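(* There is a constant $c>0$ and an integer $M_0$ such that for all integers $n\geq 2$, all integers $M\geq M_0$ and all polytopes $P_M\subset\mathbb{R}^n$ with no more than $M$ facets, $$\Delta_s(B_2^n,P_M)\geq c\,\frac{\mathrm{vol}_{n-1}(\partial B_2^n)}{M^{\frac{2}{n-1}}}.$$
   Context: $B_2^n$ denotes the closed Euclidean unit ball in $\mathbb{R}^n$; $\mathrm{vol}_{n-1}$ denotes $(n-1)$-dimensional surface measure. For convex bodies $K,L\subset\mathbb{R}^n$ the symmetric surface area deviation is $$\Delta_s(K,L)=\mathrm{vol}_{n-1}\big(\partial(K\cup L)\big)-\mathrm{vol}_{n-1}\big(\partial(K\cap L)\big).$$ No containment relation between $P_M$ and $B_2^n$ is assumed. *)

theory Defs
  imports "HOL-Analysis.Analysis"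
begin

text \<open>Euclidean n-space, for a dimension n that varies inside the statement, is
  modelled as the functions x :: nat => real vanishing at every coordinate i >= n.\<close>

definition Rn :: "nat \<Rightarrow> (nat \<Rightarrow> real) set" where
  "Rn n = {x. \<forall>i\<ge>n. x i = 0}"

definition ipr :: "nat \<Rightarrow> (nat \<Rightarrow> real) \<Rightarrow> (nat \<Rightarrow> real) \<Rightarrow> real" where
  "ipr n u v = (\<Sum>i<n. u i * v i)"

definition edist :: "nat \<Rightarrow> (nat \<Rightarrow> real) \<Rightarrow> (nat \<Rightarrow> real) \<Rightarrow> real" where
  "edist n x y = sqrt (\<Sum>i<n. (x i - y i)^2)"

definition unit_ball :: "nat \<Rightarrow> (nat \<Rightarrow> real) set" where
  "unit_ball n = {x \<in> Rn n. edist n x (\<lambda>i. 0) \<le> 1}"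

definition bdry :: "nat \<Rightarrow> (nat \<Rightarrow> real) set \<Rightarrow> (nat \<Rightarrow> real) set" where
  "bdry n S = {x \<in> Rn n. \<forall>e>0. (\<exists>y\<in>S. edist n x y < e) \<and> (\<exists>z\<in>Rn n - S. edist n x z < e)}"

definition has_interior :: "nat \<Rightarrow> (nat \<Rightarrow> real) set \<Rightarrow> bool" where
  "has_interior n S \<longleftrightarrow> (\<exists>x\<in>Rn n. \<exists>r>0. {y \<in> Rn n. edist n x y < r} \<subseteq> S)"

text \<open>Diameter (in [0,\<infinity>]) and the s-dimensional Hausdorff measure, normalised so
  that it agrees with s-dimensional surface measure (for integer s).\<close>
definition ediam :: "nat \<Rightarrow> (nat \<Rightarrow> real) set \<Rightarrow> ennreal" where
  "ediam n C = (SUP p\<in>C \<times> C. ennreal (edist n (fst p) (snd p)))"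

definition omega :: "real \<Rightarrow> real" where
  "omega s = pi powr (s / 2) / Gamma (s / 2 + 1)"

definition hausdorff_pre :: "nat \<Rightarrow> real \<Rightarrow> real \<Rightarrow> (nat \<Rightarrow> real) set \<Rightarrow> ennreal" where
  "hausdorff_pre n s \<delta> A =
     (INF C\<in>{C :: nat \<Rightarrow> (nat \<Rightarrow> real) set.
               A \<subseteq> (\<Union>j. C j) \<and> (\<forall>j. C j \<subseteq> Rn n \<and> ediam n (C j) \<le> ennreal \<delta>)}.
        \<Sum>j. ennreal (omega s * (enn2real (ediam n (C j)) / 2) powr s))"

definition hausdorff :: "nat \<Rightarrow> real \<Rightarrow> (nat \<Rightarrow> real) set \<Rightarrow> ennreal" where
  "hausdorff n s A = (SUP \<delta>\<in>{0<..}. hausdorff_pre n s \<delta> A)"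

definition surf :: "nat \<Rightarrow> (nat \<Rightarrow> real) set \<Rightarrow> real" where
  "surf n A = enn2real (hausdorff n (real n - 1) A)"

definition Delta_s :: "nat \<Rightarrow> (nat \<Rightarrow> real) set \<Rightarrow> (nat \<Rightarrow> real) set \<Rightarrow> real" where
  "Delta_s n K L = surf n (bdry n (K \<union> L)) - surf n (bdry n (K \<inter> L))"

definition polytope_n :: "nat \<Rightarrow> (nat \<Rightarrow> real) set \<Rightarrow> bool" where
  "polytope_n n P \<longleftrightarrow> (\<exists>S. finite S \<and> S \<subseteq> Rn n \<and>
     P = {x. \<exists>w. (\<forall>s\<in>S. 0 \<le> w s) \<and> sum w S = 1 \<and> x = (\<lambda>i. \<Sum>s\<in>S. w s * s i)})"

definition aff_indep_pts :: "nat \<Rightarrow> nat \<Rightarrow> (nat \<Rightarrow> real) set \<Rightarrow> bool" where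
  "aff_indep_pts n k F \<longleftrightarrow> (\<exists>p :: nat \<Rightarrow> (nat \<Rightarrow> real). (\<forall>j\<le>k. p j \<in> F) \<and>
     (\<forall>a :: nat \<Rightarrow> real. (\<forall>i<n. (\<Sum>j\<in>{1..k}. a j * (p j i - p 0 i)) = 0)
          \<longrightarrow> (\<forall>j\<in>{1..k}. a j = 0)))"

definition facet_n :: "nat \<Rightarrow> (nat \<Rightarrow> real) set \<Rightarrow> (nat \<Rightarrow> real) set \<Rightarrow> bool" where
  "facet_n n P F \<longleftrightarrow> (\<exists>u\<in>Rn n. \<exists>c. (\<exists>i<n. u i \<noteq> 0) \<and> (\<forall>x\<in>P. ipr n u x \<le> c) \<and>
       F = {x\<in>P. ipr n u x = c}) \<and> aff_indep_pts n (n - 1) F"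

end

theory Submission
  imports Defs "HOL-Library.Function_Algebras"
begin

text \<open>Let \<open>B\<close> be the unit ball, \<open>n - 1 = m\<close> and \<open>\<delta> = M powr (- 2 / m) / 16\<close>. The boundary of \<open>B \<inter> P\<close> is, up to a null set,
  the image of disjoint pieces of the boundary of \<open>B \<union> P\<close> under nonexpansive maps: a facet \<open>F\<close> inside \<open>B\<close> is
  the orthogonal projection of the part of the sphere above it, and the part of the sphere inside \<open>P\<close> is the
  radial projection of the part of the boundary of \<open>P\<close> outside \<open>B\<close>. In both cases a point \<open>x\<close> of the sphere
  corresponds to a point of a facet with outer unit normal \<open>u\<close>, and the projection contracts the surface
  measure near \<open>x\<close> at least by the factor \<open>ipr n u x\<close>. So a fraction \<open>\<delta>\<close> of the measure is lost
  wherever \<open>ipr n u x \<le> 1 - \<delta>\<close>, that is, outside the caps of height \<open>\<delta>\<close> around the at most \<open>M\<close> facet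
  normals. Each cap is a Lipschitz image of the sphere with constant \<open>2 * sqrt \<delta>\<close>, hence together the
  caps cover at most \<open>M * (2 * sqrt \<delta>) powr m \<le> 1 / 2\<close> of the sphere, and the deviation is at least
  \<open>\<delta> / 2\<close> times the measure of the sphere.

  Lebesgue measure is avoided: the contraction factor comes from the translation invariance of the Hausdorff
  measure of a hyperplane in the contracted direction, and from linearising the projections locally.\<close>

section \<open>Euclidean geometry in coordinates\<close>

text \<open>Additivity of the measure is needed only on the side of the larger boundary, where the
  pieces \<open>X F\<close> and \<open>YU\<close> are Borel. Their images under the projections are
  merely bounded from above by subadditivity, so neither measurability nor disjointness of images
  has to be shown. The gain is always expressed on the sphere: \<open>P\<close> splits the sphere
  into \<open>outer\<close> and, up to a null set, the radial image of \<open>YU\<close>, so the two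
  gains add up to \<open>\<delta>\<close> times the measure of the sphere outside the caps.
  \<open>P\<close> need not contain the origin; the inner products of normals with the relevant
  sphere points are nonnegative for other reasons, one for each of the two projections. An inner
  product may vanish, and then the linearised projection collapses a direction. Weakening the factor
  to \<open>c = 1 - \<delta>\<close>, which is at least \<open>1 / 2\<close>, keeps the model map
  invertible and lets it absorb the linearisation errors. The final constant does not depend on the
  dimension because caps are compared with the whole sphere by a Lipschitz map; no volume of a ball
  or sphere is ever computed.\<close>

definition scl :: "real \<Rightarrow> (nat \<Rightarrow> real) \<Rightarrow> nat \<Rightarrow> real"  (infixr "\<cdot>" 75)
  where "c \<cdot> x = (\<lambda>i. c * x i)"

definition nrm :: "nat \<Rightarrow> (nat \<Rightarrow> real) \<Rightarrow> real"
  where "nrm n x = sqrt (ipr n x x)"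

lemma scl_apply [simp]: "(c \<cdot> x) i = c * x i"
  by (simp add: scl_def)

lemma scl_simps [simp]: "1 \<cdot> x = x" "0 \<cdot> x = 0" "c \<cdot> (0 :: nat \<Rightarrow> real) = 0" "c \<cdot> d \<cdot> x = (c * d) \<cdot> x"
  by (auto simp: fun_eq_iff)

lemma scl_diff_right: "c \<cdot> (x - y) = c \<cdot> x - c \<cdot> y"
  and scl_add_left: "(c + d) \<cdot> x = c \<cdot> x + d \<cdot> x"
  and scl_diff_left: "(c - d) \<cdot> x = c \<cdot> x - d \<cdot> x"
  by (auto simp: fun_eq_iff algebra_simps)

lemma Rn_closed_ops [simp, intro]:
  "0 \<in> Rn n"
  "x \<in> Rn n \<Longrightarrow> y \<in> Rn n \<Longrightarrow> x + y \<in> Rn n"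
  "x \<in> Rn n \<Longrightarrow> y \<in> Rn n \<Longrightarrow> x - y \<in> Rn n"
  "x \<in> Rn n \<Longrightarrow> c \<cdot> x \<in> Rn n"
  by (auto simp: Rn_def)

lemma ipr_add_left: "ipr n (x + y) z = ipr n x z + ipr n y z"
  and ipr_diff_left: "ipr n (x - y) z = ipr n x z - ipr n y z"
  and ipr_scl_left: "ipr n (c \<cdot> x) z = c * ipr n x z"
  and ipr_add_right: "ipr n z (x + y) = ipr n z x + ipr n z y"
  and ipr_diff_right: "ipr n z (x - y) = ipr n z x - ipr n z y"
  and ipr_scl_right: "ipr n z (c \<cdot> x) = c * ipr n z x"
  by (simp_all add: ipr_def algebra_simps sum.distrib sum_subtractf sum_distrib_left)

lemma ipr_zero [simp]: "ipr n 0 x = 0" "ipr n x 0 = 0"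
  by (simp_all add: ipr_def)

lemma ipr_commute: "ipr n x y = ipr n y x"
  by (simp add: ipr_def mult.commute)

lemmas ipr_simps = ipr_add_left ipr_diff_left ipr_scl_left ipr_add_right ipr_diff_right ipr_scl_right

lemma ipr_self_nonneg [simp]: "0 \<le> ipr n x x"
  by (simp add: ipr_def sum_nonneg)

lemma nrm_nonneg [simp]: "0 \<le> nrm n x"
  by (simp add: nrm_def)

lemma nrm_sq: "(nrm n x)\<^sup>2 = ipr n x x"
  by (simp add: nrm_def)

lemma nrm_zero [simp]: "nrm n 0 = 0"
  by (simp add: nrm_def)

lemma nrm_eq_0: "x \<in> Rn n \<Longrightarrow> nrm n x = 0 \<longleftrightarrow> x = 0"
  by (auto simp: nrm_def ipr_def sum_nonneg_eq_0_iff Rn_def fun_eq_iff) (meson lessThan_iff not_less)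

lemma nrm_eq_1: "nrm n x = 1 \<longleftrightarrow> ipr n x x = 1"
  by (simp add: nrm_def)

lemma nrm_scl: "nrm n (c \<cdot> x) = \<bar>c\<bar> * nrm n x"
proof -
  have "ipr n (c \<cdot> x) (c \<cdot> x) = c\<^sup>2 * ipr n x x"
    by (simp add: ipr_simps power2_eq_square)
  then show ?thesis
    by (simp add: nrm_def real_sqrt_mult)
qed

lemma nrm_triangle: "nrm n (x + y) \<le> nrm n x + nrm n y"
  using L2_set_triangle_ineq[of x y "{..<n}"]
  by (simp add: nrm_def ipr_def L2_set_def power2_eq_square)

lemma nrm_minus_commute: "nrm n (x - y) = nrm n (y - x)"
  by (simp add: nrm_def ipr_simps)

lemma nrm_triangle_reverse: "\<bar>nrm n x - nrm n y\<bar> \<le> nrm n (x - y)"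
  using nrm_triangle[of n "x - y" y] nrm_triangle[of n "y - x" x] nrm_minus_commute[of n x y]
  by simp

lemma ipr_bound: "\<bar>ipr n x y\<bar> \<le> nrm n x * nrm n y"
proof -
  have "\<bar>ipr n x y\<bar> \<le> (\<Sum>i<n. \<bar>x i\<bar> * \<bar>y i\<bar>)"
    unfolding ipr_def by (rule order_trans[OF sum_abs]) (simp add: abs_mult)
  also have "\<dots> \<le> L2_set x {..<n} * L2_set y {..<n}"
    by (rule L2_set_mult_ineq)
  finally show ?thesis
    by (simp add: nrm_def ipr_def L2_set_def power2_eq_square)
qed

lemma edist_nrm: "edist n x y = nrm n (x - y)"
  by (simp add: edist_def nrm_def ipr_def power2_eq_square)

lemma edist_commute: "edist n x y = edist n y x"
  by (simp add: edist_nrm nrm_minus_commute)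

lemma edist_triangle: "edist n x z \<le> edist n x y + edist n y z"
  using nrm_triangle[of n "x - y" "y - z"] by (simp add: edist_nrm)

lemma edist_nonneg [simp]: "0 \<le> edist n x y"
  by (simp add: edist_nrm)

lemma edist_self [simp]: "edist n x x = 0"
  by (simp add: edist_nrm)

lemma coord_le_nrm: "i < n \<Longrightarrow> \<bar>x i\<bar> \<le> nrm n x"
  using member_le_L2_set[of "{..<n}" i "\<lambda>i. \<bar>x i\<bar>"]
  by (simp add: nrm_def ipr_def L2_set_def power2_eq_square)

lemma nrm_le_iff: "0 \<le> r \<Longrightarrow> nrm n x \<le> r \<longleftrightarrow> ipr n x x \<le> r\<^sup>2"
  unfolding nrm_def by (metis real_sqrt_le_iff real_sqrt_abs abs_of_nonneg)

lemma nrm_mono_iff: "nrm n x \<le> nrm k y \<longleftrightarrow> ipr n x x \<le> ipr k y y"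
  by (simp add: nrm_def)

text \<open>As an introduction rule it would apply to every goal about a map into \<^typ>\<open>nat \<Rightarrow> real\<close>, its own premises included.\<close>

declare continuous_on_coordinatewise_then_product [continuous_intros del]

lemma continuous_on_fun_coord:
  fixes f :: "'a::topological_space \<Rightarrow> nat \<Rightarrow> real"
  shows "continuous_on S f \<longleftrightarrow> (\<forall>i. continuous_on S (\<lambda>x. f x i))"
proof (intro iffI allI)
  fix i assume "continuous_on S f"
  then show "continuous_on S (\<lambda>x. f x i)"
    by (rule continuous_on_product_then_coordinatewise)
next
  assume "\<forall>i. continuous_on S (\<lambda>x. f x i)"
  then show "continuous_on S f"
    by (intro continuous_on_coordinatewise_then_product) blast
qed

lemma continuous_on_scl [continuous_intros]:
  "continuous_on S c \<Longrightarrow> continuous_on S f \<Longrightarrow> continuous_on S (\<lambda>x. c x \<cdot> f x)"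
  by (simp add: continuous_on_fun_coord continuous_on_mult)

lemma continuous_on_fun_add [continuous_intros]:
  fixes f g :: "_ \<Rightarrow> nat \<Rightarrow> real"
  shows "continuous_on S f \<Longrightarrow> continuous_on S g \<Longrightarrow> continuous_on S (\<lambda>x. f x + g x)"
  by (simp add: continuous_on_fun_coord continuous_on_add)

lemma continuous_on_fun_diff [continuous_intros]:
  fixes f g :: "_ \<Rightarrow> nat \<Rightarrow> real"
  shows "continuous_on S f \<Longrightarrow> continuous_on S g \<Longrightarrow> continuous_on S (\<lambda>x. f x - g x)"
  by (simp add: continuous_on_fun_coord continuous_on_diff)

lemma continuous_on_ipr [continuous_intros]:
  "continuous_on S f \<Longrightarrow> continuous_on S g \<Longrightarrow> continuous_on S (\<lambda>x. ipr n (f x) (g x))"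
  by (simp add: ipr_def continuous_on_fun_coord continuous_on_sum continuous_on_mult)

lemma continuous_on_nrm [continuous_intros]:
  "continuous_on S f \<Longrightarrow> continuous_on S (\<lambda>x. nrm n (f x))"
  unfolding nrm_def by (intro continuous_intros)

lemma continuous_on_edist [continuous_intros]:
  "continuous_on S f \<Longrightarrow> continuous_on S g \<Longrightarrow> continuous_on S (\<lambda>x. edist n (f x) (g x))"
  unfolding edist_nrm by (intro continuous_intros)

lemma closed_Rn: "closed (Rn n)"
proof -
  have "Rn n = (\<Inter>i\<in>{n..}. {x. x i = 0})"
    by (auto simp: Rn_def)
  then show ?thesis
    by (simp add: closed_INT closed_Collect_eq)
qed

lemma nrm_proj:
  assumes "ipr n u u = 1"
  shows "(nrm n (x - ipr n u x \<cdot> u))\<^sup>2 = (nrm n x)\<^sup>2 - (ipr n u x)\<^sup>2"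
proof -
  have "ipr n x u = ipr n u x"
    by (rule ipr_commute)
  then show ?thesis
    unfolding nrm_sq ipr_simps assms by (simp add: power2_eq_square)
qed

lemma nrm_proj_le:
  assumes "ipr n u u = 1"
  shows "nrm n (x - ipr n u x \<cdot> u) \<le> nrm n x"
  by (rule power2_le_imp_le) (simp_all add: nrm_proj[OF assms])

section \<open>Hausdorff measure as an outer measure\<close>

text \<open>An infinite diameter is sent to 0 by \<open>enn2real\<close>, hence the finiteness
  conditions in the lemmas below. The members of an admissible cover have diameter at most
  \<open>\<delta>\<close> and never meet this default.\<close>

definition hterm :: "nat \<Rightarrow> real \<Rightarrow> (nat \<Rightarrow> real) set \<Rightarrow> ennreal"
  where "hterm n s C = ennreal (omega s * (enn2real (ediam n C) / 2) powr s)"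

lemma omega_nonneg: "0 \<le> s \<Longrightarrow> 0 \<le> omega s"
  unfolding omega_def by (intro divide_nonneg_nonneg less_imp_le[OF Gamma_real_pos]) auto

lemma ediam_le_iff: "0 \<le> d \<Longrightarrow> ediam n C \<le> ennreal d \<longleftrightarrow> (\<forall>x\<in>C. \<forall>y\<in>C. edist n x y \<le> d)"
  by (auto simp: ediam_def SUP_le_iff)

lemma ediam_mono: "C \<subseteq> C' \<Longrightarrow> ediam n C \<le> ediam n C'"
  unfolding ediam_def by (intro SUP_subset_mono) auto

lemma ediam_empty [simp]: "ediam n {} = 0"
  by (simp add: ediam_def bot_ennreal)

lemma edist_le_ediam:
  assumes "ediam n C < top" "x \<in> C" "y \<in> C"
  shows "edist n x y \<le> enn2real (ediam n C)"
proof -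
  have "ediam n C \<le> ennreal (enn2real (ediam n C))"
    using assms by simp
  then show ?thesis
    using assms by (subst (asm) ediam_le_iff) auto
qed

lemma ediam_le_real:
  assumes "0 \<le> d" "\<And>x y. x \<in> C \<Longrightarrow> y \<in> C \<Longrightarrow> edist n x y \<le> d"
  shows "enn2real (ediam n C) \<le> d" "ediam n C \<le> ennreal d"
proof -
  show "ediam n C \<le> ennreal d"
    using assms by (simp add: ediam_le_iff)
  then show "enn2real (ediam n C) \<le> d"
    using assms(1) enn2real_leI by blast
qed

lemma hterm_empty [simp]: "hterm n s {} = 0"
  by (simp add: hterm_def)

lemma hterm_le:
  assumes "0 \<le> s" "enn2real (ediam n C) \<le> d"
  shows "hterm n s C \<le> ennreal (omega s * (d / 2) powr s)"
  unfolding hterm_def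
  by (intro ennreal_leI mult_left_mono powr_mono2 omega_nonneg) (use assms in auto)

lemma hterm_mono:
  assumes "0 \<le> s" "C \<subseteq> C'" "ediam n C' < top"
  shows "hterm n s C \<le> hterm n s C'"
  by (subst (2) hterm_def) (intro hterm_le enn2real_mono ediam_mono assms)

lemma hausdorff_pre_le:
  assumes "A \<subseteq> (\<Union>j. C j)" "\<And>j. C j \<subseteq> Rn n" "\<And>j. ediam n (C j) \<le> ennreal \<delta>"
  shows "hausdorff_pre n s \<delta> A \<le> (\<Sum>j. hterm n s (C j))"
  unfolding hausdorff_pre_def hterm_def[symmetric]
  by (rule INF_lower) (use assms in auto)

lemma hausdorff_pre_lessE:
  assumes "hausdorff_pre n s \<delta> A < e"
  obtains C :: "nat \<Rightarrow> (nat \<Rightarrow> real) set" where "A \<subseteq> (\<Union>j. C j)" "\<And>j. C j \<subseteq> Rn n"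
    "\<And>j. ediam n (C j) \<le> ennreal \<delta>" "(\<Sum>j. hterm n s (C j)) < e"
  using assms unfolding hausdorff_pre_def hterm_def[symmetric] INF_less_iff by auto

lemma le_hausdorff_pre:
  assumes "\<And>C :: nat \<Rightarrow> (nat \<Rightarrow> real) set. A \<subseteq> (\<Union>j. C j) \<Longrightarrow> (\<And>j. C j \<subseteq> Rn n) \<Longrightarrow>
    (\<And>j. ediam n (C j) \<le> ennreal \<delta>) \<Longrightarrow> b \<le> (\<Sum>j. hterm n s (C j))"
  shows "b \<le> hausdorff_pre n s \<delta> A"
  unfolding hausdorff_pre_def hterm_def[symmetric]
  by (rule INF_greatest) (use assms in auto)

lemma hausdorff_pre_mono: "A \<subseteq> B \<Longrightarrow> hausdorff_pre n s \<delta> A \<le> hausdorff_pre n s \<delta> B"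
  by (rule le_hausdorff_pre, rule hausdorff_pre_le) auto

lemma hausdorff_pre_antimono: "\<delta> \<le> \<delta>' \<Longrightarrow> hausdorff_pre n s \<delta>' A \<le> hausdorff_pre n s \<delta> A"
  by (rule le_hausdorff_pre, rule hausdorff_pre_le) (blast intro: order_trans ennreal_leI)+

lemma hausdorff_pre_le_hausdorff: "0 < \<delta> \<Longrightarrow> hausdorff_pre n s \<delta> A \<le> hausdorff n s A"
  unfolding hausdorff_def by (rule SUP_upper) auto

lemma hausdorff_le: "(\<And>\<delta>. 0 < \<delta> \<Longrightarrow> hausdorff_pre n s \<delta> A \<le> b) \<Longrightarrow> hausdorff n s A \<le> b"
  unfolding hausdorff_def by (rule SUP_least) auto

lemma hausdorff_mono: "A \<subseteq> B \<Longrightarrow> hausdorff n s A \<le> hausdorff n s B"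
  by (intro hausdorff_le order_trans[OF hausdorff_pre_mono hausdorff_pre_le_hausdorff])

lemma hausdorff_empty [simp]: "hausdorff n s {} = 0"
proof -
  have "hausdorff_pre n s \<delta> {} \<le> 0" for \<delta>
    using hausdorff_pre_le[of "{}" "\<lambda>_. {}" n \<delta> s] by simp
  then show ?thesis
    by (metis hausdorff_le le_zero_eq)
qed

text \<open>Covers of the single sets with excess \<open>e * (1/2)^Suc k\<close> are merged into one
  sequence by \<open>prod_decode\<close>; the excesses sum to \<open>e\<close>.\<close>

lemma hausdorff_pre_UN_le: "hausdorff_pre n s \<delta> (\<Union>k. A k) \<le> (\<Sum>k::nat. hausdorff_pre n s \<delta> (A k))"
proof (rule ennreal_le_epsilon)
  fix e :: real assume e: "0 < e" and fin: "(\<Sum>k. hausdorff_pre n s \<delta> (A k)) < top"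
  let ?O = "hausdorff_pre n s \<delta>"
  have lt: "?O (A k) < ?O (A k) + e * (1/2)^Suc k" for k
    using e fin by (auto simp add: less_top dest!: ennreal_suminf_lessD)
  have "\<exists>C. A k \<subseteq> (\<Union>j. C j) \<and> (\<forall>j. C j \<subseteq> Rn n \<and> ediam n (C j) \<le> ennreal \<delta>) \<and>
          (\<Sum>j. hterm n s (C j)) \<le> ?O (A k) + e * (1/2)^Suc k" for k
    by (rule hausdorff_pre_lessE[OF lt[of k]]) (meson less_imp_le)
  then obtain B where B: "\<And>k. A k \<subseteq> (\<Union>j. B k j)" "\<And>k j. B k j \<subseteq> Rn n"
      "\<And>k j. ediam n (B k j) \<le> ennreal \<delta>"
      "\<And>k. (\<Sum>j. hterm n s (B k j)) \<le> ?O (A k) + e * (1/2)^Suc k"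
    by metis
  define C where "C = case_prod B o prod_decode"
  have "(\<Union>k. A k) \<subseteq> (\<Union>i. C i)"
    using B(1) by (auto simp add: C_def subset_eq) (metis prod.case prod_encode_inverse)
  then have "?O (\<Union>k. A k) \<le> (\<Sum>i. hterm n s (C i))"
    by (rule hausdorff_pre_le) (auto simp: C_def B split: prod.split intro: subsetD[OF B(2)])
  also have "\<dots> = (\<Sum>i. ((\<lambda>(k, j). hterm n s (B k j)) (prod_decode i)))"
    by (simp add: C_def case_prod_unfold)
  also have "\<dots> = (\<Sum>k. \<Sum>j. hterm n s (B k j))"
    by (rule suminf_ennreal_2dimen) simp
  also have "\<dots> \<le> (\<Sum>k. ?O (A k) + e * (1/2) ^ Suc k)"
    by (intro suminf_le B(4)) auto
  also have "\<dots> = (\<Sum>k. ?O (A k)) + (\<Sum>k. ennreal e * ennreal ((1/2) ^ Suc k))"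
    using e by (subst suminf_add[symmetric])
               (auto simp del: ennreal_suminf_cmult simp add: ennreal_mult[symmetric])
  also have "\<dots> = (\<Sum>k. ?O (A k)) + e"
    unfolding ennreal_suminf_cmult
    by (subst suminf_ennreal_eq[OF zero_le_power power_half_series]) auto
  finally show "?O (\<Union>k. A k) \<le> (\<Sum>k. ?O (A k)) + ennreal e" .
qed

lemma hausdorff_UN_le: "hausdorff n s (\<Union>k. A k) \<le> (\<Sum>k::nat. hausdorff n s (A k))"
  by (rule hausdorff_le, rule order_trans[OF hausdorff_pre_UN_le])
     (intro suminf_le hausdorff_pre_le_hausdorff; simp)

lemma hausdorff_finite_UN_le:
  assumes "finite I"
  shows "hausdorff n s (\<Union>i\<in>I. A i) \<le> (\<Sum>i\<in>I. hausdorff n s (A i))"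
  using assms
proof (induction I)
  case (insert i I)
  let ?B = "\<lambda>k::nat. if k = 0 then A i else if k = 1 then (\<Union>i\<in>I. A i) else {}"
  have "hausdorff n s (\<Union>j\<in>insert i I. A j) \<le> hausdorff n s (\<Union>k. ?B k)"
    by (rule hausdorff_mono) (auto split: if_splits intro: exI[of _ "0::nat"] exI[of _ "1::nat"])
  also have "\<dots> \<le> (\<Sum>k. hausdorff n s (?B k))"
    by (rule hausdorff_UN_le)
  also have "\<dots> = (\<Sum>k<2. hausdorff n s (?B k))"
    by (rule suminf_finite) auto
  also have "\<dots> = hausdorff n s (A i) + hausdorff n s (\<Union>i\<in>I. A i)"
    by (simp add: numeral_2_eq_2)
  finally show ?case
    using insert by (simp add: add_left_mono order_trans)
qed simp

lemma hausdorff_Un_le: "hausdorff n s (A \<union> B) \<le> hausdorff n s A + hausdorff n s B"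
  using hausdorff_finite_UN_le[of "{False, True}" n s "\<lambda>b. if b then B else A"]
  by (simp add: Un_commute add.commute)

lemma hausdorff_relational_lipschitz:
  assumes s: "0 \<le> s" and L: "0 < L" and q: "\<And>i. i \<in> I \<Longrightarrow> q i \<in> Rn n"
    and lip: "\<And>i j. i \<in> I \<Longrightarrow> j \<in> I \<Longrightarrow> edist n (q i) (q j) \<le> L * edist n (p i) (p j)"
  shows "hausdorff n s (q ` I) \<le> ennreal (L powr s) * hausdorff n s (p ` I)"
proof (rule hausdorff_le)
  fix \<delta> :: real assume \<delta>: "0 < \<delta>"
  have "hausdorff_pre n s \<delta> (q ` I) \<le> ennreal (L powr s) * hausdorff_pre n s (\<delta> / L) (p ` I)"
  proof -
    \<comment> \<open>The factor moves to the left because an infimum is bounded from below by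
      treating one cover at a time.\<close>
    have "inverse (ennreal (L powr s)) * hausdorff_pre n s \<delta> (q ` I) \<le> hausdorff_pre n s (\<delta> / L) (p ` I)"
    proof (rule le_hausdorff_pre)
      fix C :: "nat \<Rightarrow> (nat \<Rightarrow> real) set"
      assume C: "p ` I \<subseteq> (\<Union>j. C j)" "\<And>j. C j \<subseteq> Rn n" "\<And>j. ediam n (C j) \<le> ennreal (\<delta> / L)"
      define D where "D j = q ` {i \<in> I. p i \<in> C j}" for j
      have fin: "ediam n (C j) < top" for j
        using C(3)[of j] by (simp add: order_le_less_trans)
      have dist: "edist n x y \<le> L * enn2real (ediam n (C j))" if xy: "x \<in> D j" "y \<in> D j" for x y j
      proof -
        obtain i k where ik: "i \<in> I" "k \<in> I" "p i \<in> C j" "p k \<in> C j" "x = q i" "y = q k"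
          using xy unfolding D_def by blast
        then have "edist n x y \<le> L * edist n (p i) (p k)"
          using lip by simp
        also have "\<dots> \<le> L * enn2real (ediam n (C j))"
          using ik L edist_le_ediam[OF fin] by (intro mult_left_mono) auto
        finally show ?thesis .
      qed
      have dC: "enn2real (ediam n (C j)) \<le> \<delta> / L" for j
        using C(3)[of j] \<delta> L by (intro enn2real_leI) auto
      have "hausdorff_pre n s \<delta> (q ` I) \<le> (\<Sum>j. hterm n s (D j))"
      proof (rule hausdorff_pre_le)
        show "q ` I \<subseteq> (\<Union>j. D j)" using C(1) unfolding D_def by blast
        show "D j \<subseteq> Rn n" for j using q by (auto simp: D_def)
        show "ediam n (D j) \<le> ennreal \<delta>" for j
          using dist[of _ j] dC[of j] L \<delta>
          by (intro ediam_le_real(2)) (auto simp: field_simps intro: order_trans)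
      qed
      also have "\<dots> \<le> (\<Sum>j. ennreal (L powr s) * hterm n s (C j))"
      proof (intro suminf_le)
        fix j
        have "hterm n s (D j) \<le> ennreal (omega s * (L * enn2real (ediam n (C j)) / 2) powr s)"
          using dist L by (intro hterm_le s ediam_le_real(1)) auto
        also have "\<dots> = ennreal (L powr s * (omega s * (enn2real (ediam n (C j)) / 2) powr s))"
          using L powr_mult[of L "enn2real (ediam n (C j)) / 2" s] by (simp add: mult_ac)
        also have "\<dots> = ennreal (L powr s) * hterm n s (C j)"
          unfolding hterm_def using omega_nonneg[OF s] by (simp add: ennreal_mult)
        finally show "hterm n s (D j) \<le> ennreal (L powr s) * hterm n s (C j)" .
      qed auto
      finally have "hausdorff_pre n s \<delta> (q ` I) \<le> ennreal (L powr s) * (\<Sum>j. hterm n s (C j))"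
        by simp
      then have "inverse (ennreal (L powr s)) * hausdorff_pre n s \<delta> (q ` I) \<le>
          inverse (ennreal (L powr s)) * (ennreal (L powr s) * (\<Sum>j. hterm n s (C j)))"
        by (rule mult_left_mono) simp
      also have "\<dots> = (\<Sum>j. hterm n s (C j))"
        using L by (simp add: mult.assoc[symmetric] inverse_ennreal flip: ennreal_mult)
      finally show "inverse (ennreal (L powr s)) * hausdorff_pre n s \<delta> (q ` I) \<le> (\<Sum>j. hterm n s (C j))" .
    qed
    then have "ennreal (L powr s) * (inverse (ennreal (L powr s)) * hausdorff_pre n s \<delta> (q ` I)) \<le>
        ennreal (L powr s) * hausdorff_pre n s (\<delta> / L) (p ` I)"
      by (rule mult_left_mono) simp
    then show ?thesis
      using L by (simp add: mult.assoc[symmetric] inverse_ennreal flip: ennreal_mult)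
  qed
  also have "\<dots> \<le> ennreal (L powr s) * hausdorff n s (p ` I)"
    using \<delta> L by (intro mult_left_mono hausdorff_pre_le_hausdorff) auto
  finally show "hausdorff_pre n s \<delta> (q ` I) \<le> ennreal (L powr s) * hausdorff n s (p ` I)" .
qed

lemma hausdorff_lipschitz_image:
  assumes "0 \<le> s" "0 < L" "\<And>x. x \<in> A \<Longrightarrow> f x \<in> Rn n"
    and "\<And>x y. x \<in> A \<Longrightarrow> y \<in> A \<Longrightarrow> edist n (f x) (f y) \<le> L * edist n x y"
  shows "hausdorff n s (f ` A) \<le> ennreal (L powr s) * hausdorff n s A"
  using hausdorff_relational_lipschitz[of s L A f n "\<lambda>x. x"] assms by simp

lemma hausdorff_nonexpansive_image:
  assumes "0 \<le> s" "\<And>x. x \<in> A \<Longrightarrow> f x \<in> Rn n"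
    and "\<And>x y. x \<in> A \<Longrightarrow> y \<in> A \<Longrightarrow> edist n (f x) (f y) \<le> edist n x y"
  shows "hausdorff n s (f ` A) \<le> hausdorff n s A"
  using hausdorff_lipschitz_image[of s 1 A f n] assms by simp

text \<open>Along a monotone sequence of scales the supremum of a sum is the sum of the suprema
  (\<open>ennreal_SUP_add\<close>).\<close>

lemma hausdorff_seq: "hausdorff n s A = (SUP k. hausdorff_pre n s (inverse (real (Suc k))) A)"
proof (rule antisym)
  show "hausdorff n s A \<le> (SUP k. hausdorff_pre n s (inverse (real (Suc k))) A)"
  proof (rule hausdorff_le)
    fix \<delta> :: real assume "0 < \<delta>"
    then obtain k where "inverse (real (Suc k)) < \<delta>"
      using reals_Archimedean by blast
    then have "hausdorff_pre n s \<delta> A \<le> hausdorff_pre n s (inverse (real (Suc k))) A"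
      by (intro hausdorff_pre_antimono) simp
    then show "hausdorff_pre n s \<delta> A \<le> (SUP k. hausdorff_pre n s (inverse (real (Suc k))) A)"
      by (meson SUP_upper UNIV_I order_trans)
  qed
  show "(SUP k. hausdorff_pre n s (inverse (real (Suc k))) A) \<le> hausdorff n s A"
    by (intro SUP_least hausdorff_pre_le_hausdorff) simp
qed

text \<open>At scales below \<open>d\<close> no member of a cover meets both sets, so each cover
  splits into a cover of \<open>A\<close> and one of \<open>B\<close>.\<close>

lemma hausdorff_separated_add:
  assumes s: "0 \<le> s" and d: "0 < d" and sep: "\<And>x y. x \<in> A \<Longrightarrow> y \<in> B \<Longrightarrow> d \<le> edist n x y"
  shows "hausdorff n s A + hausdorff n s B \<le> hausdorff n s (A \<union> B)"
proof -
  have small: "hausdorff_pre n s \<delta> A + hausdorff_pre n s \<delta> B \<le> hausdorff_pre n s \<delta> (A \<union> B)"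
    if \<delta>: "0 < \<delta>" "\<delta> < d" for \<delta>
  proof (rule le_hausdorff_pre)
    fix C :: "nat \<Rightarrow> (nat \<Rightarrow> real) set"
    assume C: "A \<union> B \<subseteq> (\<Union>j. C j)" "\<And>j. C j \<subseteq> Rn n" "\<And>j. ediam n (C j) \<le> ennreal \<delta>"
    have fin: "ediam n (C j) < top" for j
      using C(3)[of j] by (simp add: order_le_less_trans)
    have le: "ediam n (C j \<inter> X) \<le> ennreal \<delta>" for j X
      by (rule order_trans[OF ediam_mono C(3)]) auto
    have "hausdorff_pre n s \<delta> A \<le> (\<Sum>j. hterm n s (C j \<inter> A))"
      "hausdorff_pre n s \<delta> B \<le> (\<Sum>j. hterm n s (C j \<inter> B))"
      using C(1,2) le by (intro hausdorff_pre_le; auto)+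
    then have "hausdorff_pre n s \<delta> A + hausdorff_pre n s \<delta> B \<le>
        (\<Sum>j. hterm n s (C j \<inter> A)) + (\<Sum>j. hterm n s (C j \<inter> B))"
      by (rule add_mono)
    also have "\<dots> = (\<Sum>j. hterm n s (C j \<inter> A) + hterm n s (C j \<inter> B))"
      by (rule suminf_add) auto
    also have "\<dots> \<le> (\<Sum>j. hterm n s (C j))"
    proof (intro suminf_le)
      fix j
      have "C j \<inter> A = {} \<or> C j \<inter> B = {}"
      proof (rule ccontr)
        assume "\<not> ?thesis"
        then obtain x y where xy: "x \<in> C j" "x \<in> A" "y \<in> C j" "y \<in> B"
          by auto
        then have "edist n x y \<le> \<delta>"
          using C(3)[of j] \<delta> by (subst (asm) ediam_le_iff) auto
        then show False
          using sep[OF xy(2,4)] \<delta> by simp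
      qed
      then show "hterm n s (C j \<inter> A) + hterm n s (C j \<inter> B) \<le> hterm n s (C j)"
        using hterm_mono[OF s _ fin, of "C j \<inter> A"] hterm_mono[OF s _ fin, of "C j \<inter> B"] by auto
    qed auto
    finally show "hausdorff_pre n s \<delta> A + hausdorff_pre n s \<delta> B \<le> (\<Sum>j. hterm n s (C j))" .
  qed
  have inc: "incseq (\<lambda>k. hausdorff_pre n s (inverse (real (Suc k))) X)" for X
    by (intro incseq_SucI hausdorff_pre_antimono) (simp add: field_simps)
  have "hausdorff n s A + hausdorff n s B =
      (SUP k. hausdorff_pre n s (inverse (real (Suc k))) A + hausdorff_pre n s (inverse (real (Suc k))) B)"
    unfolding hausdorff_seq by (rule ennreal_SUP_add[symmetric, OF inc inc])
  also have "\<dots> \<le> hausdorff n s (A \<union> B)"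
  proof (rule SUP_least)
    fix k :: nat
    let ?e = "inverse (real (Suc k))"
    have "hausdorff_pre n s ?e A + hausdorff_pre n s ?e B \<le>
        hausdorff_pre n s (min ?e (d / 2)) A + hausdorff_pre n s (min ?e (d / 2)) B"
      by (intro add_mono hausdorff_pre_antimono) auto
    also have "\<dots> \<le> hausdorff_pre n s (min ?e (d / 2)) (A \<union> B)"
      using d by (intro small) auto
    also have "\<dots> \<le> hausdorff n s (A \<union> B)"
      using d by (intro hausdorff_pre_le_hausdorff) auto
    finally show "hausdorff_pre n s ?e A + hausdorff_pre n s ?e B \<le> hausdorff n s (A \<union> B)" .
  qed
  finally show ?thesis .
qed

section \<open>Borel sets are measurable\<close>

text \<open>Consecutive slabs touch, but every second one is at positive distance from the previous ones, so the
  measures add up. Hence the slabs accumulating at a bounding hyperplane have a summable measure, which is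
  the key to the measurability of half-spaces.\<close>

lemma hausdorff_slab_sum_le:
  assumes s: "0 \<le> s" and i: "i < n" and t: "\<And>k :: nat. t (Suc k) < (t k :: real)"
  shows "(\<Sum>k<K. hausdorff n s (A \<inter> {x. t (Suc (2 * k + p)) \<le> x i \<and> x i < t (2 * k + p)}))
    \<le> hausdorff n s (\<Union>k<K. A \<inter> {x. t (Suc (2 * k + p)) \<le> x i \<and> x i < t (2 * k + p)})"
proof (induction K)
  case (Suc K)
  let ?R = "\<lambda>k. A \<inter> {x. t (Suc (2 * k + p)) \<le> x i \<and> x i < t (2 * k + p)}"
  have anti: "t k' \<le> t k" if "k \<le> k'" for k k'
    by (rule lift_Suc_antimono_le[where f = t, OF less_imp_le[OF t] that])
  have "hausdorff n s (\<Union>k<K. ?R k) + hausdorff n s (?R K) \<le> hausdorff n s ((\<Union>k<K. ?R k) \<union> ?R K)"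
  proof (cases "K = 0")
    case False
    \<comment> \<open>\<open>a\<close> is the lower end of the last earlier slab and
      \<open>b\<close> the upper end of the new one; the skipped slab between them provides the gap
      \<open>a - b\<close>.\<close>
    define a where "a = t (Suc (2 * (K - 1) + p))"
    define b where "b = t (2 * K + p)"
    have "b < a"
      using False t[of "Suc (2 * (K - 1) + p)"] by (simp add: a_def b_def) (cases K; simp)
    show ?thesis
    proof (rule hausdorff_separated_add[OF s])
      show "0 < a - b" using \<open>b < a\<close> by simp
      fix x y assume xy: "x \<in> (\<Union>k<K. ?R k)" "y \<in> ?R K"
      then obtain k where k: "k < K" "x \<in> ?R k" by blast
      have "a \<le> t (Suc (2 * k + p))"
        unfolding a_def using k by (intro anti) simp
      then have "a - b \<le> (x - y) i"
        using k xy(2) by (simp add: b_def)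
      then show "a - b \<le> edist n x y"
        using coord_le_nrm[OF i, of "x - y"] by (simp add: edist_nrm)
    qed
  qed simp
  then have "(\<Sum>k<K. hausdorff n s (?R k)) + hausdorff n s (?R K) \<le> hausdorff n s ((\<Union>k<K. ?R k) \<union> ?R K)"
    by (rule order_trans[OF add_right_mono[OF Suc]])
  moreover have "(\<Union>k<Suc K. ?R k) = (\<Union>k<K. ?R k) \<union> ?R K"
    unfolding lessThan_Suc by blast
  ultimately show ?case
    by (simp only: sum.lessThan_Suc)
qed simp

lemma suminf_le_even_odd:
  fixes f :: "nat \<Rightarrow> ennreal"
  assumes "\<And>K. (\<Sum>k<K. f (2 * k)) \<le> c" "\<And>K. (\<Sum>k<K. f (Suc (2 * k))) \<le> c"
  shows "suminf f \<le> 2 * c"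
proof -
  have even: "(\<Sum>k<2 * K. f k) = (\<Sum>k<K. f (2 * k)) + (\<Sum>k<K. f (Suc (2 * k)))" for K
    by (induction K) (auto simp: add_ac)
  have "(\<Sum>k<K. f k) \<le> 2 * c" for K
  proof -
    have "(\<Sum>k<K. f k) \<le> (\<Sum>k<2 * K. f k)"
      by (intro sum_mono2) auto
    also have "\<dots> \<le> c + c"
      unfolding even by (intro add_mono assms)
    finally show ?thesis by (simp add: mult_2)
  qed
  then show ?thesis
    by (intro suminf_le_const) auto
qed

lemma ennreal_suminf_tail:
  fixes f :: "nat \<Rightarrow> ennreal" and e :: real
  assumes "suminf f < top" "0 < e"
  obtains N where "(\<Sum>k. f (k + N)) \<le> ennreal e"
proof -
  have fin: "f k < top" for k
    using assms(1) by (rule ennreal_suminf_lessD)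
  define r where "r k = enn2real (f k)" for k
  have r: "f k = ennreal (r k)" "0 \<le> r k" for k
    using fin by (simp_all add: r_def)
  have f: "f = (\<lambda>k. ennreal (r k))"
    using r(1) by auto
  have "summable r"
    using assms(1) r(2) unfolding f by (intro summable_suminf_not_top) auto
  from suminf_exist_split[OF assms(2) this] obtain N where "norm (\<Sum>k. r (k + N)) < e"
    by auto
  moreover have "(\<Sum>k. f (k + N)) = ennreal (\<Sum>k. r (k + N))"
    unfolding r(1) using \<open>summable r\<close> r(2) by (intro suminf_ennreal2) auto
  ultimately have "(\<Sum>k. f (k + N)) \<le> ennreal e"
    by (auto intro!: ennreal_leI)
  then show ?thesis by (rule that)
qed

text \<open>This is the Caratheodory condition for a coordinate half-space. The part with
  \<open>x i \<le> a\<close> has positive distance from the part with \<open>t N \<le> x i\<close>,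
  and what lies between is the union of the slabs \<open>R (k + N)\<close>, whose measures form the
  tail of a convergent series.\<close>

lemma hausdorff_halfspace_split:
  assumes s: "0 \<le> s" and A: "A \<subseteq> Rn n"
  shows "hausdorff n s (A \<inter> {x. x i \<le> a}) + hausdorff n s (A \<inter> {x. a < x i}) \<le> hausdorff n s A"
proof (cases "i < n")
  \<comment> \<open>Borel sets of the function type constrain all coordinates, also those with
    \<open>n \<le> i\<close>, which vanish on \<open>Rn n\<close>.\<close>
  case False
  then have zero: "x i = 0" if "x \<in> A" for x
    using A that by (auto simp: Rn_def)
  have "A \<inter> {x. x i \<le> a} = (if 0 \<le> a then A else {})" "A \<inter> {x. a < x i} = (if 0 \<le> a then {} else A)"
    by (auto dest: zero)
  then show ?thesis by simp
next
  case i: True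
  define t where "t k = a + inverse (real (Suc k))" for k
  define R where "R k = A \<inter> {x. t (Suc k) \<le> x i \<and> x i < t k}" for k
  define W where "W = A \<inter> {x. x i \<le> a}"
  have t: "t (Suc k) < t k" for k
    by (simp add: t_def)
  have sep: "hausdorff n s W + hausdorff n s (A \<inter> {x. t N \<le> x i}) \<le> hausdorff n s A" for N
  proof -
    have "hausdorff n s W + hausdorff n s (A \<inter> {x. t N \<le> x i}) \<le> hausdorff n s (W \<union> (A \<inter> {x. t N \<le> x i}))"
    proof (rule hausdorff_separated_add[OF s])
      show "0 < inverse (real (Suc N))" by simp
      fix x y assume "x \<in> W" "y \<in> A \<inter> {x. t N \<le> x i}"
      then have "inverse (real (Suc N)) \<le> (y - x) i"
        by (simp add: W_def t_def)
      then show "inverse (real (Suc N)) \<le> edist n x y"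
        using coord_le_nrm[OF i, of "y - x"] by (simp add: edist_nrm nrm_minus_commute)
    qed
    also have "\<dots> \<le> hausdorff n s A"
      by (rule hausdorff_mono) (auto simp: W_def)
    finally show ?thesis .
  qed
  show ?thesis
  proof (rule ennreal_le_epsilon)
    fix e :: real assume fin: "hausdorff n s A < top" and e: "0 < e"
    have le: "(\<Sum>k<K. hausdorff n s (R (2 * k + p))) \<le> hausdorff n s A" for K p
      unfolding R_def by (rule order_trans[OF hausdorff_slab_sum_le[where t = t, OF s i t] hausdorff_mono]) auto
    have "(\<Sum>k. hausdorff n s (R k)) \<le> 2 * hausdorff n s A"
      using le[of 0] le[of 1] by (intro suminf_le_even_odd) simp_all
    also have "\<dots> < top"
      using fin by (simp add: ennreal_mult_less_top)
    finally obtain N where N: "(\<Sum>k. hausdorff n s (R (k + N))) \<le> ennreal e"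
      using e by (rule ennreal_suminf_tail)
    have cover: "A \<inter> {x. a < x i} \<subseteq> (A \<inter> {x. t N \<le> x i}) \<union> (\<Union>k. R (k + N))"
    proof
      fix x assume x: "x \<in> A \<inter> {x. a < x i}"
      show "x \<in> (A \<inter> {x. t N \<le> x i}) \<union> (\<Union>k. R (k + N))"
      proof (cases "t N \<le> x i")
        case False
        have "\<exists>m. t m \<le> x i"
          using x reals_Archimedean[of "x i - a"] by (auto simp: t_def algebra_simps intro: less_imp_le)
        define m where "m = (LEAST m. t m \<le> x i)"
        have m: "t m \<le> x i" "\<And>j. j < m \<Longrightarrow> x i < t j"
          using \<open>\<exists>m. t m \<le> x i\<close> unfolding m_def by (auto intro: LeastI dest: not_less_Least)
        have "t k' \<le> t k" if "k \<le> k'" for k k'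
          by (rule lift_Suc_antimono_le[where f = t, OF less_imp_le[OF t] that])
        then have "N < m"
          using m(1) False by (meson not_le order_trans)
        then obtain j where "m = Suc (j + N)"
          using less_imp_Suc_add by (metis add.commute)
        then have "x \<in> R (j + N)"
          using m x by (simp add: R_def)
        then show ?thesis by blast
      qed (use x in auto)
    qed
    have "hausdorff n s (A \<inter> {x. a < x i}) \<le>
        hausdorff n s (A \<inter> {x. t N \<le> x i}) + (\<Sum>k. hausdorff n s (R (k + N)))"
      by (intro order_trans[OF hausdorff_mono[OF cover]] order_trans[OF hausdorff_Un_le] add_left_mono hausdorff_UN_le)
    then have "hausdorff n s W + hausdorff n s (A \<inter> {x. a < x i}) \<le>
        hausdorff n s W + (hausdorff n s (A \<inter> {x. t N \<le> x i}) + ennreal e)"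
      using N by (intro add_left_mono) (meson add_left_mono order_trans)
    also have "\<dots> \<le> hausdorff n s A + ennreal e"
      using sep[of N] by (simp add: add.assoc[symmetric] add_right_mono)
    finally show "hausdorff n s (A \<inter> {x. x i \<le> a}) + hausdorff n s (A \<inter> {x. a < x i}) \<le> hausdorff n s A + ennreal e"
      by (simp add: W_def)
  qed
qed

text \<open>A set that is not contained in \<open>Rn n\<close> has no admissible cover, so its Hausdorff measure is infinite;
  the intersection with \<open>Rn n\<close> discards the junk part of the type.\<close>

definition hmeas :: "nat \<Rightarrow> real \<Rightarrow> (nat \<Rightarrow> real) measure"
  where "hmeas n s = measure_of UNIV (sets borel) (\<lambda>A. hausdorff n s (A \<inter> Rn n))"

lemma sets_hmeas [simp, measurable_cong]: "sets (hmeas n s) = sets borel"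
  and space_hmeas [simp]: "space (hmeas n s) = UNIV"
  using sets.sigma_sets_eq[of "borel :: (nat \<Rightarrow> real) measure"]
  by (simp_all add: hmeas_def sets_measure_of_conv space_measure_of_conv)

text \<open>Caratheodory's construction gives a measure on the sets that split every set additively.
  These contain all coordinate half-spaces, and therefore all Borel sets.\<close>

lemma measure_space_hausdorff:
  assumes s: "0 \<le> s"
  shows "measure_space UNIV (sets borel) (\<lambda>A. hausdorff n s (A \<inter> Rn n))"
proof -
  let ?f = "\<lambda>A. hausdorff n s (A \<inter> Rn n)"
  define L where "L = lambda_system UNIV UNIV ?f"
  have "countably_subadditive UNIV ?f"
    unfolding countably_subadditive_def using hausdorff_UN_le[of n s "\<lambda>k. _ k \<inter> Rn n"]
    by (simp add: UN_extend_simps del: UN_simps)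
  then have oms: "outer_measure_space UNIV ?f"
    by (auto simp: outer_measure_space_def positive_def increasing_def intro!: hausdorff_mono)
  interpret S: sigma_algebra UNIV "UNIV :: (nat \<Rightarrow> real) set set"
    by (metis Pow_UNIV sigma_algebra_Pow)
  have ms: "measure_space UNIV L ?f"
    unfolding L_def by (rule S.caratheodory_lemma[OF oms])
  then have sa: "sigma_algebra UNIV L"
    by (simp add: measure_space_def)
  let ?N = "sigma UNIV L"
  have sets_N: "sets ?N = L"
    using sa by (rule sigma_algebra.sets_measure_of_eq)
  have half: "{x. x i \<le> a} \<in> L" for i a
    unfolding L_def lambda_system_def
  proof (intro CollectI conjI ballI antisym)
    fix X :: "(nat \<Rightarrow> real) set"
    have *: "{x. x i \<le> a} \<inter> X \<inter> Rn n = (X \<inter> Rn n) \<inter> {x. x i \<le> a}"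
      "(UNIV - {x. x i \<le> a}) \<inter> X \<inter> Rn n = (X \<inter> Rn n) \<inter> {x. a < x i}"
      by auto
    show "?f ({x. x i \<le> a} \<inter> X) + ?f ((UNIV - {x. x i \<le> a}) \<inter> X) \<le> ?f X"
      unfolding * by (rule hausdorff_halfspace_split[OF s]) simp
    have "X \<inter> Rn n = ({x. x i \<le> a} \<inter> X \<inter> Rn n) \<union> ((UNIV - {x. x i \<le> a}) \<inter> X \<inter> Rn n)"
      by auto
    then show "?f X \<le> ?f ({x. x i \<le> a} \<inter> X) + ?f ((UNIV - {x. x i \<le> a}) \<inter> X)"
      by (metis hausdorff_Un_le)
  qed simp
  \<comment> \<open>The Borel sets of the countable product are generated by the coordinates, so
    measurability of the identity is a coordinatewise statement about half-lines.\<close>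
  have "(\<lambda>x. x) \<in> borel_measurable ?N"
    by (rule measurable_coordinatewise_then_product)
       (simp add: borel_measurable_iff_le sets_N half space_measure_of_conv)
  then have sub: "sets borel \<subseteq> L"
    using measurable_sets[of "\<lambda>x. x" ?N borel] sets_N by (auto simp: space_measure_of_conv)
  show ?thesis
    using ms sub sets.sigma_algebra_axioms[of "borel :: (nat \<Rightarrow> real) measure"]
    unfolding measure_space_def countably_additive_def positive_def by auto
qed

lemma emeasure_hmeas:
  assumes "0 \<le> s" "A \<in> sets borel"
  shows "emeasure (hmeas n s) A = hausdorff n s (A \<inter> Rn n)"
  unfolding hmeas_def using measure_space_hausdorff[OF assms(1), of n] assms(2)
  by (intro emeasure_measure_of_sigma) (auto simp: measure_space_def)

lemma hausdorff_add_borel: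
  assumes s: "0 \<le> s" and A: "A \<subseteq> Rn n" "A \<in> sets borel" and B: "B \<in> sets borel"
  shows "hausdorff n s A = hausdorff n s (A \<inter> B) + hausdorff n s (A - B)"
proof -
  have "emeasure (hmeas n s) A = emeasure (hmeas n s) (A \<inter> B) + emeasure (hmeas n s) (A - B)"
    using A B by (subst plus_emeasure) (auto simp: Int_Diff_Un)
  moreover have "A \<inter> B \<inter> Rn n = A \<inter> B" "(A - B) \<inter> Rn n = A - B" "A \<inter> Rn n = A"
    using A by auto
  ultimately show ?thesis
    using A B by (simp add: emeasure_hmeas[OF s])
qed

lemma hausdorff_sums_borel:
  assumes s: "0 \<le> s" and A: "\<And>k. A k \<subseteq> Rn n" "\<And>k. A k \<in> sets borel" and d: "disjoint_family A"
  shows "hausdorff n s (\<Union>k. A k) = (\<Sum>k::nat. hausdorff n s (A k))"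
proof -
  have "(\<Sum>k. emeasure (hmeas n s) (A k)) = emeasure (hmeas n s) (\<Union>k. A k)"
    using A d by (intro suminf_emeasure) auto
  moreover have "A k \<inter> Rn n = A k" "(\<Union>k. A k) \<inter> Rn n = (\<Union>k. A k)" for k
    using A(1) by auto
  ultimately show ?thesis
    using A by (simp add: emeasure_hmeas[OF s])
qed

lemma hausdorff_finite_sum_borel:
  assumes s: "0 \<le> s" and I: "finite I" and A: "\<And>i. i \<in> I \<Longrightarrow> A i \<subseteq> Rn n" "\<And>i. i \<in> I \<Longrightarrow> A i \<in> sets borel"
    and d: "disjoint_family_on A I"
  shows "hausdorff n s (\<Union>i\<in>I. A i) = (\<Sum>i\<in>I. hausdorff n s (A i))"
proof -
  have "(\<Sum>i\<in>I. emeasure (hmeas n s) (A i)) = emeasure (hmeas n s) (\<Union>i\<in>I. A i)"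
    using A d I by (intro sum_emeasure) auto
  moreover have "A i \<inter> Rn n = A i" "(\<Union>i\<in>I. A i) \<inter> Rn n = (\<Union>i\<in>I. A i)" if "i \<in> I" for i
    using A(1) that by auto
  moreover have "(\<Union>i\<in>I. A i) \<inter> Rn n = (\<Union>i\<in>I. A i)"
    using A(1) by auto
  moreover have "(\<Union>i\<in>I. A i) \<in> sets borel"
    using I A(2) by (intro sets.finite_UN) auto
  ultimately show ?thesis
    using A by (simp add: emeasure_hmeas[OF s] cong: sum.cong)
qed

section \<open>Borel hulls of equal Hausdorff measure\<close>

lemma ediam_closure_le:
  assumes "0 \<le> d" "ediam n C \<le> ennreal d"
  shows "ediam n (closure C) \<le> ennreal d"
proof -
  have C: "edist n x y \<le> d" if "x \<in> C" "y \<in> C" for x y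
    using assms that by (simp add: ediam_le_iff)
  have cl: "closed {y. edist n x y \<le> d}" for x
    by (intro closed_Collect_le continuous_intros)
  have 1: "edist n x y \<le> d" if "x \<in> C" "y \<in> closure C" for x y
    using closure_minimal[OF _ cl[of x], of C] C that by blast
  have 2: "edist n x y \<le> d" if "x \<in> closure C" "y \<in> closure C" for x y
  proof -
    have "C \<subseteq> {y. edist n x y \<le> d}"
      using 1[OF _ that(1)] edist_commute[of n x] by auto
    then show ?thesis
      using closure_minimal[OF _ cl[of x]] that(2) by blast
  qed
  then show ?thesis
    using assms(1) by (simp add: ediam_le_iff)
qed

lemma ediam_closure:
  assumes "ediam n C < top"
  shows "ediam n (closure C) = ediam n C"
proof (rule antisym)
  have "ediam n C = ennreal (enn2real (ediam n C))"
    using assms by simp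
  then show "ediam n (closure C) \<le> ediam n C"
    by (metis ediam_closure_le enn2real_nonneg order_refl)
qed (intro ediam_mono closure_subset)

text \<open>Passing to closures does not change diameters, so nearly optimal covers at the scales
  \<open>1 / (k + 1)\<close> may be taken closed; the intersection over \<open>k\<close> of their
  unions is covered as cheaply as \<open>A\<close>. For infinite measure \<open>Rn n\<close> itself
  serves.\<close>

lemma hausdorff_borel_hull:
  assumes s: "0 \<le> s" and A: "A \<subseteq> Rn n"
  obtains G where "G \<in> sets borel" "A \<subseteq> G" "G \<subseteq> Rn n" "hausdorff n s G = hausdorff n s A"
proof (cases "hausdorff n s A = top")
  case True
  have "hausdorff n s (Rn n) = top"
    using hausdorff_mono[OF A, of n s] True by (simp add: top_unique)
  then show ?thesis
    using A True closed_Rn by (intro that[of "Rn n"]) auto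
next
  case False
  let ?d = "\<lambda>k. inverse (real (Suc k))"
  have "\<exists>C. A \<subseteq> (\<Union>j::nat. C j) \<and> (\<forall>j. C j \<subseteq> Rn n \<and> ediam n (C j) \<le> ennreal (?d k)) \<and>
      (\<Sum>j. hterm n s (C j)) \<le> hausdorff n s A + ennreal (?d k)" for k
  proof -
    have "hausdorff_pre n s (?d k) A \<le> hausdorff n s A"
      by (rule hausdorff_pre_le_hausdorff) simp
    also have "\<dots> < hausdorff n s A + ennreal (?d k)"
      using False by (simp add: less_top)
    finally show ?thesis
      by (rule hausdorff_pre_lessE) (meson less_imp_le)
  qed
  then obtain C where C: "\<And>k. A \<subseteq> (\<Union>j::nat. C k j)" "\<And>k j. C k j \<subseteq> Rn n"
      "\<And>k j. ediam n (C k j) \<le> ennreal (?d k)" "\<And>k. (\<Sum>j. hterm n s (C k j)) \<le> hausdorff n s A + ennreal (?d k)"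
    by metis
  define G where "G = (\<Inter>k. \<Union>j. closure (C k j))"
  have fin: "ediam n (C k j) < top" for k j
    using C(3)[of k j] by (simp add: order_le_less_trans)
  have sub: "closure (C k j) \<subseteq> Rn n" for k j
    by (intro closure_minimal C(2) closed_Rn)
  have AG: "A \<subseteq> G"
    unfolding G_def
  proof (intro INT_greatest)
    fix k
    have "(\<Union>j. C k j) \<subseteq> (\<Union>j. closure (C k j))"
      by (intro UN_mono closure_subset) simp
    then show "A \<subseteq> (\<Union>j. closure (C k j))"
      using C(1)[of k] by (rule order_trans[rotated])
  qed
  have "hausdorff n s G \<le> hausdorff n s A"
  proof (rule hausdorff_le, rule ennreal_le_epsilon)
    fix \<delta> e :: real assume "0 < \<delta>" "0 < e"
    then obtain k where k: "?d k < min \<delta> e"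
      using reals_Archimedean[of "min \<delta> e"] by auto
    have "hausdorff_pre n s \<delta> G \<le> hausdorff_pre n s (?d k) G"
      using k by (intro hausdorff_pre_antimono) simp
    also have "\<dots> \<le> (\<Sum>j. hterm n s (closure (C k j)))"
      using sub by (intro hausdorff_pre_le ediam_closure_le C(3)) (auto simp: G_def)
    also have "\<dots> = (\<Sum>j. hterm n s (C k j))"
      by (simp add: hterm_def ediam_closure[OF fin])
    also have "\<dots> \<le> hausdorff n s A + ennreal (?d k)"
      by (rule C(4))
    also have "\<dots> \<le> hausdorff n s A + ennreal e"
      using k by (intro add_left_mono ennreal_leI) simp
    finally show "hausdorff_pre n s \<delta> G \<le> hausdorff n s A + ennreal e" .
  qed
  then have "hausdorff n s G = hausdorff n s A"
    using hausdorff_mono[OF AG, of n s] by (rule antisym)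
  moreover have "G \<in> sets borel"
    unfolding G_def by measurable
  moreover have "G \<subseteq> Rn n"
    unfolding G_def using sub by blast
  ultimately show ?thesis
    using AG that by blast
qed

section \<open>Spheres and discs have finite surface measure\<close>

abbreviation hsf :: "nat \<Rightarrow> (nat \<Rightarrow> real) set \<Rightarrow> ennreal"
  where "hsf n \<equiv> hausdorff n (real n - 1)"

definition esphere :: "nat \<Rightarrow> (nat \<Rightarrow> real) set"
  where "esphere n = {x \<in> Rn n. nrm n x = 1}"

definition radial :: "nat \<Rightarrow> (nat \<Rightarrow> real) \<Rightarrow> nat \<Rightarrow> real"
  where "radial n x = (1 / nrm n x) \<cdot> x"

lemma radial_Rn [simp]: "x \<in> Rn n \<Longrightarrow> radial n x \<in> Rn n"
  by (simp add: radial_def)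

lemma nrm_radial: "nrm n x \<noteq> 0 \<Longrightarrow> nrm n (radial n x) = 1"
  by (simp add: radial_def nrm_scl)

lemma nrm_scl_radial: "nrm n x \<noteq> 0 \<Longrightarrow> nrm n x \<cdot> radial n x = x"
  by (simp add: radial_def)

lemma radial_scl: "0 < c \<Longrightarrow> radial n (c \<cdot> x) = radial n x"
  by (simp add: radial_def nrm_scl)

lemma radial_esphere: "x \<in> esphere n \<Longrightarrow> radial n x = x"
  by (simp add: radial_def esphere_def)

lemma nrm_diff_sq: "(nrm n (x - y))\<^sup>2 = (nrm n x)\<^sup>2 + (nrm n y)\<^sup>2 - 2 * ipr n x y"
  by (simp add: nrm_sq ipr_simps ipr_commute[of n y x])

text \<open>With \<open>r\<close> and \<open>s\<close> the norms, \<open>r * s\<close> times the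
  squared distance of the images is \<open>2 * r * s - 2 * ipr n x y\<close>. This is at most
  \<open>(nrm n (x - y))\<^sup>2\<close> since \<open>2 * r * s \<le> r\<^sup>2 + s\<^sup>2\<close>,
  and \<open>r * s\<close> is at least 1.\<close>

lemma radial_nonexpansive:
  assumes "1 \<le> nrm n x" "1 \<le> nrm n y"
  shows "edist n (radial n x) (radial n y) \<le> edist n x y"
proof -
  define r where "r = nrm n x"
  define s where "s = nrm n y"
  have rs: "1 \<le> r" "1 \<le> s" "1 \<le> r * s"
    using assms mult_mono[of 1 r 1 s] by (auto simp: r_def s_def)
  let ?d = "(nrm n (radial n x - radial n y))\<^sup>2"
  have "?d = 2 - 2 * (ipr n x y / (r * s))"
    unfolding nrm_diff_sq using rs
    by (subst (1 2) nrm_radial) (auto simp: r_def s_def radial_def ipr_simps)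
  then have "(r * s) * ?d = 2 * r * s - 2 * ipr n x y"
    using rs by (simp add: field_simps)
  also have "\<dots> \<le> (nrm n (x - y))\<^sup>2"
    unfolding nrm_diff_sq using sum_squares_bound[of r s] by (simp add: r_def s_def)
  finally have "(r * s) * ?d \<le> (nrm n (x - y))\<^sup>2" .
  moreover have "1 * ?d \<le> (r * s) * ?d"
    using rs by (intro mult_right_mono) auto
  ultimately have "?d \<le> (nrm n (x - y))\<^sup>2"
    by linarith
  then show ?thesis
    unfolding edist_nrm by (rule power2_le_imp_le[OF _ nrm_nonneg])
qed

lemma hausdorff_pre_finite_cover:
  assumes I: "finite I" and A: "A \<subseteq> (\<Union>i\<in>I. C i)" and C: "\<And>i. i \<in> I \<Longrightarrow> C i \<subseteq> Rn n"
    "\<And>i. i \<in> I \<Longrightarrow> ediam n (C i) \<le> ennreal \<delta>"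
  shows "hausdorff_pre n s \<delta> A \<le> (\<Sum>i\<in>I. hterm n s (C i))"
proof -
  obtain h where h: "bij_betw h {..<card I} I"
    using ex_bij_betw_nat_finite[OF I] by (auto simp: lessThan_atLeast0)
  define D where "D k = (if k < card I then C (h k) else {})" for k
  have hI: "h k \<in> I" if "k < card I" for k
    using h that by (auto simp: bij_betw_def)
  have "A \<subseteq> (\<Union>k. D k)"
  proof
    fix x assume "x \<in> A"
    then obtain i where i: "i \<in> I" "x \<in> C i"
      using A by blast
    then obtain k where "k < card I" "i = h k"
      using h by (auto simp: bij_betw_def)
    then show "x \<in> (\<Union>k. D k)"
      using i by (auto simp: D_def)
  qed
  then have "hausdorff_pre n s \<delta> A \<le> (\<Sum>k. hterm n s (D k))"
    using C hI by (intro hausdorff_pre_le) (auto simp: D_def)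
  also have "\<dots> = (\<Sum>k<card I. hterm n s (D k))"
    by (rule suminf_finite) (auto simp: D_def)
  also have "\<dots> = (\<Sum>k<card I. hterm n s (C (h k)))"
    by (simp add: D_def)
  also have "\<dots> = (\<Sum>i\<in>I. hterm n s (C i))"
    by (rule sum.reindex_bij_betw[OF h])
  finally show ?thesis .
qed

lemma grid_point:
  assumes "0 \<le> t" "t \<le> real N" "0 < N"
  obtains k where "k < N" "real k \<le> t" "t \<le> real k + 1"
proof (cases "t = real N")
  case True
  then show ?thesis
    using assms by (intro that[of "N - 1"]) auto
next
  case False
  have "real (nat \<lfloor>t\<rfloor>) \<le> t" "t \<le> real (nat \<lfloor>t\<rfloor>) + 1"
    using assms(1) by (auto simp: of_nat_nat)
  moreover have "nat \<lfloor>t\<rfloor> < N"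
    using assms False calculation(1) by (simp add: nat_less_iff floor_less_iff)
  ultimately show ?thesis
    using that by blast
qed

text \<open>A grid cuts the face into \<open>N ^ (n - 1)\<close> cells of diameter at most
  \<open>n * (2 / N)\<close>, so \<open>N\<close> cancels in the covering sum and the bound is the
  same at every scale.\<close>

lemma hsf_cube_face_finite:
  assumes j: "j < n"
  shows "hsf n {x \<in> Rn n. x j = c \<and> (\<forall>i<n. \<bar>x i\<bar> \<le> 1)} < top"
proof -
  let ?A = "{x \<in> Rn n. x j = c \<and> (\<forall>i<n. \<bar>x i\<bar> \<le> 1)}"
  have s: "0 \<le> real n - 1"
    using j by simp
  have "hsf n ?A \<le> ennreal (omega (real n - 1) * real n ^ (n - 1))"
  proof (rule hausdorff_le)
    fix \<delta> :: real assume \<delta>: "0 < \<delta>"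
    obtain N :: nat where N: "2 * real n / \<delta> < real N"
      using reals_Archimedean2 by blast
    moreover have "0 \<le> 2 * real n / \<delta>"
      using \<delta> by simp
    ultimately have N0: "0 < N"
      by linarith
    have Nd: "real n * (2 / real N) \<le> \<delta>"
      using N N0 \<delta> by (simp add: pos_divide_less_eq pos_divide_le_eq mult.commute)
    define I where "I = ({..<n} - {j}) \<rightarrow>\<^sub>E {..<N}"
    define C where "C k = {x \<in> ?A. \<forall>i\<in>{..<n} - {j}. real (k i) \<le> (x i + 1) / 2 * real N \<and>
        (x i + 1) / 2 * real N \<le> real (k i) + 1}" for k :: "nat \<Rightarrow> nat"
    have I: "finite I" "card I = N ^ (n - 1)"
      using j by (auto simp: I_def finite_PiE card_PiE)
    have cover: "?A \<subseteq> (\<Union>k\<in>I. C k)"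
    proof
      fix x assume x: "x \<in> ?A"
      have "\<exists>k<N. real k \<le> (x i + 1) / 2 * real N \<and> (x i + 1) / 2 * real N \<le> real k + 1"
        if "i \<in> {..<n} - {j}" for i
      proof -
        have "\<bar>x i\<bar> \<le> 1" using x that by auto
        then have "0 \<le> (x i + 1) / 2" "(x i + 1) / 2 \<le> 1" "0 \<le> real N"
          by auto
        have "0 \<le> (x i + 1) / 2 * real N"
          by (rule mult_nonneg_nonneg) fact+
        moreover have "(x i + 1) / 2 * real N \<le> 1 * real N"
          by (rule mult_right_mono) fact+
        ultimately show ?thesis
          using grid_point[of "(x i + 1) / 2 * real N" N] N0 by (metis mult_1)
      qed
      then obtain k where k: "\<And>i. i \<in> {..<n} - {j} \<Longrightarrow> k i < N \<and> real (k i) \<le> (x i + 1) / 2 * real N \<and>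
          (x i + 1) / 2 * real N \<le> real (k i) + 1"
        by metis
      have "restrict k ({..<n} - {j}) \<in> I" "x \<in> C (restrict k ({..<n} - {j}))"
        using k x by (auto simp: I_def C_def)
      then show "x \<in> (\<Union>k\<in>I. C k)" by blast
    qed
    have dist: "edist n x y \<le> real n * (2 / real N)" if xy: "x \<in> C k" "y \<in> C k" for x y k
    proof -
      have "edist n x y \<le> (\<Sum>i<n. \<bar>(x - y) i\<bar>)"
        using L2_set_le_sum_abs[of "x - y" "{..<n}"] by (simp add: edist_def L2_set_def)
      also have "\<dots> \<le> (\<Sum>i<n. 2 / real N)"
      proof (rule sum_mono)
        fix i assume i: "i \<in> {..<n}"
        show "\<bar>(x - y) i\<bar> \<le> 2 / real N"
        proof (cases "i = j")
          case False
          have "\<bar>(x i + 1) / 2 * real N - (y i + 1) / 2 * real N\<bar> \<le> 1"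
          proof -
            have i': "i \<in> {..<n} - {j}" using i False by simp
            have "real (k i) \<le> (x i + 1) / 2 * real N" "(x i + 1) / 2 * real N \<le> real (k i) + 1"
              "real (k i) \<le> (y i + 1) / 2 * real N" "(y i + 1) / 2 * real N \<le> real (k i) + 1"
              using xy i' unfolding C_def by blast+
            then show ?thesis by linarith
          qed
          also have "(x i + 1) / 2 * real N - (y i + 1) / 2 * real N = (x i - y i) * (real N / 2)"
            by (simp add: field_simps)
          finally have "\<bar>x i - y i\<bar> * (real N / 2) \<le> 1"
            by (simp add: abs_mult)
          then show ?thesis
            using N0 by (simp add: field_simps)
        qed (use xy N0 in \<open>auto simp: C_def\<close>)
      qed
      finally show ?thesis by simp
    qed
    have "hausdorff_pre n (real n - 1) \<delta> ?A \<le> (\<Sum>k\<in>I. hterm n (real n - 1) (C k))"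
    proof (rule hausdorff_pre_finite_cover[OF I(1) cover])
      show "C k \<subseteq> Rn n" for k by (auto simp: C_def)
      show "ediam n (C k) \<le> ennreal \<delta>" for k
        using \<delta> by (intro ediam_le_real(2) order_trans[OF dist Nd]) auto
    qed
    also have "\<dots> \<le> (\<Sum>k\<in>I. ennreal (omega (real n - 1) * (real n * (2 / real N) / 2) powr (real n - 1)))"
      using dist by (intro sum_mono hterm_le s ediam_le_real(1)) auto
    also have "\<dots> = ennreal (real N ^ (n - 1) * (omega (real n - 1) * (real n * (2 / real N) / 2) powr (real n - 1)))"
      using omega_nonneg[OF s] by (simp add: I(2) ennreal_mult ennreal_of_nat_eq_real_of_nat)
    also have "(real n * (2 / real N) / 2) powr (real n - 1) = (real n / real N) ^ (n - 1)"
      using j N0 powr_realpow[of "real n / real N" "n - 1"] by (simp add: of_nat_diff)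
    also have "real N ^ (n - 1) * (omega (real n - 1) * (real n / real N) ^ (n - 1)) =
        omega (real n - 1) * real n ^ (n - 1)"
      using N0 by (simp add: power_divide)
    finally show "hausdorff_pre n (real n - 1) \<delta> ?A \<le> ennreal (omega (real n - 1) * real n ^ (n - 1))" .
  qed
  also have "\<dots> < top" by simp
  finally show ?thesis .
qed

text \<open>The sphere is covered by the radial images of the \<open>2 * n\<close> faces of the
  cube, whose points have norm at least 1, where \<open>radial\<close> is nonexpansive.\<close>

lemma hsf_esphere_finite:
  assumes n: "1 \<le> n"
  shows "hsf n (esphere n) < top"
proof -
  define Q where "Q = (\<lambda>(j, c). {x \<in> Rn n. x j = c \<and> (\<forall>i<n. \<bar>x i\<bar> \<le> (1::real))})"
  let ?I = "{..<n} \<times> {- 1, 1 :: real}"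
  have cover: "esphere n \<subseteq> (\<Union>p\<in>?I. radial n ` Q p)"
  proof
    fix x assume x: "x \<in> esphere n"
    define m where "m = Max ((\<lambda>i. \<bar>x i\<bar>) ` {..<n})"
    have ne: "(\<lambda>i. \<bar>x i\<bar>) ` {..<n} \<noteq> {}"
      using n by (auto simp: lessThan_empty_iff)
    obtain j where j: "j < n" "m = \<bar>x j\<bar>"
      using Max_in[OF _ ne] unfolding m_def by auto
    have le: "\<bar>x i\<bar> \<le> m" if "i < n" for i
      unfolding m_def using that by (intro Max_ge) auto
    have "m \<noteq> 0"
    proof
      assume "m = 0"
      then have "x = 0"
        using le x by (auto simp: esphere_def Rn_def fun_eq_iff) (metis abs_le_zero_iff not_le)
      then show False
        using x by (simp add: esphere_def)
    qed
    then have m: "0 < m" using j by simp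
    define y where "y = (1 / m) \<cdot> x"
    have "y \<in> Q (j, sgn (x j))"
      using x le m j by (auto simp: Q_def y_def esphere_def abs_mult sgn_if field_simps)
    moreover have "sgn (x j) \<in> {-1, 1}"
      using m j by (auto simp: sgn_if)
    moreover have "x = radial n y"
      using x m by (simp add: y_def radial_scl radial_esphere)
    ultimately show "x \<in> (\<Union>p\<in>?I. radial n ` Q p)"
      using j by blast
  qed
  have "hsf n (radial n ` Q p) < top" if p: "p \<in> ?I" for p
  proof -
    have ge: "1 \<le> nrm n x" if "x \<in> Q p" for x
      using p that coord_le_nrm[of "fst p" n x] by (auto simp: Q_def split: prod.splits)
    have "hsf n (radial n ` Q p) \<le> hsf n (Q p)"
      by (rule hausdorff_nonexpansive_image)
         (use n ge in \<open>auto intro!: radial_nonexpansive simp: Q_def split: prod.splits\<close>)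
    also have "\<dots> < top"
      using p by (auto simp: Q_def intro!: hsf_cube_face_finite split: prod.splits)
    finally show ?thesis .
  qed
  then have "(\<Sum>p\<in>?I. hsf n (radial n ` Q p)) < top"
    by (subst ennreal_sum_less_top) (simp, blast)
  moreover have "hsf n (esphere n) \<le> (\<Sum>p\<in>?I. hsf n (radial n ` Q p))"
    by (rule order_trans[OF hausdorff_mono[OF cover] hausdorff_finite_UN_le]) simp
  ultimately show ?thesis
    by (rule order_le_less_trans[rotated])
qed

text \<open>The disc is covered by a Lipschitz image of the sphere: project along \<open>u\<close>,
  dilate by \<open>S\<close>, translate to height \<open>c\<close>. A point of the disc is hit by
  lifting its rescaled projection \<open>(1 / S) \<cdot> z\<close> back to the sphere.\<close>

lemma hsf_disc_finite:
  assumes n: "1 \<le> n" and u: "u \<in> Rn n" "ipr n u u = 1"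
  shows "hsf n {x \<in> Rn n. ipr n u x = c \<and> nrm n x \<le> R} < top"
proof -
  define S where "S = max R 1"
  have S: "1 \<le> S" "R \<le> S" by (auto simp: S_def)
  define f where "f y = S \<cdot> (y - ipr n u y \<cdot> u) + c \<cdot> u" for y
  have sub: "{x \<in> Rn n. ipr n u x = c \<and> nrm n x \<le> R} \<subseteq> f ` esphere n"
  proof clarify
    fix x assume x: "x \<in> Rn n" "nrm n x \<le> R" "c = ipr n u x"
    define z where "z = x - c \<cdot> u"
    have uz: "ipr n u z = 0"
      by (simp add: z_def ipr_simps u x(3))
    have "nrm n z \<le> S"
      using nrm_proj_le[OF u(2), of x] x S by (simp add: z_def)
    then have "ipr n z z \<le> S\<^sup>2"
      using S by (simp add: nrm_le_iff)
    then have le: "ipr n z z / S\<^sup>2 \<le> 1"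
      using S by (simp add: field_simps)
    define t where "t = sqrt (1 - ipr n z z / S\<^sup>2)"
    have t: "t * t = 1 - ipr n z z / S\<^sup>2"
      using le by (simp add: t_def)
    define y where "y = (1 / S) \<cdot> z + t \<cdot> u"
    have "ipr n y y = 1"
      using S t uz by (simp add: y_def ipr_simps u ipr_commute[of n z u] power2_eq_square)
    moreover have "y \<in> Rn n"
      using x u by (simp add: y_def z_def)
    moreover have "ipr n u y = t"
      by (simp add: y_def ipr_simps u uz)
    then have "f y = x"
      using S by (simp add: f_def y_def z_def)
    ultimately show "x \<in> f ` esphere n"
      by (force simp: esphere_def nrm_eq_1)
  qed
  have "hsf n (f ` esphere n) \<le> ennreal (S powr (real n - 1)) * hsf n (esphere n)"
  proof (rule hausdorff_lipschitz_image)
    show "f x \<in> Rn n" if "x \<in> esphere n" for x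
      using that u by (simp add: f_def esphere_def)
    fix x y
    have "f x - f y = S \<cdot> ((x - y) - ipr n u (x - y) \<cdot> u)"
      by (simp add: f_def scl_diff_right scl_diff_left ipr_simps right_diff_distrib)
    then show "edist n (f x) (f y) \<le> S * edist n x y"
      using S nrm_proj_le[OF u(2), of "x - y"] by (simp add: edist_nrm nrm_scl)
  qed (use S n in auto)
  also have "\<dots> < top"
    using hsf_esphere_finite[OF n] by (simp add: ennreal_mult_less_top)
  finally show ?thesis
    using hausdorff_mono[OF sub] order_le_less_trans by blast
qed

section \<open>Contracting one direction of a hyperplane\<close>

text \<open>Cauchy's functional equation on the half-line: nonnegativity and additivity give
  monotonicity, and trapping \<open>c\<close> between \<open>p / N\<close> and
  \<open>(p + 1) / N\<close> reduces the claim to natural factors, up to the error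
  \<open>g x / N\<close>.\<close>

lemma additive_nonneg_linear:
  fixes g :: "real \<Rightarrow> real"
  assumes nn: "\<And>x. 0 \<le> x \<Longrightarrow> 0 \<le> g x"
    and add: "\<And>x y. 0 \<le> x \<Longrightarrow> 0 \<le> y \<Longrightarrow> g (x + y) = g x + g y"
    and c: "0 \<le> c" and x: "0 \<le> x"
  shows "g (c * x) = c * g x"
proof -
  have g0: "g 0 = 0"
    using add[of 0 0] by simp
  have nat: "g (real k * y) = real k * g y" if "0 \<le> y" for k y
    by (induction k) (use that in \<open>auto simp: g0 add distrib_right\<close>)
  have mono: "g y \<le> g z" if "0 \<le> y" "y \<le> z" for y z
    using add[of y "z - y"] nn[of "z - y"] that by simp
  have est: "\<bar>g (c * x) - c * g x\<bar> \<le> g x / real N" if N: "0 < N" for N :: nat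
  proof -
    define p where "p = nat \<lfloor>c * real N\<rfloor>"
    have "0 \<le> c * real N"
      using c by simp
    then have p: "real p \<le> c * real N" "c * real N \<le> real (Suc p)"
      unfolding p_def by linarith+
    have "g (real p * x) \<le> g (real N * (c * x))" "g (real N * (c * x)) \<le> g (real (Suc p) * x)"
      using mult_right_mono[OF p(1) x] mult_right_mono[OF p(2) x] c x
      by (auto intro!: mono simp: mult_ac)
    then have "real p * g x \<le> real N * g (c * x)" "real N * g (c * x) \<le> real (Suc p) * g x"
      unfolding nat[OF x] nat[OF mult_nonneg_nonneg[OF c x]] .
    moreover have "real p * g x \<le> c * real N * g x" "c * real N * g x \<le> real (Suc p) * g x"
      using p nn[OF x] by (auto intro: mult_right_mono)
    ultimately have "\<bar>real N * g (c * x) - c * real N * g x\<bar> \<le> real (Suc p) * g x - real p * g x"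
      by linarith
    then have "\<bar>real N * (g (c * x) - c * g x)\<bar> \<le> g x"
      by (simp add: algebra_simps)
    then show ?thesis
      using N by (simp add: abs_mult pos_le_divide_eq mult.commute)
  qed
  have "\<bar>g (c * x) - c * g x\<bar> \<le> 0"
  proof (rule field_le_epsilon)
    fix e :: real assume e: "0 < e"
    obtain N :: nat where N: "g x / e < real N"
      using reals_Archimedean2 by blast
    moreover have "0 \<le> g x / e"
      using nn[OF x] e by simp
    ultimately have "0 < N" by linarith
    then have "g x / real N \<le> e"
      using N e by (simp add: pos_divide_less_eq pos_divide_le_eq mult.commute)
    then show "\<bar>g (c * x) - c * g x\<bar> \<le> 0 + e"
      using est[OF \<open>0 < N\<close>] by simp
  qed
  then show ?thesis by simp
qed

lemma borel_measurable_ipr [measurable]: "(\<lambda>x. ipr n u x) \<in> borel_measurable borel"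
  by (intro borel_measurable_continuous_onI continuous_intros)

lemma borel_measurable_nrm [measurable]: "nrm n \<in> borel_measurable borel"
  by (intro borel_measurable_continuous_onI continuous_intros)

lemma borel_measurable_along [measurable]: "(\<lambda>x. x - (c * ipr n u x) \<cdot> u) \<in> borel \<rightarrow>\<^sub>M borel"
  by (intro borel_measurable_continuous_onI continuous_intros)

lemma borel_Rn [measurable]: "Rn n \<in> sets borel"
  by (simp add: closed_Rn)

text \<open>\<open>a\<close> is the normal of a hyperplane and \<open>e\<close> the direction inside
  it that will be contracted.\<close>

locale orthonormal_pair =
  fixes n :: nat and a e :: "nat \<Rightarrow> real"
  assumes a: "a \<in> Rn n" "ipr n a a = 1" and e: "e \<in> Rn n" "ipr n e e = 1" and ae: "ipr n a e = 0"
begin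

definition hyp :: "(nat \<Rightarrow> real) set"
  where "hyp = {x \<in> Rn n. ipr n a x = 0}"

definition proj :: "(nat \<Rightarrow> real) \<Rightarrow> nat \<Rightarrow> real"
  where "proj x = x - ipr n e x \<cdot> e"

definition squeeze :: "real \<Rightarrow> (nat \<Rightarrow> real) \<Rightarrow> nat \<Rightarrow> real"
  where "squeeze c x = x - ((1 - c) * ipr n e x) \<cdot> e"

definition slab :: "real \<Rightarrow> real \<Rightarrow> (nat \<Rightarrow> real) set \<Rightarrow> (nat \<Rightarrow> real) set"
  where "slab \<alpha> \<beta> W = {x. \<alpha> \<le> ipr n e x \<and> ipr n e x < \<beta> \<and> proj x \<in> W}"

text \<open>A generator of the Borel sets for the uniqueness of measures. Bounded cross-sections
  make the measures finite on the hyperplane, and half-open intervals make adjacent slabs disjoint.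
  The slabs live in the whole function type; \<open>hyp\<close> enters later as a density.\<close>

definition slabs :: "(nat \<Rightarrow> real) set set"
  where "slabs = {slab \<alpha> \<beta> W |\<alpha> \<beta> W. W \<in> sets borel \<and> (\<exists>R. \<forall>x\<in>W. nrm n x \<le> R)}"

lemma n_ge_1: "1 \<le> n"
  using a by (cases n) (auto simp: ipr_def)

lemma dim_nonneg: "0 \<le> real n - 1"
  using n_ge_1 by simp

lemma measurable_proj [measurable]: "proj \<in> borel \<rightarrow>\<^sub>M borel"
  unfolding proj_def using borel_measurable_along[of 1] by simp

lemma measurable_squeeze [measurable]: "squeeze c \<in> borel \<rightarrow>\<^sub>M borel"
  unfolding squeeze_def by measurable

lemma borel_hyp [measurable]: "hyp \<in> sets borel"
  unfolding hyp_def by measurable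

lemma borel_slab [measurable]:
  assumes [measurable]: "W \<in> sets borel"
  shows "slab \<alpha> \<beta> W \<in> sets borel"
  unfolding slab_def by measurable

lemma hyp_subset: "hyp \<subseteq> Rn n"
  by (auto simp: hyp_def)

lemma ipr_squeeze: "ipr n e (squeeze c x) = c * ipr n e x"
  by (simp add: squeeze_def ipr_simps e algebra_simps)

lemma proj_squeeze: "proj (squeeze c x) = proj x"
  unfolding proj_def ipr_squeeze by (simp add: squeeze_def scl_diff_left scl_add_left left_diff_distrib)

lemma squeeze_hyp: "x \<in> hyp \<Longrightarrow> squeeze c x \<in> hyp"
  using e by (simp add: hyp_def squeeze_def ipr_simps ae)

lemma squeeze_squeeze: "squeeze c (squeeze d x) = squeeze (c * d) x"
  unfolding squeeze_def[of c] ipr_squeeze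
  by (simp add: squeeze_def fun_eq_iff algebra_simps)

lemma squeeze_1: "squeeze 1 x = x"
  by (simp add: squeeze_def)

lemma squeeze_slab:
  assumes "0 < c"
  shows "squeeze c ` (slab \<alpha> \<beta> W \<inter> hyp) = slab (c * \<alpha>) (c * \<beta>) W \<inter> hyp"
proof (intro equalityI subsetI)
  fix x assume "x \<in> squeeze c ` (slab \<alpha> \<beta> W \<inter> hyp)"
  then show "x \<in> slab (c * \<alpha>) (c * \<beta>) W \<inter> hyp"
    using assms by (auto simp: slab_def ipr_squeeze proj_squeeze squeeze_hyp)
next
  fix x assume x: "x \<in> slab (c * \<alpha>) (c * \<beta>) W \<inter> hyp"
  have "squeeze (1 / c) x \<in> slab \<alpha> \<beta> W \<inter> hyp"
    using x assms by (auto simp: slab_def ipr_squeeze proj_squeeze squeeze_hyp field_simps)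
  moreover have "x = squeeze c (squeeze (1 / c) x)"
    using assms by (simp add: squeeze_squeeze squeeze_1)
  ultimately show "x \<in> squeeze c ` (slab \<alpha> \<beta> W \<inter> hyp)"
    by blast
qed

lemma hsf_slab_finite:
  assumes "\<forall>x\<in>W. nrm n x \<le> R"
  shows "hsf n (slab \<alpha> \<beta> W \<inter> hyp) < top"
proof -
  have "slab \<alpha> \<beta> W \<inter> hyp \<subseteq> {x \<in> Rn n. ipr n a x = 0 \<and> nrm n x \<le> R + max \<bar>\<alpha>\<bar> \<bar>\<beta>\<bar>}"
  proof clarify
    fix x assume x: "x \<in> slab \<alpha> \<beta> W" "x \<in> hyp"
    have "nrm n e = 1"
      by (simp add: nrm_def e)
    have "nrm n x \<le> nrm n (proj x) + nrm n (ipr n e x \<cdot> e)"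
      using nrm_triangle[of n "proj x" "ipr n e x \<cdot> e"] by (simp add: proj_def)
    also have "\<dots> \<le> R + max \<bar>\<alpha>\<bar> \<bar>\<beta>\<bar>"
      using x assms \<open>nrm n e = 1\<close> by (intro add_mono) (auto simp: slab_def nrm_scl)
    finally show "x \<in> Rn n \<and> ipr n a x = 0 \<and> nrm n x \<le> R + max \<bar>\<alpha>\<bar> \<bar>\<beta>\<bar>"
      using x by (simp add: hyp_def)
  qed
  then show ?thesis
    using hsf_disc_finite[OF n_ge_1 a] hausdorff_mono order_le_less_trans by blast
qed

lemma hsf_slab_translate: "hsf n (slab (\<alpha> + t) (\<beta> + t) W \<inter> hyp) = hsf n (slab \<alpha> \<beta> W \<inter> hyp)"
proof -
  have le: "hsf n (slab (\<alpha> + t) (\<beta> + t) W \<inter> hyp) \<le> hsf n (slab \<alpha> \<beta> W \<inter> hyp)" for \<alpha> \<beta> t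
  proof -
    have sub: "slab (\<alpha> + t) (\<beta> + t) W \<inter> hyp \<subseteq> (\<lambda>x. x + t \<cdot> e) ` (slab \<alpha> \<beta> W \<inter> hyp)"
    proof
      fix x assume x: "x \<in> slab (\<alpha> + t) (\<beta> + t) W \<inter> hyp"
      have "proj (x - t \<cdot> e) = proj x"
        by (simp add: proj_def ipr_simps e scl_diff_left)
      then have "x - t \<cdot> e \<in> slab \<alpha> \<beta> W \<inter> hyp"
        using x e by (auto simp: slab_def hyp_def ipr_simps ae)
      moreover have "x = (x - t \<cdot> e) + t \<cdot> e"
        by simp
      ultimately show "x \<in> (\<lambda>x. x + t \<cdot> e) ` (slab \<alpha> \<beta> W \<inter> hyp)"
        by blast
    qed
    have "hsf n ((\<lambda>x. x + t \<cdot> e) ` (slab \<alpha> \<beta> W \<inter> hyp)) \<le> hsf n (slab \<alpha> \<beta> W \<inter> hyp)"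
      using e hyp_subset by (intro hausdorff_nonexpansive_image dim_nonneg) (auto simp: edist_nrm)
    then show ?thesis
      using hausdorff_mono[OF sub] by (rule order_trans[rotated])
  qed
  show ?thesis
    using le[of \<alpha> t \<beta>] le[of "\<alpha> + t" "- t" "\<beta> + t"] by simp
qed

text \<open>As a function of the width, the measure \<open>g\<close> is additive: cut the slab and
  translate the second piece back to 0. Hence \<open>g\<close> is homogeneous by
  \<open>additive_nonneg_linear\<close>, and squeezing multiplies the width by
  \<open>c\<close>.\<close>

lemma hsf_squeeze_slab:
  assumes W: "W \<in> sets borel" "\<forall>x\<in>W. nrm n x \<le> R" and c: "0 < c"
  shows "hsf n (squeeze c ` (slab \<alpha> \<beta> W \<inter> hyp)) = ennreal c * hsf n (slab \<alpha> \<beta> W \<inter> hyp)"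
proof (cases "\<alpha> \<le> \<beta>")
  case False
  then have "slab \<alpha> \<beta> W = {}"
    by (auto simp: slab_def)
  then show ?thesis by simp
next
  case True
  define g where "g t = enn2real (hsf n (slab 0 t W \<inter> hyp))" for t
  have fin: "hsf n (slab \<alpha> \<beta> W \<inter> hyp) < top" for \<alpha> \<beta>
    using hsf_slab_finite W by blast
  have add: "g (x + y) = g x + g y" if "0 \<le> x" "0 \<le> y" for x y
  proof -
    have "hsf n (slab 0 (x + y) W \<inter> hyp) =
        hsf n (slab 0 (x + y) W \<inter> hyp \<inter> slab 0 x W) + hsf n (slab 0 (x + y) W \<inter> hyp - slab 0 x W)"
      using hyp_subset W by (intro hausdorff_add_borel dim_nonneg) auto
    also have "slab 0 (x + y) W \<inter> hyp \<inter> slab 0 x W = slab 0 x W \<inter> hyp"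
      using that by (auto simp: slab_def)
    also have "slab 0 (x + y) W \<inter> hyp - slab 0 x W = slab (0 + x) (y + x) W \<inter> hyp"
      using that by (auto simp: slab_def)
    also have "hsf n \<dots> = hsf n (slab 0 y W \<inter> hyp)"
      by (rule hsf_slab_translate)
    finally show ?thesis
      using fin unfolding g_def by (simp add: enn2real_plus)
  qed
  have "g (c * (\<beta> - \<alpha>)) = c * g (\<beta> - \<alpha>)"
    using True c by (intro additive_nonneg_linear add) (auto simp: g_def)
  then have "hsf n (slab 0 (c * (\<beta> - \<alpha>)) W \<inter> hyp) = ennreal c * hsf n (slab 0 (\<beta> - \<alpha>) W \<inter> hyp)"
    using fin c unfolding g_def
    by (metis enn2real_nonneg ennreal_enn2real ennreal_mult less_imp_le)
  moreover have "hsf n (slab (c * \<alpha>) (c * \<beta>) W \<inter> hyp) = hsf n (slab 0 (c * (\<beta> - \<alpha>)) W \<inter> hyp)"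
    using hsf_slab_translate[of 0 "c * \<alpha>" "c * (\<beta> - \<alpha>)"] by (simp add: algebra_simps)
  moreover have "hsf n (slab \<alpha> \<beta> W \<inter> hyp) = hsf n (slab 0 (\<beta> - \<alpha>) W \<inter> hyp)"
    using hsf_slab_translate[of 0 "\<alpha>" "\<beta> - \<alpha>"] by simp
  ultimately show ?thesis
    unfolding squeeze_slab[OF c] by simp
qed

lemma Int_stable_slabs: "Int_stable slabs"
proof (rule Int_stableI)
  fix A B assume "A \<in> slabs" "B \<in> slabs"
  then obtain \<alpha> \<beta> W R \<alpha>' \<beta>' W' where *: "A = slab \<alpha> \<beta> W" "B = slab \<alpha>' \<beta>' W'"
      "W \<in> sets borel" "W' \<in> sets borel" "\<forall>x\<in>W. nrm n x \<le> R"
    unfolding slabs_def by blast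
  have "A \<inter> B = slab (max \<alpha> \<alpha>') (min \<beta> \<beta>') (W \<inter> W')"
    unfolding * by (auto simp: slab_def)
  then show "A \<inter> B \<in> slabs"
    using * unfolding slabs_def by blast
qed

text \<open>A point is \<open>proj x + ipr n e x \<cdot> e\<close>, so the identity is measurable
  for the sets generated by slabs once the height \<open>ipr n e x\<close> and \<open>proj\<close>
  are. Their preimages are countable unions of slabs, exhausting the unbounded directions by
  integers.\<close>

lemma sigma_sets_slabs: "sigma_sets UNIV slabs = sets borel"
proof (rule antisym)
  have "slabs \<subseteq> sets borel"
    by (auto simp: slabs_def)
  then show "sigma_sets UNIV slabs \<subseteq> sets borel"
    using sets.sigma_sets_subset[of slabs borel] by simp
next
  let ?N = "sigma UNIV slabs"
  have N: "sets ?N = sigma_sets UNIV slabs" "space ?N = UNIV"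
    by auto
  have in_N: "slab \<alpha> \<beta> (W \<inter> {x. nrm n x \<le> R}) \<in> sets ?N" if "W \<in> sets borel" for \<alpha> \<beta> W R
  proof -
    have "W \<inter> {x. nrm n x \<le> R} \<in> sets borel"
      using that by measurable
    then have "slab \<alpha> \<beta> (W \<inter> {x. nrm n x \<le> R}) \<in> slabs"
      unfolding slabs_def by blast
    then show ?thesis
      unfolding N by (rule sigma_sets.Basic)
  qed
  have big: "\<exists>k::nat. s \<le> real k \<and> t \<le> real k \<and> r < real k" for s t r :: real
    using reals_Archimedean2[of "max (max s t) r"] by (metis less_imp_le max_less_iff_conj)
  have m1 [measurable]: "(\<lambda>x. ipr n e x) \<in> borel_measurable ?N"
    unfolding borel_measurable_iff_less
  proof
    fix c
    have "{x \<in> space ?N. ipr n e x < c} = (\<Union>k. slab (- real k) c (UNIV \<inter> {x. nrm n x \<le> real k}))"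
    proof (intro equalityI subsetI)
      fix x assume x: "x \<in> {x \<in> space ?N. ipr n e x < c}"
      obtain k :: nat where "- ipr n e x \<le> real k" "nrm n (proj x) \<le> real k"
        using big by blast
      then show "x \<in> (\<Union>k. slab (- real k) c (UNIV \<inter> {x. nrm n x \<le> real k}))"
        using x by (auto simp: slab_def intro!: exI[of _ k])
    qed (auto simp: slab_def)
    then show "{x \<in> space ?N. ipr n e x < c} \<in> sets ?N"
      by (simp only:) (rule sets.countable_UN, intro image_subsetI in_N, simp)
  qed
  have m2: "proj \<in> ?N \<rightarrow>\<^sub>M borel"
  proof (rule measurableI)
    fix W :: "(nat \<Rightarrow> real) set" assume W: "W \<in> sets borel"
    have "proj -` W \<inter> space ?N = (\<Union>k. slab (- real k) (real k) (W \<inter> {x. nrm n x \<le> real k}))"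
    proof (intro equalityI subsetI)
      fix x assume x: "x \<in> proj -` W \<inter> space ?N"
      obtain k :: nat where "- ipr n e x \<le> real k" "nrm n (proj x) \<le> real k" "ipr n e x < real k"
        using big by blast
      then show "x \<in> (\<Union>k. slab (- real k) (real k) (W \<inter> {x. nrm n x \<le> real k}))"
        using x by (auto simp: slab_def intro!: exI[of _ k])
    qed (auto simp: slab_def)
    then show "proj -` W \<inter> space ?N \<in> sets ?N"
      by (simp only:) (rule sets.countable_UN, intro image_subsetI in_N W)
  qed simp
  have "(\<lambda>x. x) \<in> ?N \<rightarrow>\<^sub>M borel"
  proof (rule measurable_coordinatewise_then_product)
    fix i
    have [measurable]: "(\<lambda>x. proj x i) \<in> borel_measurable ?N"
      by (rule measurable_product_then_coordinatewise[OF m2])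
    have "(\<lambda>x. proj x i + ipr n e x * e i) \<in> borel_measurable ?N"
      by measurable
    then show "(\<lambda>x. x i) \<in> borel_measurable ?N"
      by (simp add: proj_def)
  qed
  then show "sets borel \<subseteq> sigma_sets UNIV slabs"
    using measurable_sets[of "\<lambda>x. x" ?N borel] N by auto
qed

lemma emeasure_density_hyp:
  assumes "A \<in> sets borel"
  shows "emeasure (density (hmeas n (real n - 1)) (indicator hyp)) A = hsf n (A \<inter> hyp)"
proof -
  have "emeasure (density (hmeas n (real n - 1)) (indicator hyp)) A = emeasure (hmeas n (real n - 1)) (hyp \<inter> A)"
    using assms by (intro emeasure_restricted) auto
  also have "\<dots> = hsf n (hyp \<inter> A \<inter> Rn n)"
    using assms by (intro emeasure_hmeas dim_nonneg) auto
  also have "hyp \<inter> A \<inter> Rn n = A \<inter> hyp"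
    using hyp_subset by auto
  finally show ?thesis .
qed

text \<open>Both sides are Borel measures in \<open>A\<close>. They agree on the generating slabs, because the measure of a slab is
  invariant under translations along \<open>e\<close> and therefore proportional to its width.\<close>

lemma hsf_squeeze_borel:
  assumes c: "0 < c" and A: "A \<in> sets borel" "A \<subseteq> hyp"
  shows "hsf n (squeeze c ` A) = ennreal c * hsf n A"
proof -
  let ?M = "density (hmeas n (real n - 1)) (indicator hyp)"
  \<comment> \<open>Pushing forward along the inverse map \<open>squeeze (1 / c)\<close> makes the
    measure of a set that of its image under \<open>squeeze c\<close>.\<close>
  let ?M' = "scale_measure (ennreal (1 / c)) (distr ?M borel (squeeze (1 / c)))"
  have vim: "squeeze (1 / c) -` B \<inter> hyp = squeeze c ` (B \<inter> hyp)" for B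
  proof (intro equalityI subsetI)
    fix x assume x: "x \<in> squeeze (1 / c) -` B \<inter> hyp"
    then have "squeeze (1 / c) x \<in> B \<inter> hyp"
      by (auto simp: squeeze_hyp)
    moreover have "x = squeeze c (squeeze (1 / c) x)"
      using c by (simp add: squeeze_squeeze squeeze_1)
    ultimately show "x \<in> squeeze c ` (B \<inter> hyp)" by blast
  qed (use c in \<open>auto simp: squeeze_hyp squeeze_squeeze squeeze_1\<close>)
  have M': "emeasure ?M' B = ennreal (1 / c) * hsf n (squeeze c ` (B \<inter> hyp))" if B: "B \<in> sets borel" for B
  proof -
    have "emeasure (distr ?M borel (squeeze (1 / c))) B = emeasure ?M (squeeze (1 / c) -` B)"
      using B by (subst emeasure_distr) auto
    also have "\<dots> = hsf n (squeeze c ` (B \<inter> hyp))"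
      unfolding vim[symmetric] using measurable_sets[OF measurable_squeeze B] by (intro emeasure_density_hyp) auto
    finally show ?thesis by simp
  qed
  have "?M = ?M'"
  proof (rule measure_eqI_generator_eq[OF Int_stable_slabs, where \<Omega> = UNIV])
    let ?A = "\<lambda>k. slab (- real k) (real k) {x. nrm n x \<le> real k}"
    have [measurable]: "{x. nrm n x \<le> r} \<in> sets borel" for r
      by measurable
    show "range ?A \<subseteq> slabs"
      by (auto simp: slabs_def) (metis mem_Collect_eq order_refl \<open>\<And>r. {x. nrm n x \<le> r} \<in> sets borel\<close>)
    show "(\<Union>k. ?A k) = UNIV"
    proof (intro equalityI subsetI UNIV_I)
      fix x
      obtain k where "max (max (ipr n e x) (- ipr n e x)) (nrm n (proj x)) < real k"
        using reals_Archimedean2 by blast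
      then show "x \<in> (\<Union>k. ?A k)"
        by (auto simp: slab_def intro!: exI[of _ k])
    qed
    show "emeasure ?M (?A k) \<noteq> \<infinity>" for k
      using hsf_slab_finite[of "{x. nrm n x \<le> real k}" "real k" "- real k" "real k"]
      by (subst emeasure_density_hyp) auto
    show "sets ?M = sigma_sets UNIV slabs" "sets ?M' = sigma_sets UNIV slabs"
      by (simp_all add: sigma_sets_slabs)
    fix X assume "X \<in> slabs"
    then obtain \<alpha> \<beta> W R where X: "X = slab \<alpha> \<beta> W" "W \<in> sets borel" "\<forall>x\<in>W. nrm n x \<le> R"
      unfolding slabs_def by blast
    show "emeasure ?M X = emeasure ?M' X"
      using X c by (subst emeasure_density_hyp M'; simp)+
        (simp add: hsf_squeeze_slab mult.assoc[symmetric] flip: ennreal_mult)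
  qed simp
  then have "hsf n A = ennreal (1 / c) * hsf n (squeeze c ` A)"
    using emeasure_density_hyp[OF A(1)] M'[OF A(1)] A(2) by (simp add: Int_absorb2)
  then have "ennreal c * hsf n A = ennreal c * (ennreal (1 / c) * hsf n (squeeze c ` A))"
    by simp
  also have "\<dots> = hsf n (squeeze c ` A)"
    using c by (simp add: mult.assoc[symmetric] flip: ennreal_mult)
  finally show ?thesis by simp
qed

text \<open>A Borel hull removes the measurability assumption. It will be applied to orthogonal
  projections of Borel sets, for which no measurability is established.\<close>

lemma hsf_squeeze_le:
  assumes c: "0 < c" and A: "A \<subseteq> hyp"
  shows "hsf n (squeeze c ` A) \<le> ennreal c * hsf n A"
proof -
  obtain G where G: "G \<in> sets borel" "A \<subseteq> G" "G \<subseteq> Rn n" "hsf n G = hsf n A"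
    using hausdorff_borel_hull[OF dim_nonneg order_trans[OF A hyp_subset]] .
  have "hsf n (squeeze c ` A) \<le> hsf n (squeeze c ` (G \<inter> hyp))"
    using A G(2) by (intro hausdorff_mono image_mono) auto
  also have "\<dots> = ennreal c * hsf n (G \<inter> hyp)"
    using G by (intro hsf_squeeze_borel c) auto
  also have "\<dots> \<le> ennreal c * hsf n A"
    unfolding G(4)[symmetric] by (intro mult_left_mono hausdorff_mono) auto
  finally show ?thesis .
qed

end

section \<open>Tilted projections\<close>

definition perp :: "nat \<Rightarrow> (nat \<Rightarrow> real) \<Rightarrow> (nat \<Rightarrow> real) \<Rightarrow> nat \<Rightarrow> real"
  where "perp n u x = x - ipr n u x \<cdot> u"

lemma perp_Rn [simp]: "u \<in> Rn n \<Longrightarrow> x \<in> Rn n \<Longrightarrow> perp n u x \<in> Rn n"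
  by (simp add: perp_def)

lemma perp_add: "perp n u (x + y) = perp n u x + perp n u y"
  and perp_diff: "perp n u (x - y) = perp n u x - perp n u y"
  and perp_scl: "perp n u (c \<cdot> x) = c \<cdot> perp n u x"
  by (auto simp: perp_def ipr_simps fun_eq_iff algebra_simps)

lemma perp_self: "ipr n u u = 1 \<Longrightarrow> perp n u u = 0"
  by (simp add: perp_def)

lemma ipr_perp: "ipr n u u = 1 \<Longrightarrow> ipr n u (perp n u x) = 0"
  by (simp add: perp_def ipr_simps)

lemma nrm_perp_sq: "ipr n u u = 1 \<Longrightarrow> (nrm n (perp n u x))\<^sup>2 = (nrm n x)\<^sup>2 - (ipr n u x)\<^sup>2"
  unfolding perp_def by (rule nrm_proj)

lemma nrm_perp_le: "ipr n u u = 1 \<Longrightarrow> nrm n (perp n u x) \<le> nrm n x"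
  unfolding perp_def by (rule nrm_proj_le)

lemma nrm_le_perp:
  assumes "ipr n u u = 1"
  shows "nrm n x \<le> nrm n (perp n u x) + \<bar>ipr n u x\<bar>"
proof -
  have "nrm n u = 1"
    using assms by (simp add: nrm_def)
  then show ?thesis
    using nrm_triangle[of n "perp n u x" "ipr n u x \<cdot> u"] by (simp add: perp_def nrm_scl)
qed

lemma (in orthonormal_pair) nrm_squeeze_sq:
  "(nrm n (squeeze c x))\<^sup>2 = (nrm n x)\<^sup>2 - (1 - c\<^sup>2) * (ipr n e x)\<^sup>2"
proof -
  have "ipr n x e = ipr n e x"
    by (rule ipr_commute)
  then show ?thesis
    unfolding nrm_sq squeeze_def ipr_simps e(2) by (simp add: power2_eq_square algebra_simps)
qed

lemma (in orthonormal_pair) squeeze_diff: "squeeze c (x - y) = squeeze c x - squeeze c y"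
  by (auto simp: squeeze_def ipr_simps fun_eq_iff algebra_simps)

text \<open>One Gram-Schmidt step: \<open>e\<close> is the normalised component of \<open>b\<close>
  orthogonal to \<open>a\<close>, nonzero because \<open>b\<close> is not parallel to
  \<open>a\<close>.\<close>

lemma orthonormal_completion:
  assumes a: "a \<in> Rn n" "ipr n a a = 1" and b: "b \<in> Rn n" "ipr n b b = 1" and ab: "\<bar>ipr n a b\<bar> < 1"
  obtains e where "orthonormal_pair n a e" "b = ipr n a b \<cdot> a + sqrt (1 - (ipr n a b)\<^sup>2) \<cdot> e"
proof -
  define q where "q = sqrt (1 - (ipr n a b)\<^sup>2)"
  have lt: "(ipr n a b)\<^sup>2 < 1"
    using ab by (simp add: abs_square_less_1)
  then have q: "0 < q" "q * q = 1 - (ipr n a b)\<^sup>2"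
    by (auto simp: q_def)
  define e where "e = (1 / q) \<cdot> perp n a b"
  have pp: "ipr n (perp n a b) (perp n a b) = q * q"
    using nrm_perp_sq[OF a(2), of b] by (simp add: nrm_sq b q(2))
  have "orthonormal_pair n a e"
  proof
    show "e \<in> Rn n" using a b by (simp add: e_def)
    show "ipr n e e = 1"
      using q(1) by (simp add: e_def ipr_simps pp)
    show "ipr n a e = 0"
      by (simp add: e_def ipr_scl_right ipr_perp a)
  qed (use a in auto)
  moreover have "b = ipr n a b \<cdot> a + q \<cdot> e"
    using q(1) by (simp add: e_def perp_def)
  ultimately show ?thesis
    using that by (simp add: q_def)
qed

text \<open>Up to the error \<open>\<epsilon>\<close>, the set \<open>A\<close> is orthogonal to \<open>a\<close> and \<open>f\<close> does not increase distances more than the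
  projection along \<open>b\<close>. That projection contracts one direction orthogonal to \<open>a\<close> by the factor \<open>ipr n a b\<close>.\<close>

lemma hsf_tilted_image_le:
  assumes a: "a \<in> Rn n" "ipr n a a = 1" and b: "b \<in> Rn n" "ipr n b b = 1"
    and ab: "0 \<le> ipr n a b" "ipr n a b \<le> c" and c: "1 / 2 \<le> c" "c < 1" and \<epsilon>: "0 < \<epsilon>" "\<epsilon> \<le> 1 / 2"
    and A: "A \<subseteq> Rn n" and f: "\<And>x. x \<in> A \<Longrightarrow> f x \<in> Rn n"
    and flat: "\<And>x y. x \<in> A \<Longrightarrow> y \<in> A \<Longrightarrow> \<bar>ipr n a (x - y)\<bar> \<le> \<epsilon> * nrm n (x - y)"
    and tilt: "\<And>x y. x \<in> A \<Longrightarrow> y \<in> A \<Longrightarrow>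
      nrm n (f x - f y) \<le> nrm n (perp n b (x - y)) + \<epsilon> * nrm n (x - y)"
  shows "hsf n (f ` A) \<le> ennreal ((1 + 8 * \<epsilon>) powr (real n - 1)) * (ennreal c * hsf n A)"
proof -
  define d where "d = ipr n a b"
  have d: "0 \<le> d" "d \<le> c"
    using ab by (simp_all add: d_def)
  have "\<bar>ipr n a b\<bar> < 1"
    using ab c by simp
  then obtain e where orth: "orthonormal_pair n a e" and b_eq: "b = d \<cdot> a + sqrt (1 - d\<^sup>2) \<cdot> e"
    using orthonormal_completion[OF a b] unfolding d_def by blast
  interpret orthonormal_pair n a e by (rule orth)
  have d2: "d\<^sup>2 \<le> c\<^sup>2" "c\<^sup>2 < 1"
    using d c by (simp_all add: power_mono power_less_one_iff abs_square_less_1)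
  \<comment> \<open>On \<open>hyp\<close>, projecting along \<open>b\<close> subtracts
    \<open>(1 - d\<^sup>2) * (ipr n e v)\<^sup>2\<close> from the squared norm, and
    \<open>squeeze c\<close> only \<open>(1 - c\<^sup>2) * (ipr n e v)\<^sup>2\<close>. The weaker
    contraction is used since \<open>d\<close> may be 0, whereas \<open>c \<ge> 1 / 2\<close> gives
    the second bound, which turns errors relative to \<open>v\<close> into errors relative to
    \<open>squeeze c v\<close>.\<close>
  have perp_b: "nrm n (perp n b v) \<le> nrm n (squeeze c v)" and le_squeeze: "c * nrm n v \<le> nrm n (squeeze c v)"
    if v: "v \<in> hyp" for v
  proof -
    have av: "ipr n a v = 0"
      using v by (simp add: hyp_def)
    then have "ipr n b v = sqrt (1 - d\<^sup>2) * ipr n e v"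
      by (simp add: b_eq ipr_simps)
    then have "(ipr n b v)\<^sup>2 = (1 - d\<^sup>2) * (ipr n e v)\<^sup>2"
      using d2 by (simp add: power_mult_distrib)
    moreover have "(1 - c\<^sup>2) * (ipr n e v)\<^sup>2 \<le> (1 - d\<^sup>2) * (ipr n e v)\<^sup>2"
      using d2 by (intro mult_right_mono) auto
    ultimately have "(nrm n (perp n b v))\<^sup>2 \<le> (nrm n (squeeze c v))\<^sup>2"
      unfolding nrm_perp_sq[OF b(2)] nrm_squeeze_sq by simp
    then show "nrm n (perp n b v) \<le> nrm n (squeeze c v)"
      by (rule power2_le_imp_le) simp
    have "(ipr n e v)\<^sup>2 \<le> (nrm n v)\<^sup>2"
      using nrm_perp_sq[OF e(2), of v] zero_le_power2[of "nrm n (perp n e v)"] by linarith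
    then have "(1 - c\<^sup>2) * (ipr n e v)\<^sup>2 \<le> (1 - c\<^sup>2) * (nrm n v)\<^sup>2"
      using d2 by (intro mult_left_mono) auto
    then have "(c * nrm n v)\<^sup>2 \<le> (nrm n (squeeze c v))\<^sup>2"
      unfolding nrm_squeeze_sq power_mult_distrib left_diff_distrib by simp
    then show "c * nrm n v \<le> nrm n (squeeze c v)"
      by (rule power2_le_imp_le) simp
  qed
  have "hsf n (f ` A) \<le> ennreal ((1 + 8 * \<epsilon>) powr (real n - 1)) * hsf n ((\<lambda>x. squeeze c (perp n a x)) ` A)"
  proof (rule hausdorff_relational_lipschitz[OF dim_nonneg])
    fix x y assume xy: "x \<in> A" "y \<in> A"
    define w where "w = x - y"
    define v where "v = perp n a w"
    have w: "w \<in> Rn n"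
      using xy A by (auto simp: w_def)
    then have v: "v \<in> hyp"
      using a by (simp add: v_def hyp_def ipr_perp)
    have aw: "\<bar>ipr n a w\<bar> \<le> \<epsilon> * nrm n w"
      unfolding w_def using flat xy by blast
    have "nrm n w \<le> nrm n v + \<epsilon> * nrm n w"
      using nrm_le_perp[OF a(2), of w] aw by (simp add: v_def)
    moreover have "\<epsilon> * nrm n w \<le> 1 / 2 * nrm n w"
      using \<epsilon> by (intro mult_right_mono) auto
    ultimately have wv: "nrm n w \<le> 2 * nrm n v"
      by simp
    have "perp n b w = perp n b v + perp n b (ipr n a w \<cdot> a)"
      by (simp add: v_def perp_add[symmetric]) (simp add: perp_def)
    then have "nrm n (perp n b w) \<le> nrm n (perp n b v) + nrm n (perp n b (ipr n a w \<cdot> a))"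
      by (simp add: nrm_triangle)
    also have "nrm n (perp n b (ipr n a w \<cdot> a)) \<le> \<bar>ipr n a w\<bar>"
      using nrm_perp_le[OF b(2), of "ipr n a w \<cdot> a"] a(2) by (simp add: nrm_scl nrm_eq_1[symmetric])
    also have "nrm n (perp n b v) \<le> nrm n (squeeze c v)"
      using v by (rule perp_b)
    finally have "nrm n (f x - f y) \<le> nrm n (squeeze c v) + 2 * (\<epsilon> * nrm n w)"
      using tilt[OF xy, folded w_def] aw by linarith
    also have "\<epsilon> * nrm n w \<le> \<epsilon> * (2 * nrm n v)"
      using wv \<epsilon> by (intro mult_left_mono) auto
    also have "\<epsilon> * (2 * nrm n v) \<le> \<epsilon> * (4 * nrm n (squeeze c v))"
    proof (rule mult_left_mono)
      have "1 / 2 * nrm n v \<le> c * nrm n v"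
        using c by (intro mult_right_mono) auto
      then show "2 * nrm n v \<le> 4 * nrm n (squeeze c v)"
        using le_squeeze[OF v] by simp
    qed (use \<epsilon> in simp)
    \<comment> \<open>Origin of the 8: there are two errors \<open>\<epsilon> * nrm n w\<close>, one
      from \<open>tilt\<close> and one from the component of \<open>w\<close> along
      \<open>a\<close>; moreover \<open>nrm n w \<le> 2 * nrm n v\<close> and
      \<open>nrm n v \<le> 2 * nrm n (squeeze c v)\<close>.\<close>
    finally have "nrm n (f x - f y) \<le> (1 + 8 * \<epsilon>) * nrm n (squeeze c v)"
      by (simp add: algebra_simps)
    moreover have "squeeze c v = squeeze c (perp n a x) - squeeze c (perp n a y)"
      by (simp add: v_def w_def perp_diff squeeze_diff)
    ultimately show "edist n (f x) (f y) \<le>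
        (1 + 8 * \<epsilon>) * edist n (squeeze c (perp n a x)) (squeeze c (perp n a y))"
      by (simp add: edist_nrm)
  qed (use f \<epsilon> in auto)
  also have "hsf n ((\<lambda>x. squeeze c (perp n a x)) ` A) \<le> ennreal c * hsf n A"
  proof -
    have "hsf n (squeeze c ` perp n a ` A) \<le> ennreal c * hsf n (perp n a ` A)"
      using A a c by (intro hsf_squeeze_le) (auto simp: hyp_def ipr_perp)
    also have "\<dots> \<le> ennreal c * hsf n A"
      using A a
      by (intro mult_left_mono hausdorff_nonexpansive_image dim_nonneg)
         (auto simp: edist_nrm perp_diff[symmetric] nrm_perp_le)
    finally show ?thesis
      by (simp add: image_image)
  qed
  finally show ?thesis
    by (simp add: mult_left_mono)
qed

text \<open>A replacement for the area formula. For fixed \<open>\<epsilon>\<close>, countably many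
  of the neighbourhoods suffice by Lindelof; made disjoint, they cut \<open>A\<close> into Borel
  pieces whose estimates add up. The factor \<open>(1 + 8 * \<epsilon>) powr (real n - 1)\<close>
  tends to 1.\<close>

lemma hsf_locally_tilted_image_le:
  assumes n: "1 \<le> n" and c: "1 / 2 \<le> c" "c < 1"
    and A: "A \<subseteq> Rn n" "A \<in> sets borel" and f: "\<And>x. x \<in> A \<Longrightarrow> f x \<in> Rn n"
    and loc: "\<And>\<epsilon> x. 0 < \<epsilon> \<Longrightarrow> \<epsilon> \<le> 1 / 2 \<Longrightarrow> x \<in> A \<Longrightarrow>
      \<exists>U a b. open U \<and> x \<in> U \<and> a \<in> Rn n \<and> ipr n a a = 1 \<and> b \<in> Rn n \<and> ipr n b b = 1 \<and>
        0 \<le> ipr n a b \<and> ipr n a b \<le> c \<and>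
        (\<forall>y\<in>A \<inter> U. \<forall>z\<in>A \<inter> U. \<bar>ipr n a (y - z)\<bar> \<le> \<epsilon> * nrm n (y - z) \<and>
          nrm n (f y - f z) \<le> nrm n (perp n b (y - z)) + \<epsilon> * nrm n (y - z))"
  shows "hsf n (f ` A) \<le> ennreal c * hsf n A"
proof (cases "A = {} \<or> hsf n A = top")
  case True
  then show ?thesis
    using c by (auto simp: ennreal_mult_top)
next
  case False
  have s: "0 \<le> real n - 1" using n by simp
  have approx: "hsf n (f ` A) \<le> ennreal ((1 + 8 * \<epsilon>) powr (real n - 1)) * (ennreal c * hsf n A)"
    if \<epsilon>: "0 < \<epsilon>" "\<epsilon> \<le> 1 / 2" for \<epsilon>
  proof -
    let ?K = "ennreal ((1 + 8 * \<epsilon>) powr (real n - 1))"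
    \<comment> \<open>The estimate is required for all subsets of \<open>U\<close>, because making
      the cover disjoint leaves only parts of its members.\<close>
    define \<F> where "\<F> = {U. open U \<and>
        (\<forall>D\<subseteq>U. hsf n (f ` (A \<inter> D)) \<le> ?K * (ennreal c * hsf n (A \<inter> D)))}"
    have cover: "A \<subseteq> \<Union>\<F>"
    proof
      fix x assume "x \<in> A"
      from loc[OF \<epsilon> this] obtain U a b where U: "open U" "x \<in> U" "a \<in> Rn n" "ipr n a a = 1" "b \<in> Rn n"
          "ipr n b b = 1" "0 \<le> ipr n a b" "ipr n a b \<le> c"
        and est: "\<forall>y\<in>A \<inter> U. \<forall>z\<in>A \<inter> U. \<bar>ipr n a (y - z)\<bar> \<le> \<epsilon> * nrm n (y - z) \<and>
          nrm n (f y - f z) \<le> nrm n (perp n b (y - z)) + \<epsilon> * nrm n (y - z)"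
        by blast
      have "hsf n (f ` (A \<inter> D)) \<le> ?K * (ennreal c * hsf n (A \<inter> D))" if "D \<subseteq> U" for D
        by (rule hsf_tilted_image_le[OF U(3-8) c \<epsilon>]) (use A(1) f est that in blast)+
      then show "x \<in> \<Union>\<F>"
        using U(1,2) unfolding \<F>_def by blast
    qed
    have "\<And>U. U \<in> \<F> \<Longrightarrow> open U"
      by (simp add: \<F>_def)
    then obtain \<G> where \<G>: "\<G> \<subseteq> \<F>" "countable \<G>" "\<Union>\<G> = \<Union>\<F>"
      by (rule Lindelof)
    have "\<G> \<noteq> {}"
      using False cover \<G>(3) by auto
    define V where "V = from_nat_into \<G>"
    have V: "V k \<in> \<F>" for k
      unfolding V_def using from_nat_into[OF \<open>\<G> \<noteq> {}\<close>] \<G>(1) by blast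
    have "(\<Union>k. V k) = \<Union>\<G>"
      unfolding V_def using range_from_nat_into[OF \<open>\<G> \<noteq> {}\<close> \<G>(2)] by simp
    then have "A \<subseteq> (\<Union>k. V k)"
      using cover \<G>(3) by simp
    define D where "D k = A \<inter> disjointed V k" for k
    have UD: "(\<Union>k. D k) = A"
      using \<open>A \<subseteq> (\<Union>k. V k)\<close> UN_disjointed_eq[of V] unfolding D_def by blast
    have Vb: "V k \<in> sets borel" for k
      using V[of k] by (simp add: \<F>_def)
    have Db: "D k \<in> sets borel" for k
      unfolding D_def disjointed_def using A(2) Vb by auto
    have "hsf n (f ` A) = hsf n (\<Union>k. f ` D k)"
      unfolding UD[symmetric] by (simp add: image_UN)
    also have "\<dots> \<le> (\<Sum>k. hsf n (f ` D k))"
      by (rule hausdorff_UN_le)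
    also have "\<dots> \<le> (\<Sum>k. ?K * (ennreal c * hsf n (D k)))"
      using V disjointed_subset[of V] by (intro suminf_le) (auto simp: D_def \<F>_def)
    also have "\<dots> = ?K * (ennreal c * (\<Sum>k. hsf n (D k)))"
      by simp
    also have "(\<Sum>k. hsf n (D k)) = hsf n A"
      unfolding UD[symmetric]
    proof (rule hausdorff_sums_borel[OF s, symmetric])
      show "D k \<subseteq> Rn n" for k using A by (auto simp: D_def)
      show "disjoint_family D"
        using disjoint_family_disjointed[of V] unfolding D_def disjoint_family_on_def by blast
    qed (rule Db)
    finally show ?thesis .
  qed
  define r where "r = c * enn2real (hsf n A)"
  have r: "ennreal c * hsf n A = ennreal r" "0 \<le> r"
    using False c unfolding r_def by (simp_all add: ennreal_mult less_top)
  \<comment> \<open>The shift by two keeps the values at most \<open>1 / 2\<close>, as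
    \<open>approx\<close> demands.\<close>
  let ?\<epsilon> = "\<lambda>k. inverse (real (Suc (Suc k)))"
  have "(\<lambda>k. ?\<epsilon> k) \<longlonglongrightarrow> 0"
    using LIMSEQ_inverse_real_of_nat by (rule LIMSEQ_Suc)
  then have "(\<lambda>k. (1 + 8 * ?\<epsilon> k) powr (real n - 1) * r) \<longlonglongrightarrow> (1 + 8 * 0) powr (real n - 1) * r"
    by (intro tendsto_intros) auto
  then have "(\<lambda>k. ennreal ((1 + 8 * ?\<epsilon> k) powr (real n - 1) * r)) \<longlonglongrightarrow> ennreal r"
    by (intro tendsto_ennrealI) simp
  then have "hsf n (f ` A) \<le> ennreal r"
  proof (rule LIMSEQ_le_const)
    have "hsf n (f ` A) \<le> ennreal ((1 + 8 * ?\<epsilon> k) powr (real n - 1) * r)" for k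
      using approx[of "?\<epsilon> k"] r by (simp add: ennreal_mult field_simps)
    then show "\<exists>N. \<forall>k\<ge>N. hsf n (f ` A) \<le> ennreal ((1 + 8 * ?\<epsilon> k) powr (real n - 1) * r)"
      by blast
  qed
  then show ?thesis
    using r by simp
qed

section \<open>Orthogonal and radial projections as locally tilted maps\<close>

definition hproj :: "nat \<Rightarrow> (nat \<Rightarrow> real) \<Rightarrow> real \<Rightarrow> (nat \<Rightarrow> real) \<Rightarrow> nat \<Rightarrow> real"
  where "hproj n u h x = x - (ipr n u x - h) \<cdot> u"

lemma hproj_Rn [simp]: "u \<in> Rn n \<Longrightarrow> x \<in> Rn n \<Longrightarrow> hproj n u h x \<in> Rn n"
  by (simp add: hproj_def)

lemma hproj_diff: "hproj n u h x - hproj n u h y = perp n u (x - y)"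
  by (auto simp: hproj_def perp_def ipr_simps fun_eq_iff algebra_simps)

lemma hproj_nonexpansive: "ipr n u u = 1 \<Longrightarrow> edist n (hproj n u h x) (hproj n u h y) \<le> edist n x y"
  by (simp add: edist_nrm hproj_diff nrm_perp_le)

lemma esphere_Rn: "x \<in> esphere n \<Longrightarrow> x \<in> Rn n"
  and esphere_ipr: "x \<in> esphere n \<Longrightarrow> ipr n x x = 1"
  and esphere_nrm: "x \<in> esphere n \<Longrightarrow> nrm n x = 1"
  by (simp_all add: esphere_def nrm_eq_1)

lemma borel_esphere [measurable]: "esphere n \<in> sets borel"
  unfolding esphere_def by measurable

lemma open_edist_less: "open {y. edist n y x < r}"
  by (intro open_Collect_less continuous_intros)

text \<open>For unit vectors \<open>y + z\<close> is orthogonal to \<open>y - z\<close>, and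
  \<open>x\<close> differs little from the midpoint of \<open>y\<close> and
  \<open>z\<close>.\<close>

lemma chord_almost_orthogonal:
  assumes y: "ipr n y y = 1" and z: "ipr n z z = 1"
    and close: "edist n y x \<le> \<epsilon>" "edist n z x \<le> \<epsilon>"
  shows "\<bar>ipr n x (y - z)\<bar> \<le> \<epsilon> * nrm n (y - z)"
proof -
  have "2 * ipr n x (y - z) = - ipr n (y - x) (y - z) - ipr n (z - x) (y - z)"
    using y z by (simp add: ipr_simps ipr_commute[of n z y])
  moreover have "\<bar>ipr n (y - x) (y - z)\<bar> \<le> \<epsilon> * nrm n (y - z)" "\<bar>ipr n (z - x) (y - z)\<bar> \<le> \<epsilon> * nrm n (y - z)"
    using close unfolding edist_nrm
    by (auto intro!: order_trans[OF ipr_bound] mult_right_mono)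
  ultimately show ?thesis by linarith
qed

text \<open>Near \<open>x\<close> the sphere is almost orthogonal to \<open>x\<close>, so the pair
  \<open>a = x\<close>, \<open>b = u\<close> fits the local criterion; the tilt condition then holds
  without error because the differences of \<open>hproj\<close> are exactly those of
  \<open>perp\<close>.\<close>

lemma hsf_hproj_esphere_le:
  assumes n: "1 \<le> n" and c: "1 / 2 \<le> c" "c < 1" and u: "u \<in> Rn n" "ipr n u u = 1"
    and A: "A \<subseteq> esphere n" "A \<in> sets borel" and Au: "\<And>x. x \<in> A \<Longrightarrow> 0 \<le> ipr n u x \<and> ipr n u x \<le> c"
  shows "hsf n (hproj n u h ` A) \<le> ennreal c * hsf n A"
proof (rule hsf_locally_tilted_image_le[OF n c _ A(2)])
  show "A \<subseteq> Rn n"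
    using A(1) by (auto simp: esphere_def)
  then show "hproj n u h x \<in> Rn n" if "x \<in> A" for x
    using u that by auto
  fix \<epsilon> :: real and x assume \<epsilon>: "0 < \<epsilon>" and x: "x \<in> A"
  show "\<exists>U a b. open U \<and> x \<in> U \<and> a \<in> Rn n \<and> ipr n a a = 1 \<and> b \<in> Rn n \<and> ipr n b b = 1 \<and>
      0 \<le> ipr n a b \<and> ipr n a b \<le> c \<and>
      (\<forall>y\<in>A \<inter> U. \<forall>z\<in>A \<inter> U. \<bar>ipr n a (y - z)\<bar> \<le> \<epsilon> * nrm n (y - z) \<and>
        nrm n (hproj n u h y - hproj n u h z) \<le> nrm n (perp n b (y - z)) + \<epsilon> * nrm n (y - z))"
  proof (rule exI[of _ "{y. edist n y x < \<epsilon>}"], rule exI[of _ x], rule exI[of _ u], intro conjI ballI)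
    fix y z assume yz: "y \<in> A \<inter> {y. edist n y x < \<epsilon>}" "z \<in> A \<inter> {y. edist n y x < \<epsilon>}"
    then show "\<bar>ipr n x (y - z)\<bar> \<le> \<epsilon> * nrm n (y - z)"
      using A by (intro chord_almost_orthogonal) (auto intro: esphere_ipr)
    show "nrm n (hproj n u h y - hproj n u h z) \<le> nrm n (perp n u (y - z)) + \<epsilon> * nrm n (y - z)"
      using \<epsilon> by (simp add: hproj_diff)
  qed (use u x A \<epsilon> Au[OF x] in \<open>auto simp: open_edist_less ipr_commute[of n x u] esphere_ipr esphere_Rn\<close>)
qed

text \<open>The roles are exchanged: flatness with \<open>a = u\<close> is exact, and near
  \<open>x\<close> the radial projection is dominated by the projection along
  \<open>b = radial n x\<close> up to a small error. The additional shrinking by the norm is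
  discarded.\<close>

lemma hsf_radial_hyperplane_le:
  assumes n: "1 \<le> n" and c: "1 / 2 \<le> c" "c < 1" and u: "u \<in> Rn n" "ipr n u u = 1"
    and A: "A \<subseteq> {y \<in> Rn n. ipr n u y = h \<and> 1 \<le> nrm n y}" "A \<in> sets borel"
    and Au: "\<And>y. y \<in> A \<Longrightarrow> 0 \<le> ipr n u (radial n y) \<and> ipr n u (radial n y) \<le> c"
  shows "hsf n (radial n ` A) \<le> ennreal c * hsf n A"
proof (rule hsf_locally_tilted_image_le[OF n c _ A(2)])
  show "A \<subseteq> Rn n"
    using A(1) by auto
  then show "radial n x \<in> Rn n" if "x \<in> A" for x
    using that by auto
  fix \<epsilon> :: real and x assume \<epsilon>: "0 < \<epsilon>" and x: "x \<in> A"
  define b where "b = radial n x"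
  have unit: "ipr n (radial n y) (radial n y) = 1" if "y \<in> A" for y
    using nrm_radial[of n y] A(1) that by (auto simp: nrm_eq_1)
  have b: "b \<in> Rn n" "ipr n b b = 1"
    using x A(1) unit by (auto simp: b_def)
  let ?U = "{y. edist n y x < \<epsilon> / 2}"
  have main: "nrm n (radial n y - radial n z) \<le> nrm n (perp n b (y - z)) + \<epsilon> * nrm n (y - z)"
    if yz: "y \<in> A \<inter> ?U" "z \<in> A \<inter> ?U" for y z
  proof -
    define r where "r = nrm n y"
    define s where "s = nrm n z"
    define w where "w = y - z"
    define D where "D = radial n y - radial n z"
    have rs: "1 \<le> r" "1 \<le> s" "1 \<le> nrm n x"
      using yz x A(1) by (auto simp: r_def s_def)
    have close: "edist n (radial n y) b \<le> \<epsilon> / 2" "edist n (radial n z) b \<le> \<epsilon> / 2"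
      using radial_nonexpansive[of n y x] radial_nonexpansive[of n z x] rs yz
      by (auto simp: b_def r_def s_def)
    have Dw: "nrm n D \<le> nrm n w"
      using radial_nonexpansive[of n y z] rs by (simp add: D_def w_def r_def s_def edist_nrm)
    have "\<bar>ipr n b D\<bar> \<le> \<epsilon> / 2 * nrm n D"
      unfolding D_def using yz close by (intro chord_almost_orthogonal unit) auto
    also have "\<dots> \<le> \<epsilon> / 2 * nrm n w"
      using Dw \<epsilon> by (intro mult_left_mono) auto
    finally have 1: "\<bar>ipr n b D\<bar> \<le> \<epsilon> / 2 * nrm n w" .
    \<comment> \<open>The change of norm acts along \<open>radial n z\<close>, which is close to
      \<open>b\<close> and hence almost removed by \<open>perp n b\<close>. The component of
      \<open>D\<close> along \<open>b\<close> is small because \<open>D\<close> is a chord of the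
      sphere near \<open>b\<close>.\<close>
    have "D = (1 / r) \<cdot> w + ((s - r) / r) \<cdot> radial n z"
    proof
      fix i
      have "D i = y i / r - z i / s"
        by (simp add: D_def radial_def r_def s_def)
      also have "\<dots> = (y i - z i) / r + (s - r) / r * (z i / s)"
        using rs by (simp add: field_simps)
      finally show "D i = ((1 / r) \<cdot> w + ((s - r) / r) \<cdot> radial n z) i"
        by (simp add: w_def radial_def s_def)
    qed
    then have "perp n b D = (1 / r) \<cdot> perp n b w + ((s - r) / r) \<cdot> perp n b (radial n z)"
      by (simp add: perp_add perp_scl)
    then have "nrm n (perp n b D) \<le> nrm n (perp n b w) / r + \<bar>s - r\<bar> / r * nrm n (perp n b (radial n z))"
      using nrm_triangle[of n "(1 / r) \<cdot> perp n b w" "((s - r) / r) \<cdot> perp n b (radial n z)"] rs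
      by (simp add: nrm_scl)
    also have "nrm n (perp n b w) / r \<le> nrm n (perp n b w)"
      using divide_left_mono[of 1 r "nrm n (perp n b w)"] rs by simp
    also have "\<bar>s - r\<bar> / r * nrm n (perp n b (radial n z)) \<le> nrm n w * (\<epsilon> / 2)"
    proof (rule mult_mono)
      have "\<bar>s - r\<bar> / r \<le> \<bar>s - r\<bar> / 1"
        using rs by (intro divide_left_mono) auto
      then show "\<bar>s - r\<bar> / r \<le> nrm n w"
        using nrm_triangle_reverse[of n z y] nrm_minus_commute[of n z y] by (simp add: s_def r_def w_def)
      have "perp n b (radial n z) = perp n b (radial n z - b)"
        by (simp add: perp_diff perp_self b)
      then show "nrm n (perp n b (radial n z)) \<le> \<epsilon> / 2"
        using nrm_perp_le[OF b(2), of "radial n z - b"] close(2) by (simp add: edist_nrm)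
    qed auto
    finally have "nrm n (perp n b D) \<le> nrm n (perp n b w) + nrm n w * (\<epsilon> / 2)"
      by simp
    then show ?thesis
      using nrm_le_perp[OF b(2), of D] 1 unfolding D_def[symmetric] w_def[symmetric]
      by (simp add: algebra_simps)
  qed
  show "\<exists>U a b. open U \<and> x \<in> U \<and> a \<in> Rn n \<and> ipr n a a = 1 \<and> b \<in> Rn n \<and> ipr n b b = 1 \<and>
      0 \<le> ipr n a b \<and> ipr n a b \<le> c \<and>
      (\<forall>y\<in>A \<inter> U. \<forall>z\<in>A \<inter> U. \<bar>ipr n a (y - z)\<bar> \<le> \<epsilon> * nrm n (y - z) \<and>
        nrm n (radial n y - radial n z) \<le> nrm n (perp n b (y - z)) + \<epsilon> * nrm n (y - z))"
  proof (rule exI[of _ ?U], rule exI[of _ u], rule exI[of _ b], intro conjI ballI)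
    fix y z assume yz: "y \<in> A \<inter> ?U" "z \<in> A \<inter> ?U"
    then have "ipr n u (y - z) = 0"
      using A(1) by (auto simp: ipr_diff_right)
    then show "\<bar>ipr n u (y - z)\<bar> \<le> \<epsilon> * nrm n (y - z)"
      using \<epsilon> by simp
    show "nrm n (radial n y - radial n z) \<le> nrm n (perp n b (y - z)) + \<epsilon> * nrm n (y - z)"
      using yz by (rule main)
  next
    show "open ?U" by (rule open_edist_less)
  qed (use u b \<epsilon> Au[OF x] in \<open>simp_all add: b_def\<close>)
qed

text \<open>The cap is the image of the whole sphere under the map that projects along \<open>u\<close>, shrinks by the factor
  \<open>sqrt (2 * \<delta>)\<close> and lifts back to the sphere; lifting is Lipschitz with constant \<open>sqrt 2\<close> there.\<close>

lemma hsf_cap_le: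
  assumes n: "1 \<le> n" and u: "u \<in> Rn n" "ipr n u u = 1" and \<delta>: "0 < \<delta>" "\<delta> \<le> 1 / 16"
  shows "hsf n {x \<in> esphere n. 1 - \<delta> < ipr n u x} \<le> ennreal ((2 * sqrt \<delta>) powr (real n - 1)) * hsf n (esphere n)"
proof -
  \<comment> \<open>Projecting the cap along \<open>u\<close> gives vectors of squared norm at most
    \<open>1 - (1 - \<delta>)\<^sup>2\<close>, which is at most \<open>2 * \<delta>\<close>.\<close>
  define \<rho> where "\<rho> = sqrt (2 * \<delta>)"
  have \<rho>: "0 < \<rho>" "\<rho> * \<rho> = 2 * \<delta>"
    using \<delta> by (auto simp: \<rho>_def)
  define z where "z y = \<rho> \<cdot> perp n u y" for y
  define s where "s y = sqrt (1 - ipr n (z y) (z y))" for y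
  define f where "f y = z y + s y \<cdot> u" for y
  have z: "ipr n u (z y) = 0" for y
    by (simp add: z_def ipr_scl_right ipr_perp u)
  have zz: "ipr n (z y) (z y) \<le> 2 * \<delta>" if "y \<in> esphere n" for y
  proof -
    have "ipr n (perp n u y) (perp n u y) \<le> 1"
      using nrm_perp_le[OF u(2), of y] that by (simp add: esphere_nrm nrm_le_iff)
    then have "(\<rho> * \<rho>) * ipr n (perp n u y) (perp n u y) \<le> (\<rho> * \<rho>) * 1"
      using \<rho> \<delta> by (intro mult_left_mono) auto
    then show ?thesis
      by (simp add: z_def ipr_simps \<rho>(2) mult.assoc[symmetric])
  qed
  \<comment> \<open>Here \<open>\<delta> \<le> 1 / 16\<close> enters. Since two heights add up to at
    least 1, and two norms of projections to at most 1, the difference of heights is at most the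
    distance of the projections; the lift then costs the factor \<open>sqrt 2\<close>.\<close>
  have nz: "nrm n (z y) \<le> 1 / 2" "1 / 2 \<le> s y" "s y * s y = 1 - ipr n (z y) (z y)" if "y \<in> esphere n" for y
  proof -
    have le: "ipr n (z y) (z y) \<le> (1 / 2)\<^sup>2" "(1 / 2)\<^sup>2 \<le> 1 - ipr n (z y) (z y)"
      using zz[OF that] \<delta> by (auto simp: power2_eq_square)
    from le(1) show "nrm n (z y) \<le> 1 / 2"
      by (subst nrm_le_iff) auto
    from le(2) show "1 / 2 \<le> s y"
      unfolding s_def by (rule real_le_rsqrt)
    show "s y * s y = 1 - ipr n (z y) (z y)"
      using le by (simp add: s_def power2_eq_square)
  qed
  have "{x \<in> esphere n. 1 - \<delta> < ipr n u x} \<subseteq> f ` esphere n"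
  proof clarify
    fix x assume x: "x \<in> esphere n" "1 - \<delta> < ipr n u x"
    define p where "p = perp n u x"
    have up: "ipr n u p = 0"
      by (simp add: p_def ipr_perp u)
    have pp: "ipr n p p = 1 - (ipr n u x)\<^sup>2"
      using nrm_perp_sq[OF u(2), of x] x by (simp add: p_def nrm_sq esphere_ipr)
    have "(1 - \<delta>)\<^sup>2 \<le> (ipr n u x)\<^sup>2"
      using x \<delta> by (intro power_mono) auto
    moreover have "1 - 2 * \<delta> \<le> (1 - \<delta>)\<^sup>2"
      by (simp add: power2_eq_square algebra_simps)
    ultimately have "ipr n p p \<le> \<rho> * \<rho>"
      using pp \<rho> by simp
    then have le: "ipr n p p / (\<rho> * \<rho>) \<le> 1"
      using \<rho>(1) by (simp add: field_simps)
    define t where "t = sqrt (1 - ipr n p p / (\<rho> * \<rho>))"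
    have t: "t * t = 1 - ipr n p p / (\<rho> * \<rho>)"
      using le by (simp add: t_def)
    define y where "y = (1 / \<rho>) \<cdot> p + t \<cdot> u"
    have "ipr n y y = 1"
      using \<rho>(1) t up by (simp add: y_def ipr_simps u ipr_commute[of n p u])
    moreover have "y \<in> Rn n"
      using x u by (simp add: y_def p_def esphere_Rn)
    ultimately have y: "y \<in> esphere n"
      by (simp add: esphere_def nrm_eq_1)
    have "ipr n u y = t"
      by (simp add: y_def ipr_simps u up)
    then have "z y = p"
      using \<rho>(1) by (simp add: z_def perp_def y_def)
    moreover have "s y = ipr n u x"
      using x \<delta> by (simp add: s_def \<open>z y = p\<close> pp)
    ultimately have "f y = x"
      by (simp add: f_def p_def perp_def)
    then show "x \<in> f ` esphere n"
      using y by blast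
  qed
  then have "hsf n {x \<in> esphere n. 1 - \<delta> < ipr n u x} \<le> hsf n (f ` esphere n)"
    by (rule hausdorff_mono)
  also have "\<dots> \<le> ennreal ((2 * sqrt \<delta>) powr (real n - 1)) * hsf n (esphere n)"
  proof (rule hausdorff_lipschitz_image)
    show "f x \<in> Rn n" if "x \<in> esphere n" for x
      using that u by (simp add: f_def z_def esphere_Rn)
    fix x y assume xy: "x \<in> esphere n" "y \<in> esphere n"
    define d where "d = z x - z y"
    have "(s x - s y) * (s x + s y) = (nrm n (z y) + nrm n (z x)) * (nrm n (z y) - nrm n (z x))"
      using nz(3)[OF xy(1)] nz(3)[OF xy(2)] nrm_sq[of n "z x"] nrm_sq[of n "z y"]
      by (simp add: algebra_simps power2_eq_square)
    moreover have "\<bar>s x - s y\<bar> * (s x + s y) = \<bar>(s x - s y) * (s x + s y)\<bar>"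
      using nz(2)[OF xy(1)] nz(2)[OF xy(2)] by (simp add: abs_mult)
    ultimately have "\<bar>s x - s y\<bar> * (s x + s y) = (nrm n (z y) + nrm n (z x)) * \<bar>nrm n (z y) - nrm n (z x)\<bar>"
      by (simp add: abs_mult)
    also have "\<dots> \<le> 1 * nrm n d"
      using nz(1)[OF xy(1)] nz(1)[OF xy(2)] nrm_triangle_reverse[of n "z y" "z x"]
      by (intro mult_mono) (auto simp: d_def nrm_minus_commute)
    finally have "\<bar>s x - s y\<bar> * (s x + s y) \<le> nrm n d" by simp
    moreover have "\<bar>s x - s y\<bar> * 1 \<le> \<bar>s x - s y\<bar> * (s x + s y)"
      using nz(2)[OF xy(1)] nz(2)[OF xy(2)] by (intro mult_left_mono) auto
    ultimately have "\<bar>s x - s y\<bar> \<le> nrm n d"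
      by (metis mult.right_neutral order_trans)
    then have "(s x - s y)\<^sup>2 \<le> (nrm n d)\<^sup>2"
      by (rule abs_le_square_iff[THEN iffD1, of _ "nrm n d", simplified])
    moreover have "f x - f y = d + (s x - s y) \<cdot> u"
      by (simp add: f_def d_def scl_diff_left)
    then have "(nrm n (f x - f y))\<^sup>2 = (nrm n d)\<^sup>2 + (s x - s y)\<^sup>2"
    proof -
      have "ipr n u d = 0" "ipr n d u = 0"
        using z ipr_commute[of n d u] by (simp_all add: d_def ipr_diff_right)
      then show ?thesis
        unfolding \<open>f x - f y = _\<close> nrm_sq ipr_simps u(2) by (simp add: power2_eq_square)
    qed
    moreover have "d = \<rho> \<cdot> perp n u (x - y)"
      by (simp add: d_def z_def perp_diff scl_diff_right)
    then have "nrm n d \<le> \<rho> * nrm n (x - y)"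
      using \<rho>(1) nrm_perp_le[OF u(2), of "x - y"] by (simp add: nrm_scl)
    then have "(nrm n d)\<^sup>2 \<le> (\<rho> * nrm n (x - y))\<^sup>2"
      by (rule power_mono) simp
    then have "(nrm n d)\<^sup>2 \<le> 2 * \<delta> * (nrm n (x - y))\<^sup>2"
      unfolding power_mult_distrib power2_eq_square[of \<rho>] \<rho>(2) .
    ultimately have "(nrm n (f x - f y))\<^sup>2 \<le> (2 * sqrt \<delta> * nrm n (x - y))\<^sup>2"
      using \<delta> by (simp add: power_mult_distrib)
    then have "nrm n (f x - f y) \<le> 2 * sqrt \<delta> * nrm n (x - y)"
      by (rule power2_le_imp_le) (use \<delta> in simp)
    then show "edist n (f x) (f y) \<le> 2 * sqrt \<delta> * edist n x y"
      by (simp add: edist_nrm)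
  qed (use n \<delta> in auto)
  finally show ?thesis .
qed

section \<open>Null sets\<close>

text \<open>No condition on \<open>s\<close> is needed because \<open>0 powr s = 0\<close>, even for
  \<open>s = 0\<close>.\<close>

lemma hausdorff_singleton:
  assumes "x \<in> Rn n"
  shows "hausdorff n s {x} = 0"
proof -
  have ed: "ediam n {x} = 0"
    by (simp add: ediam_def)
  have "hausdorff_pre n s \<delta> {x} \<le> 0" for \<delta>
    using hausdorff_pre_finite_cover[of "{()}" "{x}" "\<lambda>_. {x}" n \<delta> s] assms
    by (simp add: ed hterm_def)
  then show ?thesis
    by (metis hausdorff_le le_zero_eq)
qed

text \<open>Infinitely many disjoint sets inside a set of finite measure have measures tending to 0.
  This yields null sets without any lower-dimensional measure.\<close>

lemma hsf_null_of_disjoint_copies: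
  assumes n: "1 \<le> n" and B: "\<And>k. B k \<in> sets borel" "\<And>k::nat. B k \<subseteq> G" "disjoint_family B"
    and G: "G \<subseteq> Rn n" "hsf n G < top" and D: "\<And>k. hsf n D \<le> hsf n (B k)"
  shows "hsf n D = 0"
proof -
  have "(\<Sum>k. hsf n (B k)) = hsf n (\<Union>k. B k)"
    using n B G by (intro hausdorff_sums_borel[symmetric]) auto
  also have "\<dots> \<le> hsf n G"
    using B by (intro hausdorff_mono) auto
  finally have fin: "(\<Sum>k. hsf n (B k)) < top"
    using G(2) by (rule order_le_less_trans)
  have "hsf n D \<le> 0"
  proof (rule ennreal_le_epsilon)
    fix e :: real assume "0 < e"
    then obtain N where N: "(\<Sum>k. hsf n (B (k + N))) \<le> ennreal e"
      using ennreal_suminf_tail[OF fin] by blast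
    have "hsf n D \<le> (\<Sum>k<1. hsf n (B (k + N)))"
      using D by simp
    also have "\<dots> \<le> (\<Sum>k. hsf n (B (k + N)))"
      by (rule sum_le_suminf) auto
    finally show "hsf n D \<le> 0 + ennreal e"
      using N by simp
  qed
  then show ?thesis by simp
qed

text \<open>The section is a sphere of radius \<open>r\<close> around \<open>h \<cdot> u\<close>
  inside the hyperplane. Its concentric dilations by the distinct factors \<open>t k\<close> are
  disjoint, lie in a disc, and shrink back onto it. The section is empty or one point when no
  positive radius remains.\<close>

lemma hsf_esphere_hyperplane:
  assumes n: "1 \<le> n" and u: "u \<in> Rn n" "ipr n u u = 1"
  shows "hsf n {x \<in> esphere n. ipr n u x = h} = 0"
proof -
  let ?D = "{x \<in> esphere n. ipr n u x = h}"
  let ?o = "h \<cdot> u"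
  have dist: "ipr n (x - ?o) (x - ?o) = 1 - h\<^sup>2" if "x \<in> ?D" for x
    using that u ipr_commute[of n x u] by (simp add: ipr_simps esphere_ipr power2_eq_square)
  consider "1 - h\<^sup>2 < 0" | "h\<^sup>2 = 1" | "0 < 1 - h\<^sup>2" by linarith
  then show ?thesis
  proof cases
    case 1
    have "?D = {}"
    proof (rule ccontr)
      assume "?D \<noteq> {}"
      then obtain x where "x \<in> ?D" by blast
      then show False
        using dist[of x] 1 ipr_self_nonneg[of n "x - ?o"] by linarith
    qed
    then show ?thesis by (simp only: hausdorff_empty)
  next
    case 2
    have "x = ?o" if "x \<in> ?D" for x
      using dist[OF that] 2 nrm_eq_0[of "x - ?o" n] that u by (simp add: nrm_def esphere_Rn)
    then have "hsf n ?D \<le> hsf n {?o}"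
      by (intro hausdorff_mono) blast
    then show ?thesis
      using u by (simp add: hausdorff_singleton)
  next
    case 3
    define r where "r = sqrt (1 - h\<^sup>2)"
    have r: "0 < r" "r \<le> 1"
      using 3 by (simp_all add: r_def)
    have h: "\<bar>h\<bar> \<le> 1"
      using 3 abs_square_less_1[of h] by simp
    define t where "t k = 1 + inverse (real (Suc k))" for k
    have t: "1 < t k" "t k \<le> 2" for k
      by (auto simp: t_def field_simps)
    define B where "B k = {x \<in> Rn n. ipr n u x = h \<and> nrm n (x - ?o) = t k * r}" for k
    show ?thesis
    proof (rule hsf_null_of_disjoint_copies[OF n, of B "{x \<in> Rn n. ipr n u x = h \<and> nrm n x \<le> 3}"])
      have m: "(\<lambda>x. nrm n (x - ?o)) \<in> borel_measurable borel"
        by (intro borel_measurable_continuous_onI continuous_intros)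
      show "B k \<in> sets borel" for k
        unfolding B_def using m by measurable
      show "B k \<subseteq> {x \<in> Rn n. ipr n u x = h \<and> nrm n x \<le> 3}" for k
      proof
        fix x assume x: "x \<in> B k"
        have "nrm n x \<le> nrm n (x - ?o) + nrm n ?o"
          using nrm_triangle[of n "x - ?o" ?o] by simp
        also have "nrm n ?o \<le> 1"
          using h u by (simp add: nrm_scl nrm_eq_1[symmetric])
        also have "nrm n (x - ?o) \<le> 2 * 1"
          using x t(1)[of k] t(2)[of k] r mult_mono[of "t k" 2 r 1] by (simp add: B_def)
        finally show "x \<in> {x \<in> Rn n. ipr n u x = h \<and> nrm n x \<le> 3}"
          using x by (simp add: B_def)
      qed
      show "disjoint_family B"
        unfolding disjoint_family_on_def
      proof (intro ballI impI equals0I)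
        fix k l :: nat and x assume "k \<noteq> l" "x \<in> B k \<inter> B l"
        then have "nrm n (x - ?o) = t k * r" "nrm n (x - ?o) = t l * r"
          unfolding B_def by blast+
        then have "t k * r = t l * r"
          by (rule trans[OF sym])
        then show False
          using r \<open>k \<noteq> l\<close> by (simp add: t_def)
      qed
      show "hsf n {x \<in> Rn n. ipr n u x = h \<and> nrm n x \<le> 3} < top"
        by (rule hsf_disc_finite[OF n u])
      show "hsf n ?D \<le> hsf n (B k)" for k
      proof -
        let ?f = "\<lambda>x. ?o + (1 / t k) \<cdot> (x - ?o)"
        have "?D \<subseteq> ?f ` B k"
        proof
          fix x assume x: "x \<in> ?D"
          define y where "y = ?o + t k \<cdot> (x - ?o)"
          have "y - ?o = t k \<cdot> (x - ?o)"
            by (simp add: y_def)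
          then have "nrm n (y - ?o) = t k * r"
            using t(1)[of k] dist[OF x] by (simp add: nrm_scl) (simp add: nrm_def r_def)
          moreover have "y \<in> Rn n" "ipr n u y = h"
            using x u by (simp_all add: y_def ipr_simps esphere_Rn)
          ultimately have "y \<in> B k"
            by (simp add: B_def)
          moreover have "?f y = x"
            using t(1)[of k] by (simp add: \<open>y - ?o = _\<close>)
          ultimately show "x \<in> ?f ` B k"
            by blast
        qed
        then have "hsf n ?D \<le> hsf n (?f ` B k)"
          by (rule hausdorff_mono)
        also have "\<dots> \<le> hsf n (B k)"
        proof (rule hausdorff_nonexpansive_image)
          fix x y
          have "?f x - ?f y = (1 / t k) \<cdot> (x - y)"
            by (auto simp: fun_eq_iff algebra_simps)
          then show "edist n (?f x) (?f y) \<le> edist n x y"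
            unfolding edist_nrm using t(1)[of k] mult_left_le_one_le[of "nrm n (x - y)" "1 / t k"]
            by (simp add: nrm_scl)
        qed (use n u in \<open>auto simp: B_def\<close>)
        finally show ?thesis .
      qed
    qed auto
  qed
qed

text \<open>The translates of \<open>F\<close> along \<open>w\<close> stay in the hyperplane of
  \<open>u\<close> and are pairwise disjoint because they differ in \<open>ipr n w\<close>.\<close>

lemma hsf_codim2_null:
  assumes n: "1 \<le> n" and u: "u \<in> Rn n" "ipr n u u = 1" and w: "w \<in> Rn n" "w \<noteq> 0" and uw: "ipr n u w = 0"
    and F: "F \<in> sets borel" "\<And>x. x \<in> F \<Longrightarrow> x \<in> Rn n \<and> nrm n x \<le> R \<and> ipr n u x = c \<and> ipr n w x = d"
  shows "hsf n F = 0"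
proof -
  define t where "t k = inverse (real (Suc k))" for k
  define B where "B k = (\<lambda>x. x - t k \<cdot> w) -` F" for k
  have ww: "0 < ipr n w w"
    using w nrm_eq_0[of w n] ipr_self_nonneg[of n w] by (auto simp: nrm_def less_le)
  have B: "x \<in> Rn n" "nrm n x \<le> R + nrm n w" "ipr n u x = c" "ipr n w x = d + t k * ipr n w w"
    if "x \<in> B k" for x k
  proof -
    define y where "y = x - t k \<cdot> w"
    have x: "x = y + t k \<cdot> w" and y: "y \<in> F"
      using that by (simp_all add: y_def B_def)
    show "x \<in> Rn n" "ipr n u x = c" "ipr n w x = d + t k * ipr n w w"
      using F(2)[OF y] w uw by (simp_all add: x ipr_simps)
    have "nrm n x \<le> nrm n y + t k * nrm n w"
      using nrm_triangle[of n y "t k \<cdot> w"] by (simp add: x nrm_scl t_def)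
    also have "t k * nrm n w \<le> 1 * nrm n w"
      by (intro mult_right_mono) (auto simp: t_def field_simps)
    finally show "nrm n x \<le> R + nrm n w"
      using F(2)[OF y] by simp
  qed
  show ?thesis
  proof (rule hsf_null_of_disjoint_copies[OF n, of B "{x \<in> Rn n. ipr n u x = c \<and> nrm n x \<le> R + nrm n w}"])
    have meas: "(\<lambda>x. x - t k \<cdot> w) \<in> borel \<rightarrow>\<^sub>M borel" for k
      by (intro borel_measurable_continuous_onI continuous_intros)
    show "B k \<in> sets borel" for k
      using measurable_sets[OF meas F(1), of k] by (simp add: B_def)
    show "B k \<subseteq> {x \<in> Rn n. ipr n u x = c \<and> nrm n x \<le> R + nrm n w}" for k
      using B by blast
    show "disjoint_family B"
      unfolding disjoint_family_on_def
    proof (intro ballI impI equals0I)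
      fix k l :: nat and x assume "k \<noteq> l" "x \<in> B k \<inter> B l"
      then have "d + t k * ipr n w w = d + t l * ipr n w w"
        using B(4) by (metis IntD1 IntD2)
      then show False
        using ww \<open>k \<noteq> l\<close> by (simp add: t_def)
    qed
    show "hsf n {x \<in> Rn n. ipr n u x = c \<and> nrm n x \<le> R + nrm n w} < top"
      by (rule hsf_disc_finite[OF n u])
    show "hsf n F \<le> hsf n (B k)" for k
    proof -
      have "F \<subseteq> (\<lambda>x. x - t k \<cdot> w) ` B k"
      proof
        fix x assume "x \<in> F"
        then have "x + t k \<cdot> w \<in> B k" "x = (x + t k \<cdot> w) - t k \<cdot> w"
          by (simp_all add: B_def)
        then show "x \<in> (\<lambda>x. x - t k \<cdot> w) ` B k" by blast
      qed
      then have "hsf n F \<le> hsf n ((\<lambda>x. x - t k \<cdot> w) ` B k)"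
        by (rule hausdorff_mono)
      also have "\<dots> \<le> hsf n (B k)"
        using n w B(1) by (intro hausdorff_nonexpansive_image) (auto simp: edist_nrm)
      finally show ?thesis .
    qed
  qed auto
qed

text \<open>Gaussian elimination in the last coordinate: a pivot \<open>v k\<close> clears it from
  the other vectors, and the last coordinate of the solution is then chosen to satisfy the equation
  of \<open>k\<close>.\<close>

lemma underdetermined_system:
  assumes "finite J" "card J < n"
  shows "\<exists>w\<in>Rn n. w \<noteq> 0 \<and> (\<forall>j\<in>J. ipr n (v j) w = 0)"
  using assms
proof (induction n arbitrary: J v)
  case (Suc n)
  show ?case
  proof (cases "\<forall>j\<in>J. v j n = 0")
    case True
    let ?w = "\<lambda>i. if i = n then 1 else 0 :: real"
    have "?w \<in> Rn (Suc n)" "?w \<noteq> 0"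
      by (auto simp: Rn_def fun_eq_iff)
    moreover have "ipr (Suc n) (v j) ?w = 0" if "j \<in> J" for j
      using True that by (simp add: ipr_def)
    ultimately show ?thesis by blast
  next
    case False
    then obtain k where k: "k \<in> J" "v k n \<noteq> 0" by blast
    define v' where "v' j = v j - (v j n / v k n) \<cdot> v k" for j
    have "card (J - {k}) < n"
      using card_Diff1_less[OF Suc.prems(1) k(1)] Suc.prems(2) by linarith
    then obtain w where w: "w \<in> Rn n" "w \<noteq> 0" "\<And>j. j \<in> J - {k} \<Longrightarrow> ipr n (v' j) w = 0"
      using Suc.IH[of "J - {k}" v'] Suc.prems(1) by blast
    define w' where "w' = w(n := - ipr n (v k) w / v k n)"
    have ext: "ipr (Suc n) x w' = ipr n x w - x n * ipr n (v k) w / v k n" for x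
      by (simp add: ipr_def w'_def)
    have "w' \<in> Rn (Suc n)"
      using w(1) by (auto simp: Rn_def w'_def)
    moreover have "w' \<noteq> 0"
    proof -
      obtain i where "w i \<noteq> 0"
        using w(2) by (auto simp: fun_eq_iff)
      then have "w' i \<noteq> 0"
        using w(1) by (auto simp: w'_def Rn_def)
      then show ?thesis by auto
    qed
    moreover have "ipr (Suc n) (v j) w' = 0" if "j \<in> J" for j
    proof (cases "j = k")
      case False
      then have "ipr n (v' j) w = 0"
        using that w(3) by blast
      then show ?thesis
        by (simp add: ext v'_def ipr_simps)
    qed (use k in \<open>simp add: ext\<close>)
    ultimately show ?thesis by blast
  qed
qed simp

text \<open>If every such \<open>w\<close> were violated by some point of \<open>F\<close>,
  independent points could be picked greedily: choose \<open>w\<close> orthogonal to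
  \<open>u\<close> and to the differences found so far, and add a point of \<open>F\<close> off the
  hyperplane of \<open>w\<close> through \<open>x0\<close>.\<close>

lemma not_aff_indep_normal:
  assumes n: "1 \<le> n" and F: "x0 \<in> F" and dep: "\<not> aff_indep_pts n (n - 1) F"
  shows "\<exists>w\<in>Rn n. w \<noteq> 0 \<and> ipr n u w = 0 \<and> (\<forall>x\<in>F. ipr n w (x - x0) = 0)"
proof (rule ccontr)
  assume "\<not> ?thesis"
  then have ex: "\<exists>x\<in>F. ipr n w (x - x0) \<noteq> 0" if "w \<in> Rn n" "w \<noteq> 0" "ipr n u w = 0" for w
    using that by blast
  have "\<exists>p :: nat \<Rightarrow> nat \<Rightarrow> real. p 0 = x0 \<and> (\<forall>j\<le>k. p j \<in> F) \<and>
      (\<forall>a :: nat \<Rightarrow> real. (\<forall>i<n. (\<Sum>j\<in>{1..k}. a j * (p j i - p 0 i)) = 0) \<longrightarrow> (\<forall>j\<in>{1..k}. a j = 0))"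
    if "k \<le> n - 1" for k
    using that
  proof (induction k)
    case 0
    then show ?case
      using F by (intro exI[of _ "\<lambda>_. x0"]) simp
  next
    case (Suc k)
    then obtain p where p: "p 0 = x0" "\<And>j. j \<le> k \<Longrightarrow> p j \<in> F"
      "\<And>a. \<forall>i<n. (\<Sum>j\<in>{1..k}. a j * (p j i - p 0 i)) = 0 \<Longrightarrow> \<forall>j\<in>{1..k}. a j = (0 :: real)"
      by (metis Suc_leD)
    \<comment> \<open>Index 0 stands for \<open>u\<close> and the indices \<open>1..k\<close> for
      the differences: \<open>k + 1\<close> equations in \<open>n\<close> unknowns.\<close>
    have "card {..k} < n"
      using Suc.prems by simp
    then obtain w where w: "w \<in> Rn n" "w \<noteq> 0"
        "\<And>j. j \<in> {..k} \<Longrightarrow> ipr n (if j = 0 then u else p j - x0) w = 0"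
      using underdetermined_system[of "{..k}" n "\<lambda>j. if j = 0 then u else p j - x0"] by blast
    have "ipr n u w = 0"
      using w(3)[of 0] by simp
    then obtain x where x: "x \<in> F" "ipr n w (x - x0) \<noteq> 0"
      using ex w by blast
    have pw: "ipr n w (p j - x0) = 0" if "j \<in> {1..k}" for j
      using w(3)[of j] that by (simp add: ipr_commute)
    define p' where "p' = p(Suc k := x)"
    have "\<forall>j\<in>{1..Suc k}. a j = 0" if a: "\<forall>i<n. (\<Sum>j\<in>{1..Suc k}. a j * (p' j i - p' 0 i)) = 0" for a :: "nat \<Rightarrow> real"
    proof -
      have split: "(\<Sum>j\<in>{1..Suc k}. a j * (p' j i - p' 0 i)) =
          (\<Sum>j\<in>{1..k}. a j * (p j i - p 0 i)) + a (Suc k) * (x i - x0 i)" for i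
        by (simp add: p'_def p(1))
      have "0 = (\<Sum>i<n. w i * (\<Sum>j\<in>{1..Suc k}. a j * (p' j i - p' 0 i)))"
        using a by simp
      also have "\<dots> = (\<Sum>i<n. \<Sum>j\<in>{1..k}. a j * (w i * (p j i - x0 i))) + a (Suc k) * ipr n w (x - x0)"
        unfolding split by (simp add: distrib_left sum.distrib sum_distrib_left ipr_def p(1) mult_ac)
      also have "(\<Sum>i<n. \<Sum>j\<in>{1..k}. a j * (w i * (p j i - x0 i))) = (\<Sum>j\<in>{1..k}. a j * ipr n w (p j - x0))"
        by (subst sum.swap) (simp add: ipr_def sum_distrib_left)
      also have "\<dots> = 0"
        by (simp add: pw)
      finally have "a (Suc k) = 0"
        using x(2) by (simp add: fun_diff_def)
      then have "\<forall>i<n. (\<Sum>j\<in>{1..k}. a j * (p j i - p 0 i)) = 0"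
        using a unfolding split by simp
      then have "\<forall>j\<in>{1..k}. a j = 0"
        by (rule p(3))
      then show ?thesis
        using \<open>a (Suc k) = 0\<close> by (auto simp: le_Suc_eq)
    qed
    moreover have "p' 0 = x0" "\<forall>j\<le>Suc k. p' j \<in> F"
      using p(1,2) x(1) by (auto simp: p'_def le_Suc_eq)
    ultimately show ?case by blast
  qed
  from this[of "n - 1"] show False
    using dep unfolding aff_indep_pts_def by blast
qed

lemma hsf_degenerate_null:
  assumes n: "1 \<le> n" and u: "u \<in> Rn n" "ipr n u u = 1"
    and F: "F \<in> sets borel" "\<And>x. x \<in> F \<Longrightarrow> x \<in> Rn n \<and> nrm n x \<le> R \<and> ipr n u x = c"
    and dep: "\<not> aff_indep_pts n (n - 1) F"
  shows "hsf n F = 0"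
proof (cases "F = {}")
  case False
  then obtain x0 where x0: "x0 \<in> F" by blast
  obtain w where w: "w \<in> Rn n" "w \<noteq> 0" "ipr n u w = 0" "\<forall>x\<in>F. ipr n w (x - x0) = 0"
    using not_aff_indep_normal[OF n x0 dep] by blast
  show ?thesis
    by (rule hsf_codim2_null[OF n u w(1-3) F(1), of R c "ipr n w x0"])
       (use F(2) w(4) in \<open>auto simp: ipr_diff_right\<close>)
qed simp

section \<open>Faces of polytopes\<close>

text \<open>Faces of all dimensions, with normalised normals. A bound \<open>c\<close> that is not
  attained contributes the empty face.\<close>

definition exposed_faces :: "nat \<Rightarrow> (nat \<Rightarrow> real) set \<Rightarrow> (nat \<Rightarrow> real) set set"
  where "exposed_faces n P = {G. \<exists>u\<in>Rn n. \<exists>c. ipr n u u = 1 \<and> (\<forall>x\<in>P. ipr n u x \<le> c) \<and> G = {x\<in>P. ipr n u x = c}}"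

locale polytope =
  fixes n :: nat and P S :: "(nat \<Rightarrow> real) set"
  assumes n: "2 \<le> n" and finS: "finite S" and SRn: "S \<subseteq> Rn n"
    and P: "P = {x. \<exists>w. (\<forall>s\<in>S. 0 \<le> w s) \<and> sum w S = 1 \<and> x = (\<lambda>i. \<Sum>s\<in>S. w s * s i)}"
begin

lemma P_subset_Rn: "P \<subseteq> Rn n"
proof
  fix x assume "x \<in> P"
  then obtain w where "x = (\<lambda>i. \<Sum>s\<in>S. w s * s i)"
    unfolding P by blast
  then show "x \<in> Rn n"
    using SRn by (auto simp: Rn_def subset_eq intro!: sum.neutral)
qed

lemma S_subset_P: "S \<subseteq> P"
proof
  fix x assume x: "x \<in> S"
  let ?w = "\<lambda>s. if s = x then 1 else 0 :: real"
  have "x i = (\<Sum>s\<in>S. ?w s * s i)" for i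
  proof -
    have "(\<Sum>s\<in>S. ?w s * s i) = (\<Sum>s\<in>S. if s = x then x i else 0)"
      by (rule sum.cong) auto
    then show ?thesis
      using x finS by (simp add: sum.delta)
  qed
  moreover have "sum ?w S = 1"
    using x finS by (simp add: sum.delta)
  ultimately show "x \<in> P"
    unfolding P by (intro CollectI exI[of _ ?w]) auto
qed

lemma ipr_combination: "ipr n u (\<lambda>i. \<Sum>s\<in>S. w s * s i) = (\<Sum>s\<in>S. w s * ipr n u s)"
  unfolding ipr_def sum_distrib_left by (subst sum.swap) (simp add: mult_ac)

lemma P_convex:
  assumes x: "x \<in> P" and y: "y \<in> P" and t: "0 \<le> t" "t \<le> 1"
  shows "x + t \<cdot> (y - x) \<in> P"
proof -
  obtain v w where v: "\<forall>s\<in>S. 0 \<le> v s" "sum v S = 1" "x = (\<lambda>i. \<Sum>s\<in>S. v s * s i)"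
    and w: "\<forall>s\<in>S. 0 \<le> w s" "sum w S = 1" "y = (\<lambda>i. \<Sum>s\<in>S. w s * s i)"
    using x y unfolding P by blast
  define z where "z s = (1 - t) * v s + t * w s" for s
  have "\<forall>s\<in>S. 0 \<le> z s"
    using v(1) w(1) t by (auto simp: z_def)
  moreover have "sum z S = 1"
    using v(2) w(2) by (simp add: z_def sum.distrib sum_distrib_left[symmetric])
  moreover have "x + t \<cdot> (y - x) = (\<lambda>i. \<Sum>s\<in>S. z s * s i)"
    unfolding v(3) w(3) z_def
    by (simp add: fun_eq_iff sum.distrib sum_distrib_left sum_subtractf algebra_simps)
  ultimately show ?thesis
    unfolding P by blast
qed

lemma compact_P: "compact P"
proof -
  \<comment> \<open>Weights are pinned to 0 outside \<open>S\<close>, so that they range over a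
    compact product.\<close>
  define W where "W = {w \<in> PiE UNIV (\<lambda>s. if s \<in> S then {0..1} else {0 :: real}). sum w S = 1}"
  define f where "f w = (\<lambda>i. \<Sum>s\<in>S. w s * s i)" for w :: "(nat \<Rightarrow> real) \<Rightarrow> real"
  have "P = f ` W"
  proof (intro equalityI subsetI)
    fix x assume "x \<in> P"
    then obtain w where w: "\<forall>s\<in>S. 0 \<le> w s" "sum w S = 1" "x = f w"
      unfolding P f_def by blast
    define w' where "w' s = (if s \<in> S then w s else 0)" for s
    have "w s \<le> 1" if "s \<in> S" for s
      using member_le_sum[of s S w] w that finS by simp
    then have "w' \<in> W"
      using w(1,2) by (auto simp: W_def w'_def)
    moreover have "x = f w'"
      by (simp add: w(3) f_def w'_def)
    ultimately show "x \<in> f ` W" by blast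
  next
    fix x assume "x \<in> f ` W"
    then obtain w where w: "w \<in> W" "x = f w" by blast
    have "0 \<le> w s" if "s \<in> S" for s
      using w(1) PiE_mem[of w UNIV "\<lambda>s. if s \<in> S then {0..1} else {0}" s] that by (auto simp: W_def)
    then show "x \<in> P"
      using w unfolding P f_def W_def by blast
  qed
  moreover have "continuous_on W f"
    unfolding f_def
    by (rule continuous_on_coordinatewise_then_product, rule continuous_on_sum, rule continuous_on_mult,
        rule continuous_on_product_then_coordinatewise[OF continuous_on_id], rule continuous_on_const)
  moreover have "compact W"
  proof -
    have "compact (PiE UNIV (\<lambda>s. if s \<in> S then {0..1} else {0 :: real}))"
      using compactin_PiE[of "\<lambda>_. euclidean :: real topology" UNIV "\<lambda>s. if s \<in> S then {0..1} else {0}"]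
      by (auto simp: euclidean_product_topology)
    moreover have "closed {w :: (nat \<Rightarrow> real) \<Rightarrow> real. sum w S = 1}"
      by (rule closed_Collect_eq, rule continuous_on_sum,
          rule continuous_on_product_then_coordinatewise[OF continuous_on_id], rule continuous_on_const)
    ultimately have "compact (PiE UNIV (\<lambda>s. if s \<in> S then {0..1} else {0 :: real}) \<inter> {w. sum w S = 1})"
      by (rule compact_Int_closed)
    then show ?thesis
      by (simp add: W_def Int_def)
  qed
  ultimately show ?thesis
    by (simp add: compact_continuous_image)
qed

lemma closed_P: "closed P"
  using compact_P by (rule compact_imp_closed)

lemma P_bounded: obtains R where "\<And>x. x \<in> P \<Longrightarrow> nrm n x \<le> R"
proof -
  have "compact (nrm n ` P)"
    by (intro compact_continuous_image compact_P continuous_intros)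
  then have "bounded (nrm n ` P)"
    by (rule compact_imp_bounded)
  then obtain R where "\<forall>y\<in>nrm n ` P. \<bar>y\<bar> \<le> R"
    by (auto simp: bounded_iff)
  then have "nrm n x \<le> R" if "x \<in> P" for x
    using that by force
  then show ?thesis by (rule that)
qed

lemma compact_face: "compact {x\<in>P. ipr n u x = c}"
proof -
  have "{x\<in>P. ipr n u x = c} = P \<inter> {x. ipr n u x = c}"
    by auto
  then show ?thesis
    by (simp only:) (intro compact_Int_closed compact_P closed_Collect_eq continuous_intros)
qed

lemma exposed_face_compact: "G \<in> exposed_faces n P \<Longrightarrow> compact G"
  using compact_face by (auto simp: exposed_faces_def)

text \<open>The deficit \<open>c - ipr n u x\<close> is a sum of nonnegative terms, one for each
  generator, so it vanishes only if every term does.\<close>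

lemma face_combination:
  assumes le: "\<forall>x\<in>P. ipr n u x \<le> c" and w: "\<forall>s\<in>S. 0 \<le> w s" "sum w S = 1"
    and x: "x = (\<lambda>i. \<Sum>s\<in>S. w s * s i)"
  shows "ipr n u x = c \<longleftrightarrow> (\<forall>s\<in>S. w s = 0 \<or> ipr n u s = c)"
proof -
  have "c - ipr n u x = (\<Sum>s\<in>S. w s * c) - (\<Sum>s\<in>S. w s * ipr n u s)"
    unfolding x ipr_combination using w(2) by (simp add: sum_distrib_right[symmetric])
  also have "\<dots> = (\<Sum>s\<in>S. w s * (c - ipr n u s))"
    by (simp add: sum_subtractf right_diff_distrib)
  finally have eq: "c - ipr n u x = (\<Sum>s\<in>S. w s * (c - ipr n u s))" .
  have "0 \<le> w s * (c - ipr n u s)" if "s \<in> S" for s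
    using le w(1) S_subset_P that by auto
  then have "(\<Sum>s\<in>S. w s * (c - ipr n u s)) = 0 \<longleftrightarrow> (\<forall>s\<in>S. w s * (c - ipr n u s) = 0)"
    by (rule sum_nonneg_eq_0_iff[OF finS])
  then show ?thesis
    using eq by auto
qed

text \<open>By \<open>face_combination\<close> a face is determined by the generators that it
  contains.\<close>

lemma finite_exposed_faces: "finite (exposed_faces n P)"
proof -
  have "inj_on (\<lambda>G. G \<inter> S) (exposed_faces n P)"
  proof (rule inj_onI)
    have sub: "G \<subseteq> H" if G: "G \<in> exposed_faces n P" and H: "H \<in> exposed_faces n P" and eq: "G \<inter> S = H \<inter> S" for G H
    proof
      fix x assume x: "x \<in> G"
      obtain u c where u: "\<forall>x\<in>P. ipr n u x \<le> c" "G = {x\<in>P. ipr n u x = c}"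
        using G unfolding exposed_faces_def by blast
      obtain v d where v: "\<forall>x\<in>P. ipr n v x \<le> d" "H = {x\<in>P. ipr n v x = d}"
        using H unfolding exposed_faces_def by blast
      obtain w where w: "\<forall>s\<in>S. 0 \<le> w s" "sum w S = 1" "x = (\<lambda>i. \<Sum>s\<in>S. w s * s i)"
        using x u(2) unfolding P by blast
      have "\<forall>s\<in>S. w s = 0 \<or> ipr n u s = c"
        using face_combination[OF u(1) w] x u(2) by blast
      then have "\<forall>s\<in>S. w s = 0 \<or> ipr n v s = d"
        using eq u(2) v(2) S_subset_P by blast
      then have "ipr n v x = d"
        using face_combination[OF v(1) w] by blast
      then show "x \<in> H"
        using x u(2) v(2) by blast
    qed
    fix G H assume "G \<in> exposed_faces n P" "H \<in> exposed_faces n P" "G \<inter> S = H \<inter> S"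
    then show "G = H"
      using sub[of G H] sub[of H G] by blast
  qed
  moreover have "finite ((\<lambda>G. G \<inter> S) ` exposed_faces n P)"
    by (rule finite_subset[of _ "Pow S"]) (use finS in auto)
  ultimately show ?thesis
    by (rule finite_imageD[rotated])
qed

text \<open>If the angle at \<open>p\<close> were acute, a short step from \<open>p\<close> towards
  \<open>q\<close> would stay in \<open>P\<close> and come closer to \<open>z\<close>.\<close>

lemma nearest_point_normal:
  assumes p: "p \<in> P" and near: "\<And>q. q \<in> P \<Longrightarrow> edist n z p \<le> edist n z q" and q: "q \<in> P"
  shows "ipr n (z - p) q \<le> ipr n (z - p) p"
proof (rule ccontr)
  define v where "v = z - p"
  define d where "d = q - p"
  assume "\<not> ?thesis"
  then have pos: "0 < ipr n v d"
    by (simp add: v_def d_def ipr_diff_right)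
  \<comment> \<open>The step is short enough for its quadratic cost to be dominated by the linear
    gain; the \<open>+ 1\<close> keeps the denominator positive.\<close>
  define t where "t = min 1 (ipr n v d / (ipr n d d + 1))"
  have dd: "0 < ipr n d d + 1"
    using ipr_self_nonneg[of n d] by linarith
  have t: "0 < t" "t \<le> 1" "t * (ipr n d d + 1) \<le> ipr n v d"
    using pos dd by (simp_all add: t_def pos_le_divide_eq[symmetric])
  have "p + t \<cdot> d \<in> P"
    unfolding d_def using p q t by (intro P_convex) auto
  then have "nrm n v \<le> nrm n (v - t \<cdot> d)"
    using near[of "p + t \<cdot> d"] by (simp add: edist_nrm v_def diff_diff_eq)
  then have "ipr n v v \<le> ipr n (v - t \<cdot> d) (v - t \<cdot> d)"
    by (simp add: nrm_mono_iff)
  then have "2 * (t * ipr n v d) \<le> t * (t * ipr n d d)"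
    by (simp add: ipr_simps ipr_commute[of n d v] algebra_simps)
  then have "2 * ipr n v d \<le> t * ipr n d d"
    using t(1) by (simp add: mult_left_le_imp_le)
  moreover have "t * ipr n d d \<le> ipr n v d"
    using t by (simp add: distrib_left)
  ultimately show False
    using pos by simp
qed

text \<open>If \<open>p\<close> missed all faces, it would have a positive distance \<open>m\<close>
  from their finite union. But the nearest point in \<open>P\<close> of an outside point
  \<open>z\<close> close to \<open>p\<close> lies on an exposed face with normal direction
  \<open>z - q\<close>, and within \<open>m\<close> of \<open>p\<close>.\<close>

lemma bdry_in_exposed_face:
  assumes p: "p \<in> bdry n P"
  obtains G where "G \<in> exposed_faces n P" "p \<in> G"
proof (rule ccontr)
  assume "\<not> thesis"
  then have "\<forall>G\<in>exposed_faces n P. p \<notin> G"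
    using that by blast
  then have no: "p \<notin> G" if "G \<in> exposed_faces n P" for G
    using that by blast
  have pR: "p \<in> Rn n"
    using p by (simp add: bdry_def)
  have "\<exists>d>0. \<forall>x\<in>G. d \<le> edist n p x" if G: "G \<in> exposed_faces n P" for G
  proof (cases "G = {}")
    case False
    have "continuous_on G (\<lambda>x. edist n p x)"
      by (intro continuous_intros)
    then obtain x where x: "x \<in> G" "\<forall>y\<in>G. edist n p x \<le> edist n p y"
      using continuous_attains_inf[OF exposed_face_compact[OF G] False] by blast
    have "x \<in> Rn n"
      using G x(1) P_subset_Rn by (auto simp: exposed_faces_def)
    then have "edist n p x \<noteq> 0"
      using no[OF G] x(1) pR nrm_eq_0[of "p - x" n] by (auto simp: edist_nrm)
    then show ?thesis
      using x(2) by (intro exI[of _ "edist n p x"]) (simp add: less_le)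
  qed (auto intro: exI[of _ 1])
  then obtain d where d: "\<And>G. G \<in> exposed_faces n P \<Longrightarrow> 0 < d G"
      "\<And>G x. G \<in> exposed_faces n P \<Longrightarrow> x \<in> G \<Longrightarrow> d G \<le> edist n p x"
    by metis
  define m where "m = Min (insert 1 (d ` exposed_faces n P))"
  have m: "0 < m" "\<And>G. G \<in> exposed_faces n P \<Longrightarrow> m \<le> d G"
    using finite_exposed_faces d(1) by (auto simp: m_def)
  have near: "\<exists>y\<in>P. edist n p y < e" "\<exists>z\<in>Rn n - P. edist n p z < e" if "0 < e" for e
    using p that by (simp_all add: bdry_def)
  obtain z where z: "z \<in> Rn n" "z \<notin> P" "edist n p z < m / 2"
    using near(2)[of "m / 2"] m(1) by auto
  \<comment> \<open>\<open>bdry\<close> does not by definition put \<open>p\<close> into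
    \<open>P\<close>, so a nearby point of \<open>P\<close> serves as competitor for the nearest
    point.\<close>
  obtain y where y: "y \<in> P" "edist n p y < m / 2 - edist n p z"
    using near(1)[of "m / 2 - edist n p z"] z(3) by auto
  have "continuous_on P (\<lambda>x. edist n z x)"
    by (intro continuous_intros)
  then obtain q where q: "q \<in> P" "\<forall>x\<in>P. edist n z q \<le> edist n z x"
    using continuous_attains_inf[OF compact_P] y(1) by blast
  define v where "v = z - q"
  have v: "v \<in> Rn n" "v \<noteq> 0"
    using z q(1) P_subset_Rn by (auto simp: v_def)
  then have nv: "0 < nrm n v"
    using nrm_eq_0[OF v(1)] by (simp add: less_le)
  define u where "u = (1 / nrm n v) \<cdot> v"
  have "ipr n u u = 1"
    using nrm_radial[of n v] nv by (simp add: u_def radial_def nrm_eq_1)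
  moreover have "u \<in> Rn n"
    using v(1) by (simp add: u_def)
  moreover have "ipr n u x \<le> ipr n u q" if "x \<in> P" for x
    using nearest_point_normal[OF q(1) _ that, of z] q(2) nv
    by (simp add: u_def ipr_scl_left v_def divide_right_mono)
  ultimately have G: "{x\<in>P. ipr n u x = ipr n u q} \<in> exposed_faces n P"
    unfolding exposed_faces_def by blast
  have "m \<le> edist n p q"
    using d(2)[OF G, of q] m(2)[OF G] q(1) by simp
  also have "\<dots> \<le> edist n p z + edist n z q"
    by (rule edist_triangle)
  also have "edist n z q \<le> edist n z y"
    using q(2) y(1) by blast
  also have "edist n z y \<le> edist n p z + edist n p y"
    using edist_triangle[of n z y p] edist_commute[of n z p] by simp
  finally show False
    using y(2) z(3) by linarith
qed

lemma facet_exposed: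
  assumes "facet_n n P F"
  shows "F \<in> exposed_faces n P" "aff_indep_pts n (n - 1) F"
proof -
  obtain u c where u: "u \<in> Rn n" "\<exists>i<n. u i \<noteq> 0" "\<forall>x\<in>P. ipr n u x \<le> c" "F = {x\<in>P. ipr n u x = c}"
    using assms unfolding facet_n_def by blast
  have nu: "0 < nrm n u"
    using nrm_eq_0[OF u(1)] u(2) by (auto simp: less_le)
  have "ipr n (radial n u) x = ipr n u x / nrm n u" for x
    by (simp add: radial_def ipr_scl_left)
  then have "\<forall>x\<in>P. ipr n (radial n u) x \<le> c / nrm n u" "F = {x\<in>P. ipr n (radial n u) x = c / nrm n u}"
    using u(3,4) nu by (auto simp: divide_right_mono)
  moreover have "ipr n (radial n u) (radial n u) = 1"
    using nrm_radial[of n u] nu by (simp add: nrm_eq_1)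
  ultimately show "F \<in> exposed_faces n P"
    using u(1) unfolding exposed_faces_def by (intro CollectI bexI[of _ "radial n u"] exI[of _ "c / nrm n u"]) auto
  show "aff_indep_pts n (n - 1) F"
    using assms by (simp add: facet_n_def)
qed

lemma facet_iff: "facet_n n P F \<longleftrightarrow> F \<in> exposed_faces n P \<and> aff_indep_pts n (n - 1) F"
proof
  assume F: "F \<in> exposed_faces n P \<and> aff_indep_pts n (n - 1) F"
  then obtain u c where u: "u \<in> Rn n" "ipr n u u = 1" "\<forall>x\<in>P. ipr n u x \<le> c" "F = {x\<in>P. ipr n u x = c}"
    unfolding exposed_faces_def by blast
  have "\<exists>i<n. u i \<noteq> 0"
  proof (rule ccontr)
    assume "\<not> ?thesis"
    then have "ipr n u u = 0" by (simp add: ipr_def)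
    then show False using u(2) by simp
  qed
  then show "facet_n n P F"
    using u F unfolding facet_n_def by blast
qed (auto dest: facet_exposed)

lemma hsf_non_facet_null:
  assumes "G \<in> exposed_faces n P" "\<not> facet_n n P G"
  shows "hsf n G = 0"
proof -
  obtain u c where u: "u \<in> Rn n" "ipr n u u = 1" "G = {x\<in>P. ipr n u x = c}"
    using assms(1) unfolding exposed_faces_def by blast
  obtain R where "\<And>x. x \<in> P \<Longrightarrow> nrm n x \<le> R"
    by (rule P_bounded) blast
  then show ?thesis
    using assms n u P_subset_Rn compact_imp_closed[OF exposed_face_compact[OF assms(1)]]
    by (intro hsf_degenerate_null[OF _ u(1,2), of G R c]) (auto simp: facet_iff)
qed

lemma hsf_exposed_face_finite:
  assumes "G \<in> exposed_faces n P"
  shows "hsf n G < top"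
proof -
  obtain u c where u: "u \<in> Rn n" "ipr n u u = 1" "G = {x\<in>P. ipr n u x = c}"
    using assms(1) unfolding exposed_faces_def by blast
  obtain R where "\<And>x. x \<in> P \<Longrightarrow> nrm n x \<le> R"
    by (rule P_bounded) blast
  then have "G \<subseteq> {x \<in> Rn n. ipr n u x = c \<and> nrm n x \<le> R}"
    using u(3) P_subset_Rn by auto
  then have "hsf n G \<le> hsf n {x \<in> Rn n. ipr n u x = c \<and> nrm n x \<le> R}"
    by (rule hausdorff_mono)
  also have "\<dots> < top"
    using n u by (intro hsf_disc_finite) auto
  finally show ?thesis .
qed

end

section \<open>Boundaries of the union and the intersection\<close>

lemma unit_ball_eq: "unit_ball n = {x \<in> Rn n. nrm n x \<le> 1}"
  by (simp add: unit_ball_def edist_def nrm_def ipr_def power2_eq_square)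

lemma bdry_near:
  assumes "x \<in> bdry n A" "0 < e"
  shows "\<exists>y\<in>A. edist n x y < e" "\<exists>z\<in>Rn n - A. edist n x z < e"
  using assms by (simp_all add: bdry_def)

lemma bdryI:
  assumes "x \<in> Rn n" "x \<in> A" "\<And>e. 0 < e \<Longrightarrow> \<exists>z\<in>Rn n - A. edist n x z < e"
  shows "x \<in> bdry n A"
proof -
  have "\<exists>y\<in>A. edist n x y < e" if "0 < e" for e
    using assms(2) that by (intro bexI[of _ x]) simp_all
  then show ?thesis
    using assms(1,3) by (simp add: bdry_def)
qed

lemma nrm_le_edist: "nrm n y \<le> nrm n x + edist n x y"
  using nrm_triangle[of n x "y - x"] by (simp add: edist_nrm nrm_minus_commute)

lemma bdry_unit_ball:
  assumes n: "1 \<le> n"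
  shows "bdry n (unit_ball n) = esphere n"
proof (intro equalityI subsetI)
  fix x assume x: "x \<in> bdry n (unit_ball n)"
  have "nrm n x \<le> 1 + e" if e: "0 < e" for e
  proof -
    obtain y where "y \<in> unit_ball n" "edist n x y < e"
      using bdry_near(1)[OF x e] by blast
    then show ?thesis
      using nrm_le_edist[of n x y] edist_commute[of n x y] by (simp add: unit_ball_eq)
  qed
  then have "nrm n x \<le> 1"
    by (rule field_le_epsilon)
  moreover have "\<not> nrm n x < 1"
  proof
    assume "nrm n x < 1"
    then have "0 < 1 - nrm n x" by simp
    then obtain z where "z \<in> Rn n - unit_ball n" "edist n x z < 1 - nrm n x"
      using bdry_near(2)[OF x] by blast
    then show False
      using nrm_le_edist[of n z x] by (simp add: unit_ball_eq)
  qed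
  ultimately show "x \<in> esphere n"
    using x by (auto simp: esphere_def bdry_def)
next
  fix x assume x: "x \<in> esphere n"
  show "x \<in> bdry n (unit_ball n)"
  proof (rule bdryI)
    fix e :: real assume "0 < e"
    then have "(1 + e / 2) \<cdot> x \<in> Rn n - unit_ball n"
      using x by (simp add: unit_ball_eq nrm_scl esphere_nrm esphere_Rn)
    moreover have "edist n ((1 + e / 2) \<cdot> x) x < e"
      using x \<open>0 < e\<close> by (simp add: edist_nrm scl_add_left nrm_scl esphere_nrm)
    then have "edist n x ((1 + e / 2) \<cdot> x) < e"
      by (subst edist_commute)
    ultimately show "\<exists>z\<in>Rn n - unit_ball n. edist n x z < e"
      by blast
  qed (use x in \<open>auto simp: unit_ball_eq esphere_def\<close>)
qed

lemma measurable_radial [measurable]: "radial n \<in> borel \<rightarrow>\<^sub>M borel"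
  by (rule measurable_coordinatewise_then_product) (simp add: radial_def)

lemma measurable_hproj [measurable]: "hproj n u h \<in> borel \<rightarrow>\<^sub>M borel"
  unfolding hproj_def by (intro borel_measurable_continuous_onI continuous_intros)

text \<open>The sets may overlap. Since the bound holds on every Borel part \<open>E\<close>, the
  induction can cut the union disjointly by passing from \<open>E\<close> to
  \<open>E - A i\<close>.\<close>

lemma hsf_image_finite_UN_le:
  assumes n: "1 \<le> n" and I: "finite I" and A: "\<And>i. i \<in> I \<Longrightarrow> A i \<subseteq> Rn n" "\<And>i. i \<in> I \<Longrightarrow> A i \<in> sets borel"
    and f: "\<And>i E. i \<in> I \<Longrightarrow> E \<in> sets borel \<Longrightarrow> hsf n (f ` (A i \<inter> E)) \<le> k * hsf n (A i \<inter> E)"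
    and E: "E \<in> sets borel"
  shows "hsf n (f ` ((\<Union>i\<in>I. A i) \<inter> E)) \<le> k * hsf n ((\<Union>i\<in>I. A i) \<inter> E)"
  using I A f E
proof (induction I arbitrary: E)
  case (insert i I)
  let ?U = "\<Union>i\<in>I. A i"
  have U: "?U \<in> sets borel"
    using insert by (intro sets.finite_UN) auto
  have "hsf n (f ` ((\<Union>i\<in>insert i I. A i) \<inter> E)) \<le> hsf n (f ` (A i \<inter> E) \<union> f ` (?U \<inter> (E - A i)))"
    by (rule hausdorff_mono) auto
  also have "\<dots> \<le> hsf n (f ` (A i \<inter> E)) + hsf n (f ` (?U \<inter> (E - A i)))"
    by (rule hausdorff_Un_le)
  also have "\<dots> \<le> k * hsf n (A i \<inter> E) + k * hsf n (?U \<inter> (E - A i))"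
    using insert by (intro add_mono insert.IH) auto
  also have "\<dots> = k * (hsf n (A i \<inter> E) + hsf n (?U \<inter> (E - A i)))"
    by (simp add: distrib_left)
  also have "hsf n (A i \<inter> E) + hsf n (?U \<inter> (E - A i)) = hsf n ((\<Union>i\<in>insert i I. A i) \<inter> E)"
  proof -
    have "hsf n ((\<Union>i\<in>insert i I. A i) \<inter> E) =
        hsf n ((\<Union>i\<in>insert i I. A i) \<inter> E \<inter> A i) + hsf n ((\<Union>i\<in>insert i I. A i) \<inter> E - A i)"
      using n insert.prems U by (intro hausdorff_add_borel) auto
    also have "(\<Union>i\<in>insert i I. A i) \<inter> E \<inter> A i = A i \<inter> E"
      by auto
    also have "(\<Union>i\<in>insert i I. A i) \<inter> E - A i = ?U \<inter> (E - A i)"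
      by auto
    finally show ?thesis by simp
  qed
  finally show ?case .
qed simp

context polytope
begin

lemma n_ge_1: "1 \<le> n" and dim_nonneg: "0 \<le> real n - 1"
  using n by simp_all

lemma distance_to_P:
  assumes "x \<in> Rn n" "x \<notin> P"
  obtains d where "0 < d" "\<And>y. y \<in> P \<Longrightarrow> d \<le> edist n x y"
proof (cases "P = {}")
  case False
  have "continuous_on P (\<lambda>y. edist n x y)"
    by (intro continuous_intros)
  then obtain y where y: "y \<in> P" "\<forall>z\<in>P. edist n x y \<le> edist n x z"
    using continuous_attains_inf[OF compact_P False] by blast
  have "edist n x y \<noteq> 0"
    using assms y(1) P_subset_Rn nrm_eq_0[of "x - y" n] by (auto simp: edist_nrm)
  then have "0 < edist n x y"
    by (simp add: less_le)
  then show ?thesis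
    using y(2) that by blast
qed (use that[of 1] in auto)

text \<open>Take the last parameter \<open>t\<close> for which \<open>t \<cdot> x\<close> is in
  \<open>P\<close>; compactness provides it, and \<open>t = 1\<close> is impossible because
  \<open>x\<close> is not a boundary point.\<close>

lemma exit_point:
  assumes x: "x \<in> esphere n" "x \<in> P" "x \<notin> bdry n P"
  obtains y where "y \<in> bdry n P" "1 < nrm n y" "radial n y = x"
proof -
  obtain R where R: "\<And>x. x \<in> P \<Longrightarrow> nrm n x \<le> R"
    by (rule P_bounded) blast
  have xR: "x \<in> Rn n" and nx: "nrm n x = 1"
    using x(1) by (simp_all add: esphere_def)
  have cont: "continuous_on A (\<lambda>t. t \<cdot> x)" for A
    by (intro continuous_intros)
  define T where "T = {1..R} \<inter> (\<lambda>t. t \<cdot> x) -` P"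
  have "closed T"
    unfolding T_def
    by (intro closed_Int closed_vimage closed_P cont closed_atLeastAtMost)
  then have "compact T"
    using compact_Int_closed[of "{1..R}" T] by (simp add: T_def Int_absorb1)
  moreover have "1 \<in> T"
    using x R[OF x(2)] nx by (simp add: T_def)
  ultimately obtain t where t: "t \<in> T" "\<And>s. s \<in> T \<Longrightarrow> s \<le> t"
    using compact_attains_sup[of T] by blast
  have out: "s \<cdot> x \<notin> P" if "t < s" for s
  proof
    assume P: "s \<cdot> x \<in> P"
    then have "s \<in> T"
      using t(1) that R[OF P] nx by (simp add: T_def nrm_scl)
    then show False
      using t(2) that by (meson not_le)
  qed
  have "t \<cdot> x \<in> bdry n P"
  proof (rule bdryI)
    fix e :: real assume e: "0 < e"
    have "edist n (t \<cdot> x) ((t + e / 2) \<cdot> x) < e"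
      using e nx by (simp add: edist_nrm nrm_scl scl_diff_left[symmetric])
    then show "\<exists>z\<in>Rn n - P. edist n (t \<cdot> x) z < e"
      using out[of "t + e / 2"] xR e by (intro bexI[of _ "(t + e / 2) \<cdot> x"]) auto
  qed (use t xR in \<open>auto simp: T_def\<close>)
  moreover have "1 < t"
    using t(1) calculation x(3) by (cases "t = 1") (auto simp: T_def)
  moreover have "radial n (t \<cdot> x) = x"
    using \<open>1 < t\<close> x(1) by (simp add: radial_scl radial_esphere)
  ultimately show ?thesis
    using that[of "t \<cdot> x"] nx by (simp add: nrm_scl)
qed

end

section \<open>The surface area deviation\<close>

text \<open>One supporting normal and height are fixed for each facet, so that there is one cap per
  facet.\<close>

locale polytope_with_caps = polytope +
  fixes \<delta> :: real and uf :: "(nat \<Rightarrow> real) set \<Rightarrow> nat \<Rightarrow> real" and hf :: "(nat \<Rightarrow> real) set \<Rightarrow> real"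
  assumes delta: "0 < \<delta>" "\<delta> \<le> 1 / 16"
    and uf: "facet_n n P F \<Longrightarrow> uf F \<in> Rn n \<and> ipr n (uf F) (uf F) = 1 \<and> (\<forall>x\<in>P. ipr n (uf F) x \<le> hf F) \<and>
      F = {x\<in>P. ipr n (uf F) x = hf F}"
begin

definition Fs :: "(nat \<Rightarrow> real) set set"
  where "Fs = {F. facet_n n P F}"

definition caps :: "(nat \<Rightarrow> real) set"
  where "caps = (\<Union>F\<in>Fs. {x \<in> esphere n. 1 - \<delta> < ipr n (uf F) x})"

definition outer :: "(nat \<Rightarrow> real) set"
  where "outer = esphere n - P"

text \<open>\<open>X F\<close> consists of the points of the sphere that lie above \<open>F \<inter> unit_ball n\<close> in the direction of the
  outer normal of \<open>F\<close>, and \<open>Y F\<close> of the points of \<open>F\<close> that lie radially above \<open>esphere n \<inter> P\<close>.\<close>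

definition X :: "(nat \<Rightarrow> real) set \<Rightarrow> (nat \<Rightarrow> real) set"
  where "X F = {x \<in> outer. hproj n (uf F) (hf F) x \<in> F \<and> nrm n (hproj n (uf F) (hf F) x) \<le> 1 \<and> hf F \<le> ipr n (uf F) x}"

definition Y :: "(nat \<Rightarrow> real) set \<Rightarrow> (nat \<Rightarrow> real) set"
  where "Y F = {y \<in> F. 1 < nrm n y \<and> radial n y \<in> P}"

definition YU :: "(nat \<Rightarrow> real) set"
  where "YU = (\<Union>F\<in>Fs. Y F)"

definition degenerate :: "(nat \<Rightarrow> real) set"
  where "degenerate = \<Union>{G \<in> exposed_faces n P. \<not> facet_n n P G}"

text \<open>The exceptional points: lower-dimensional faces, facet points on the sphere, and sphere
  points whose ray passes through a lower-dimensional face.\<close>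

definition null_part :: "(nat \<Rightarrow> real) set"
  where "null_part = degenerate \<union> (\<Union>F\<in>Fs. F \<inter> esphere n) \<union> radial n ` (degenerate \<inter> {x. 1 \<le> nrm n x})"

lemma finite_Fs: "finite Fs"
  by (rule finite_subset[OF _ finite_exposed_faces]) (auto simp: Fs_def dest: facet_exposed)

lemma unit_normal: "F \<in> Fs \<Longrightarrow> uf F \<in> Rn n" "F \<in> Fs \<Longrightarrow> ipr n (uf F) (uf F) = 1"
  and normal_le: "F \<in> Fs \<Longrightarrow> x \<in> P \<Longrightarrow> ipr n (uf F) x \<le> hf F"
  using uf by (auto simp: Fs_def)

lemma mem_facet: "F \<in> Fs \<Longrightarrow> x \<in> F \<longleftrightarrow> x \<in> P \<and> ipr n (uf F) x = hf F"
  using uf[of F] by (auto simp: Fs_def)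

lemma facet_subset_Rn: "F \<in> Fs \<Longrightarrow> F \<subseteq> Rn n"
  using mem_facet P_subset_Rn by blast

lemma borel_P [measurable]: "P \<in> sets borel"
  using closed_P by simp

lemma borel_facet: "F \<in> Fs \<Longrightarrow> F \<in> sets borel"
  using compact_imp_closed[OF exposed_face_compact[of F]] facet_exposed[of F] by (simp add: Fs_def)

lemma borel_outer [measurable]: "outer \<in> sets borel"
  unfolding outer_def by measurable

lemma borel_X:
  assumes "F \<in> Fs"
  shows "X F \<in> sets borel"
proof -
  have [measurable]: "F \<in> sets borel"
    using assms by (rule borel_facet)
  show ?thesis
    unfolding X_def by measurable
qed

lemma borel_Y:
  assumes "F \<in> Fs"
  shows "Y F \<in> sets borel"
proof -
  have [measurable]: "F \<in> sets borel"
    using assms by (rule borel_facet)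
  show ?thesis
    unfolding Y_def by measurable
qed

lemma borel_caps [measurable]: "caps \<in> sets borel"
  unfolding caps_def by (intro sets.finite_UN finite_Fs) measurable

lemma outer_subset: "outer \<subseteq> Rn n"
  by (auto simp: outer_def esphere_def)

lemma X_subset: "X F \<subseteq> outer"
  by (auto simp: X_def)

lemma Y_subset: "Y F \<subseteq> F"
  by (auto simp: Y_def)

lemma hproj_eq: "x = hproj n u h x + (ipr n u x - h) \<cdot> u"
  by (simp add: hproj_def)

lemma X_lift_pos:
  assumes F: "F \<in> Fs" and x: "x \<in> X F"
  shows "hf F < ipr n (uf F) x"
proof (rule ccontr)
  assume "\<not> ?thesis"
  then have "ipr n (uf F) x = hf F"
    using x by (simp add: X_def)
  then have "hproj n (uf F) (hf F) x = x"
    by (simp add: hproj_def)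
  then show False
    using x mem_facet[OF F] by (auto simp: X_def outer_def)
qed

text \<open>Write \<open>x = p + t \<cdot> uf F\<close> with \<open>p\<close> in the ball and
  \<open>t\<close> positive. Then \<open>1 = ipr n x p + t * ipr n x (uf F)\<close>, and the first
  summand is at most 1.\<close>

lemma X_normal_nonneg:
  assumes F: "F \<in> Fs" and x: "x \<in> X F"
  shows "0 \<le> ipr n (uf F) x"
proof -
  define p where "p = hproj n (uf F) (hf F) x"
  define t where "t = ipr n (uf F) x - hf F"
  have t: "0 < t"
    using X_lift_pos[OF F x] by (simp add: t_def)
  have x_eq: "x = p + t \<cdot> uf F"
    unfolding p_def t_def by (rule hproj_eq)
  have xx: "ipr n x x = 1" "nrm n x = 1"
    using x by (auto simp: X_def outer_def esphere_ipr esphere_nrm)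
  have "nrm n p \<le> 1"
    using x by (simp add: X_def p_def)
  then have "ipr n x p \<le> 1"
    using ipr_bound[of n x p] xx(2) by simp
  moreover have "ipr n x x = ipr n x p + t * ipr n x (uf F)"
    by (subst (2) x_eq) (simp add: ipr_add_right ipr_scl_right)
  ultimately have "0 \<le> t * ipr n (uf F) x"
    using xx(1) by (simp add: ipr_commute[of n x "uf F"])
  then show ?thesis
    using t by (simp add: zero_le_mult_iff)
qed

text \<open>The hyperplane projection of a point of \<open>X F\<close> is its nearest point in \<open>P\<close>, which determines \<open>F\<close>.\<close>

lemma X_disjoint: "disjoint_family_on X Fs"
  unfolding disjoint_family_on_def
proof (intro ballI impI equals0I)
  fix F G x assume F: "F \<in> Fs" and G: "G \<in> Fs" and "F \<noteq> G" and x: "x \<in> X F \<inter> X G"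
  define p where "p = hproj n (uf F) (hf F) x"
  define q where "q = hproj n (uf G) (hf G) x"
  define t where "t = ipr n (uf F) x - hf F"
  define s where "s = ipr n (uf G) x - hf G"
  have ts: "0 < t" "0 < s"
    using X_lift_pos[OF F, of x] X_lift_pos[OF G, of x] x by (auto simp: t_def s_def)
  have xp: "x - p = t \<cdot> uf F" and xq: "x - q = s \<cdot> uf G"
    by (simp_all add: p_def q_def t_def s_def hproj_def)
  have p: "p \<in> P" "ipr n (uf F) p = hf F" and q: "q \<in> P" "ipr n (uf G) q = hf G"
    using x mem_facet[OF F] mem_facet[OF G] by (auto simp: X_def p_def q_def)
  have "ipr n (x - p) (q - p) \<le> 0"
    using normal_le[OF F q(1)] p(2) ts by (simp add: xp ipr_scl_left ipr_diff_right mult_le_0_iff)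
  moreover have "ipr n (x - q) (p - q) \<le> 0"
    using normal_le[OF G p(1)] q(2) ts by (simp add: xq ipr_scl_left ipr_diff_right mult_le_0_iff)
  moreover have "ipr n (x - p) (q - p) + ipr n (x - q) (p - q) = ipr n (q - p) (q - p)"
    by (simp add: ipr_simps algebra_simps)
  ultimately have "ipr n (q - p) (q - p) \<le> 0"
    by linarith
  then have "nrm n (q - p) = 0"
    using ipr_self_nonneg[of n "q - p"] by (simp add: nrm_def)
  then have "q = p"
    using p(1) q(1) P_subset_Rn nrm_eq_0[of "q - p" n] by auto
  then have eq: "t \<cdot> uf F = s \<cdot> uf G"
    using xp xq by simp
  have "nrm n (t \<cdot> uf F) = t" "nrm n (s \<cdot> uf G) = s"
    using ts unit_normal(2)[OF F] unit_normal(2)[OF G] by (simp_all add: nrm_scl) (simp_all add: nrm_def)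
  then have "t = s"
    using eq by simp
  have "uf F = uf G"
  proof
    fix i
    have "t * uf F i = s * uf G i"
      using fun_cong[OF eq, of i] by simp
    then show "uf F i = uf G i"
      using \<open>t = s\<close> ts by simp
  qed
  moreover have "hf F = hf G"
    using p(2) q(2) \<open>q = p\<close> \<open>uf F = uf G\<close> by simp
  ultimately have "F = G"
    using mem_facet[OF F] mem_facet[OF G] by auto
  then show False
    using \<open>F \<noteq> G\<close> by simp
qed

text \<open>The ray from \<open>p\<close> along the outer normal meets the sphere at the positive
  root \<open>t\<close> of a quadratic equation. Beyond the supporting hyperplane it has left
  \<open>P\<close>.\<close>

lemma lift_to_sphere:
  assumes F: "F \<in> Fs" and p: "p \<in> F" "nrm n p < 1"
  shows "p \<in> hproj n (uf F) (hf F) ` X F"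
proof -
  let ?u = "uf F"
  define b where "b = ipr n ?u p"
  have b: "b = hf F" "p \<in> Rn n"
    using mem_facet[OF F] p(1) P_subset_Rn by (auto simp: b_def)
  have pp: "ipr n p p < 1"
    using p(2) by (simp add: nrm_def)
  define t where "t = sqrt (b\<^sup>2 + (1 - ipr n p p)) - b"
  have "sqrt (b\<^sup>2) < sqrt (b\<^sup>2 + (1 - ipr n p p))"
    using pp by (intro real_sqrt_less_mono) simp
  then have t: "0 < t"
    by (simp add: t_def)
  have "(t + b)\<^sup>2 = b\<^sup>2 + (1 - ipr n p p)"
    using pp by (simp add: t_def)
  then have tt: "t * t + 2 * (t * b) = 1 - ipr n p p"
    by (simp add: power2_eq_square algebra_simps)
  define x where "x = p + t \<cdot> ?u"
  have "ipr n x x = ipr n p p + (t * t + 2 * (t * b))"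
    using ipr_commute[of n p ?u]
    by (simp add: x_def ipr_simps unit_normal[OF F] b_def[symmetric] algebra_simps)
  then have "x \<in> esphere n"
    using tt b(2) unit_normal(1)[OF F] by (simp add: esphere_def nrm_eq_1 x_def)
  moreover have ux: "ipr n ?u x = hf F + t"
    by (simp add: x_def ipr_simps unit_normal[OF F] b(1)[symmetric] b_def)
  then have "x \<notin> P"
    using normal_le[OF F, of x] t by auto
  moreover have proj: "hproj n ?u (hf F) x = p"
    by (simp add: hproj_def ux) (simp add: x_def)
  ultimately have "x \<in> X F"
    using p t ux by (simp add: X_def outer_def)
  then show ?thesis
    using proj by blast
qed

lemma ennreal_delta: "ennreal (1 - \<delta>) + ennreal \<delta> = 1"
  using delta by (simp flip: ennreal_plus)

lemma hsf_X_le: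
  assumes F: "F \<in> Fs"
  shows "hsf n (hproj n (uf F) (hf F) ` X F) \<le> hsf n (X F \<inter> caps) + ennreal (1 - \<delta>) * hsf n (X F - caps)"
proof -
  let ?f = "hproj n (uf F) (hf F)"
  have "hsf n (?f ` X F) \<le> hsf n (?f ` (X F \<inter> caps) \<union> ?f ` (X F - caps))"
    by (rule hausdorff_mono) auto
  also have "\<dots> \<le> hsf n (?f ` (X F \<inter> caps)) + hsf n (?f ` (X F - caps))"
    by (rule hausdorff_Un_le)
  also have "\<dots> \<le> hsf n (X F \<inter> caps) + ennreal (1 - \<delta>) * hsf n (X F - caps)"
  proof (rule add_mono)
    show "hsf n (?f ` (X F \<inter> caps)) \<le> hsf n (X F \<inter> caps)"
      using X_subset outer_subset unit_normal[OF F]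
      by (intro hausdorff_nonexpansive_image dim_nonneg hproj_nonexpansive hproj_Rn) blast+
    show "hsf n (?f ` (X F - caps)) \<le> ennreal (1 - \<delta>) * hsf n (X F - caps)"
    proof (rule hsf_hproj_esphere_le)
      show "X F - caps \<subseteq> esphere n"
        by (auto simp: X_def outer_def)
      show "X F - caps \<in> sets borel"
        using borel_X[OF F] by (intro sets.Diff borel_caps)
      fix x assume x: "x \<in> X F - caps"
      then have "\<not> 1 - \<delta> < ipr n (uf F) x"
        using F by (auto simp: caps_def X_def outer_def)
      then show "0 \<le> ipr n (uf F) x \<and> ipr n (uf F) x \<le> 1 - \<delta>"
        using X_normal_nonneg[OF F] x by auto
    qed (use delta unit_normal[OF F] n_ge_1 in auto)
  qed
  finally show ?thesis .
qed

text \<open>The disjoint Borel sets \<open>X F\<close> have additive measure, and outside the caps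
  their images lose the fraction \<open>\<delta>\<close>. Points of \<open>outer\<close> in no
  \<open>X F\<close> have no image at all, so the gain may be stated for all of
  \<open>outer - caps\<close>.\<close>

lemma outer_estimate:
  "(\<Sum>F\<in>Fs. hsf n (hproj n (uf F) (hf F) ` X F)) + ennreal \<delta> * hsf n (outer - caps) \<le> hsf n outer"
proof -
  have sum_X: "(\<Sum>F\<in>Fs. hsf n (X F \<inter> E)) = hsf n ((\<Union>F\<in>Fs. X F) \<inter> E)" if E: "E \<in> sets borel" for E
  proof -
    have "hsf n (\<Union>F\<in>Fs. X F \<inter> E) = (\<Sum>F\<in>Fs. hsf n (X F \<inter> E))"
    proof (rule hausdorff_finite_sum_borel[OF dim_nonneg finite_Fs])
      show "X F \<inter> E \<subseteq> Rn n" for F using X_subset outer_subset by blast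
      show "X F \<inter> E \<in> sets borel" if "F \<in> Fs" for F
        using borel_X[OF that] E by (rule sets.Int)
      show "disjoint_family_on (\<lambda>F. X F \<inter> E) Fs"
        using X_disjoint unfolding disjoint_family_on_def by blast
    qed
    then show ?thesis by simp
  qed
  have "(\<Sum>F\<in>Fs. hsf n (hproj n (uf F) (hf F) ` X F)) \<le>
      (\<Sum>F\<in>Fs. hsf n (X F \<inter> caps) + ennreal (1 - \<delta>) * hsf n (X F \<inter> (- caps)))"
    using hsf_X_le by (intro sum_mono) (simp add: Diff_eq)
  also have "\<dots> = hsf n ((\<Union>F\<in>Fs. X F) \<inter> caps) + ennreal (1 - \<delta>) * hsf n ((\<Union>F\<in>Fs. X F) \<inter> (- caps))"
    using sum_X[of caps] sum_X[of "- caps"] by (simp add: sum.distrib sum_distrib_left[symmetric])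
  also have "\<dots> \<le> hsf n (outer \<inter> caps) + ennreal (1 - \<delta>) * hsf n (outer - caps)"
    using X_subset by (intro add_mono mult_left_mono hausdorff_mono) auto
  finally have "(\<Sum>F\<in>Fs. hsf n (hproj n (uf F) (hf F) ` X F)) + ennreal \<delta> * hsf n (outer - caps) \<le>
      hsf n (outer \<inter> caps) + (ennreal (1 - \<delta>) + ennreal \<delta>) * hsf n (outer - caps)"
    by (simp add: distrib_right add.assoc[symmetric] add_right_mono)
  also have "\<dots> = hsf n outer"
    unfolding ennreal_delta using hausdorff_add_borel[OF dim_nonneg outer_subset borel_outer borel_caps] by simp
  finally show ?thesis .
qed

lemma YU_subset: "YU \<subseteq> P"
  using Y_subset mem_facet by (fastforce simp: YU_def)

lemma borel_YU [measurable]: "YU \<in> sets borel"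
  unfolding YU_def by (intro sets.finite_UN finite_Fs borel_Y)

text \<open>Both \<open>y\<close> and \<open>radial n y\<close> lie in \<open>P\<close>, and
  \<open>y\<close> attains the bound \<open>hf F\<close>. So moving outwards along the ray does not
  decrease \<open>ipr n (uf F)\<close>.\<close>

lemma Y_normal_nonneg:
  assumes F: "F \<in> Fs" and y: "y \<in> Y F"
  shows "0 \<le> ipr n (uf F) (radial n y)"
proof -
  have ny: "1 < nrm n y" and "radial n y \<in> P" "y \<in> F"
    using y by (auto simp: Y_def)
  have "ipr n (uf F) (radial n y) \<le> hf F"
    using \<open>radial n y \<in> P\<close> by (rule normal_le[OF F])
  also have "hf F = ipr n (uf F) (nrm n y \<cdot> radial n y)"
    using mem_facet[OF F] \<open>y \<in> F\<close> ny by (subst nrm_scl_radial) auto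
  also have "\<dots> = nrm n y * ipr n (uf F) (radial n y)"
    by (rule ipr_scl_right)
  finally have "0 \<le> (nrm n y - 1) * ipr n (uf F) (radial n y)"
    by (simp add: left_diff_distrib)
  then show ?thesis
    using ny by (simp add: zero_le_mult_iff)
qed

lemma radial_Y_esphere: "y \<in> YU \<Longrightarrow> radial n y \<in> esphere n"
  using YU_subset P_subset_Rn nrm_radial[of n y] by (force simp: esphere_def YU_def Y_def)

text \<open>The gain is \<open>\<delta>\<close> times the measure of \<open>YU\<close> off the caps,
  and it is weakened to the radial image, which is not larger, so that it can be added on the sphere
  to that of \<open>outer_estimate\<close>. Facets may meet, hence the detour over
  \<open>hsf_image_finite_UN_le\<close>.\<close>

lemma inner_estimate:
  "hsf n (radial n ` YU) + ennreal \<delta> * hsf n (radial n ` YU - caps) \<le> hsf n YU"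
proof -
  define C' where "C' = radial n -` caps"
  have C': "C' \<in> sets borel"
    using measurable_sets[OF measurable_radial borel_caps] by (simp add: C'_def)
  have YR: "YU \<subseteq> Rn n"
    using YU_subset P_subset_Rn by blast
  define r where "r = hsf n (radial n ` (YU - C'))"
  have eq: "radial n ` YU - caps = radial n ` (YU - C')"
    by (auto simp: C'_def)
  have r: "r \<le> ennreal (1 - \<delta>) * hsf n (YU - C')"
  proof -
    have "hsf n (radial n ` ((\<Union>F\<in>Fs. Y F - C') \<inter> UNIV)) \<le> ennreal (1 - \<delta>) * hsf n ((\<Union>F\<in>Fs. Y F - C') \<inter> UNIV)"
    proof (rule hsf_image_finite_UN_le[OF n_ge_1 finite_Fs])
      show "Y F - C' \<subseteq> Rn n" if "F \<in> Fs" for F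
        using Y_subset facet_subset_Rn[OF that] by blast
      show borel: "Y F - C' \<in> sets borel" if "F \<in> Fs" for F
        using borel_Y[OF that] C' by (rule sets.Diff)
      fix F E assume F: "F \<in> Fs" and E: "E \<in> sets (borel :: (nat \<Rightarrow> real) measure)"
      show "hsf n (radial n ` ((Y F - C') \<inter> E)) \<le> ennreal (1 - \<delta>) * hsf n ((Y F - C') \<inter> E)"
      proof (rule hsf_radial_hyperplane_le)
        show "(Y F - C') \<inter> E \<subseteq> {y \<in> Rn n. ipr n (uf F) y = hf F \<and> 1 \<le> nrm n y}"
          using mem_facet[OF F] P_subset_Rn by (auto simp: Y_def)
        show "(Y F - C') \<inter> E \<in> sets borel"
          using borel[OF F] E by (rule sets.Int)
        fix y assume y: "y \<in> (Y F - C') \<inter> E"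
        have "radial n y \<in> esphere n"
          using y F by (intro radial_Y_esphere) (auto simp: YU_def)
        then have "\<not> 1 - \<delta> < ipr n (uf F) (radial n y)"
          using F y by (auto simp: caps_def C'_def)
        then show "0 \<le> ipr n (uf F) (radial n y) \<and> ipr n (uf F) (radial n y) \<le> 1 - \<delta>"
          using Y_normal_nonneg[OF F, of y] y by auto
      qed (use delta unit_normal[OF F] n_ge_1 in auto)
    qed simp
    moreover have "(\<Union>F\<in>Fs. Y F - C') = YU - C'"
      by (auto simp: YU_def)
    ultimately show ?thesis
      by (simp add: r_def)
  qed
  have "hsf n (radial n ` YU) \<le> hsf n (radial n ` (YU \<inter> C') \<union> radial n ` (YU - C'))"
    by (rule hausdorff_mono) auto
  also have "\<dots> \<le> hsf n (radial n ` (YU \<inter> C')) + r"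
    unfolding r_def by (rule hausdorff_Un_le)
  also have "hsf n (radial n ` (YU \<inter> C')) \<le> hsf n (YU \<inter> C')"
  proof (rule hausdorff_nonexpansive_image[OF dim_nonneg])
    fix x y assume "x \<in> YU \<inter> C'" "y \<in> YU \<inter> C'"
    then have "1 \<le> nrm n x" "1 \<le> nrm n y"
      by (auto simp: YU_def Y_def)
    then show "edist n (radial n x) (radial n y) \<le> edist n x y"
      by (rule radial_nonexpansive)
  qed (use YR in auto)
  finally have "hsf n (radial n ` YU) + ennreal \<delta> * r \<le> hsf n (YU \<inter> C') + r + ennreal \<delta> * r"
    by (simp add: add_right_mono)
  also have "\<dots> \<le> hsf n (YU \<inter> C') + ennreal (1 - \<delta>) * hsf n (YU - C') + ennreal \<delta> * hsf n (YU - C')"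
  proof (intro add_mono mult_left_mono)
    have "ennreal (1 - \<delta>) * hsf n (YU - C') \<le> 1 * hsf n (YU - C')"
      using delta by (intro mult_right_mono) auto
    then show "r \<le> hsf n (YU - C')"
      using r by simp
  qed (use r in auto)
  also have "\<dots> = hsf n (YU \<inter> C') + (ennreal (1 - \<delta>) + ennreal \<delta>) * hsf n (YU - C')"
    by (simp add: distrib_right add.assoc)
  also have "\<dots> = hsf n YU"
    unfolding ennreal_delta using hausdorff_add_borel[OF dim_nonneg YR borel_YU C'] by simp
  finally show ?thesis
    by (simp add: eq r_def)
qed

section \<open>Covering the boundaries up to null sets\<close>

lemma degenerate_subset: "degenerate \<subseteq> Rn n"
  using P_subset_Rn by (auto simp: degenerate_def exposed_faces_def)

lemma hsf_degenerate: "hsf n degenerate = 0"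
proof -
  let ?D = "{G \<in> exposed_faces n P. \<not> facet_n n P G}"
  have "hsf n (\<Union>G\<in>?D. G) \<le> (\<Sum>G\<in>?D. hsf n G)"
    using finite_exposed_faces by (intro hausdorff_finite_UN_le) simp
  also have "\<dots> = 0"
    using hsf_non_facet_null by (intro sum.neutral) blast
  finally show ?thesis
    by (simp add: degenerate_def)
qed

lemma hsf_null_part: "hsf n null_part = 0"
proof -
  have "hsf n (\<Union>F\<in>Fs. F \<inter> esphere n) \<le> (\<Sum>F\<in>Fs. hsf n (F \<inter> esphere n))"
    by (rule hausdorff_finite_UN_le[OF finite_Fs])
  also have "\<dots> = 0"
  proof (rule sum.neutral, rule ballI)
    fix F assume F: "F \<in> Fs"
    have "hsf n (F \<inter> esphere n) \<le> hsf n {x \<in> esphere n. ipr n (uf F) x = hf F}"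
      using mem_facet[OF F] by (intro hausdorff_mono) auto
    then show "hsf n (F \<inter> esphere n) = 0"
      using hsf_esphere_hyperplane[OF n_ge_1 unit_normal(1)[OF F] unit_normal(2)[OF F]] by simp
  qed
  finally have 1: "hsf n (\<Union>F\<in>Fs. F \<inter> esphere n) = 0"
    by simp
  have "hsf n (radial n ` (degenerate \<inter> {x. 1 \<le> nrm n x})) \<le> hsf n (degenerate \<inter> {x. 1 \<le> nrm n x})"
    using degenerate_subset by (intro hausdorff_nonexpansive_image dim_nonneg radial_nonexpansive) auto
  also have "\<dots> \<le> hsf n degenerate"
    by (rule hausdorff_mono) simp
  finally have 2: "hsf n (radial n ` (degenerate \<inter> {x. 1 \<le> nrm n x})) = 0"
    by (simp add: hsf_degenerate)
  have "hsf n null_part \<le> hsf n degenerate + hsf n (\<Union>F\<in>Fs. F \<inter> esphere n) +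
      hsf n (radial n ` (degenerate \<inter> {x. 1 \<le> nrm n x}))"
    unfolding null_part_def by (rule order_trans[OF hausdorff_Un_le add_right_mono[OF hausdorff_Un_le]])
  then show ?thesis
    unfolding 1 2 hsf_degenerate by simp
qed

lemma bdry_facet_or_degenerate:
  assumes "x \<in> bdry n P"
  obtains F where "F \<in> Fs" "x \<in> F" | "x \<in> degenerate"
proof -
  obtain G where G: "G \<in> exposed_faces n P" "x \<in> G"
    by (rule bdry_in_exposed_face[OF assms])
  show ?thesis
  proof (cases "facet_n n P G")
    case True
    then show ?thesis
      using G that(1)[of G] by (simp add: Fs_def)
  next
    case False
    then have "x \<in> degenerate"
      using G unfolding degenerate_def by blast
    then show ?thesis
      by (rule that(2))
  qed
qed

text \<open>A boundary point of \<open>P\<close> on the sphere is exceptional. From any other point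
  the ray leaves \<open>P\<close> later, through a facet or through an exceptional face.\<close>

lemma esphere_P_cover: "esphere n \<inter> P \<subseteq> radial n ` YU \<union> null_part"
proof
  fix x assume x: "x \<in> esphere n \<inter> P"
  show "x \<in> radial n ` YU \<union> null_part"
  proof (cases "x \<in> bdry n P")
    case True
    then show ?thesis
      by (rule bdry_facet_or_degenerate) (use x in \<open>auto simp: null_part_def\<close>)
  next
    case False
    then obtain y where y: "y \<in> bdry n P" "1 < nrm n y" "radial n y = x"
      using exit_point x by blast
    from y(1) show ?thesis
    proof (rule bdry_facet_or_degenerate)
      fix F assume "F \<in> Fs" "y \<in> F"
      then have "y \<in> YU"
        using y x by (auto simp: YU_def Y_def)
      then show ?thesis
        using y(3) by blast
    next
      assume "y \<in> degenerate"
      then have "y \<in> degenerate \<inter> {x. 1 \<le> nrm n x}"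
        using y(2) by simp
      then show ?thesis
        using y(3) unfolding null_part_def by blast
    qed
  qed
qed

lemma bdry_inter_cover:
  "bdry n (unit_ball n \<inter> P) \<subseteq> (\<Union>F\<in>Fs. hproj n (uf F) (hf F) ` X F) \<union> radial n ` YU \<union> null_part"
proof
  fix x assume x: "x \<in> bdry n (unit_ball n \<inter> P)"
  have xR: "x \<in> Rn n"
    using x by (simp add: bdry_def)
  have "nrm n x \<le> 1 + e" if e: "0 < e" for e
  proof -
    obtain y where "y \<in> unit_ball n \<inter> P" "edist n x y < e"
      using bdry_near(1)[OF x e] by blast
    then show ?thesis
      using nrm_le_edist[of n x y] edist_commute[of n x y] by (simp add: unit_ball_eq)
  qed
  then have nx: "nrm n x \<le> 1"
    by (rule field_le_epsilon)
  have xP: "x \<in> P"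
  proof (rule ccontr)
    assume "x \<notin> P"
    then obtain d where d: "0 < d" "\<And>y. y \<in> P \<Longrightarrow> d \<le> edist n x y"
      using distance_to_P[OF xR] by blast
    obtain y where "y \<in> unit_ball n \<inter> P" "edist n x y < d"
      using bdry_near(1)[OF x d(1)] by blast
    then show False
      using d(2)[of y] by simp
  qed
  show "x \<in> (\<Union>F\<in>Fs. hproj n (uf F) (hf F) ` X F) \<union> radial n ` YU \<union> null_part"
  proof (cases "nrm n x = 1")
    case True
    then have "x \<in> esphere n \<inter> P"
      using xR xP by (simp add: esphere_def)
    then show ?thesis
      using esphere_P_cover by blast
  next
    case False
    then have nx1: "nrm n x < 1" using nx by simp
    have "x \<in> bdry n P"
    proof (rule bdryI[OF xR xP])
      fix e :: real assume "0 < e"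
      then have "0 < min e (1 - nrm n x)" using nx1 by simp
      then obtain z where z: "z \<in> Rn n - unit_ball n \<inter> P" "edist n x z < min e (1 - nrm n x)"
        using bdry_near(2)[OF x] by blast
      have "z \<in> unit_ball n"
        using z nrm_le_edist[of n z x] by (simp add: unit_ball_eq)
      then show "\<exists>z\<in>Rn n - P. edist n x z < e"
        using z by (intro bexI[of _ z]) auto
    qed
    then show ?thesis
    proof (rule bdry_facet_or_degenerate)
      fix F assume "F \<in> Fs" "x \<in> F"
      then show ?thesis
        using lift_to_sphere[of F x] nx1 by blast
    qed (simp add: null_part_def)
  qed
qed

text \<open>Points are pushed out of both bodies, radially from \<open>outer\<close> and along the
  facet normal from \<open>YU\<close>. The union only needs a lower bound, so an inclusion
  suffices.\<close>

lemma outer_YU_subset_bdry_union: "outer \<union> YU \<subseteq> bdry n (unit_ball n \<union> P)"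
proof
  fix x assume "x \<in> outer \<union> YU"
  then show "x \<in> bdry n (unit_ball n \<union> P)"
  proof
    assume x: "x \<in> outer"
    then have xs: "x \<in> esphere n" and xR: "x \<in> Rn n" and xP: "x \<notin> P"
      using outer_subset by (auto simp: outer_def)
    obtain d where d: "0 < d" "\<And>y. y \<in> P \<Longrightarrow> d \<le> edist n x y"
      using distance_to_P[OF xR xP] by blast
    show ?thesis
    proof (rule bdryI[OF xR])
      show "x \<in> unit_ball n \<union> P"
        using xs by (simp add: unit_ball_eq esphere_def)
      fix e :: real assume e: "0 < e"
      define \<eta> where "\<eta> = min d e / 2"
      have \<eta>: "0 < \<eta>" "\<eta> < d" "\<eta> < e"
        using d(1) e by (auto simp: \<eta>_def)
      let ?z = "x + \<eta> \<cdot> x"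
      have dist: "edist n x ?z = \<eta>"
        using edist_commute[of n x ?z] \<eta>(1) esphere_nrm[OF xs] by (simp add: edist_nrm nrm_scl)
      have "?z = (1 + \<eta>) \<cdot> x"
        by (simp add: scl_add_left)
      then have "nrm n ?z = 1 + \<eta>"
        using \<eta>(1) esphere_nrm[OF xs] by (simp only: nrm_scl) simp
      then have "?z \<notin> unit_ball n"
        using \<eta>(1) by (simp add: unit_ball_eq)
      moreover have "?z \<notin> P"
        using d(2)[of ?z] dist \<eta>(2) by auto
      ultimately show "\<exists>z\<in>Rn n - (unit_ball n \<union> P). edist n x z < e"
        using dist \<eta>(3) xR by (intro bexI[of _ ?z]) auto
    qed
  next
    assume "x \<in> YU"
    then obtain F where F: "F \<in> Fs" and x: "x \<in> Y F"
      by (auto simp: YU_def)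
    have xP: "x \<in> P" and ux: "ipr n (uf F) x = hf F" and nx: "1 < nrm n x"
      using mem_facet[OF F] x by (auto simp: Y_def)
    have xR: "x \<in> Rn n"
      using xP P_subset_Rn by blast
    show ?thesis
    proof (rule bdryI[OF xR])
      show "x \<in> unit_ball n \<union> P"
        using xP by simp
      fix e :: real assume e: "0 < e"
      define \<eta> where "\<eta> = min (nrm n x - 1) e / 2"
      have \<eta>: "0 < \<eta>" "\<eta> < nrm n x - 1" "\<eta> < e"
        using nx e by (auto simp: \<eta>_def)
      let ?z = "x + \<eta> \<cdot> uf F"
      have "nrm n (uf F) = 1"
        using unit_normal(2)[OF F] by (simp add: nrm_def)
      then have dist: "edist n x ?z = \<eta>"
        using edist_commute[of n x ?z] \<eta>(1) by (simp add: edist_nrm nrm_scl)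
      have "?z \<notin> unit_ball n"
        using nrm_le_edist[of n x ?z] edist_commute[of n x ?z] dist \<eta>(2) by (simp add: unit_ball_eq)
      moreover have "ipr n (uf F) ?z = hf F + \<eta>"
        by (simp add: ipr_simps ux unit_normal(2)[OF F])
      then have "?z \<notin> P"
        using normal_le[OF F, of ?z] \<eta>(1) by auto
      ultimately show "\<exists>z\<in>Rn n - (unit_ball n \<union> P). edist n x z < e"
        using dist \<eta>(3) xR unit_normal(1)[OF F] by (intro bexI[of _ ?z]) auto
    qed
  qed
qed

text \<open>\<open>surf\<close> turns an infinite measure into 0, so finiteness is required before
  inequalities in \<open>ennreal\<close> say anything about \<open>Delta_s\<close>.\<close>

lemma hsf_bdry_union_finite: "hsf n (bdry n (unit_ball n \<union> P)) < top"
proof -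
  have "bdry n (unit_ball n \<union> P) \<subseteq> esphere n \<union> (\<Union>G\<in>exposed_faces n P. G)"
  proof
    fix x assume x: "x \<in> bdry n (unit_ball n \<union> P)"
    have xR: "x \<in> Rn n"
      using x by (simp add: bdry_def)
    have "\<not> nrm n x < 1"
    proof
      assume "nrm n x < 1"
      then have "0 < 1 - nrm n x" by simp
      then obtain z where "z \<in> Rn n - (unit_ball n \<union> P)" "edist n x z < 1 - nrm n x"
        using bdry_near(2)[OF x] by blast
      then show False
        using nrm_le_edist[of n z x] by (auto simp: unit_ball_eq)
    qed
    moreover have "x \<in> bdry n P" if nx: "1 < nrm n x"
    proof -
      have "\<exists>y\<in>P. edist n x y < e" "\<exists>z\<in>Rn n - P. edist n x z < e" if e: "0 < e" for e
      proof -
        have "0 < min e (nrm n x - 1)"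
          using nx e by simp
        then obtain y where y: "y \<in> unit_ball n \<union> P" "edist n x y < min e (nrm n x - 1)"
          using bdry_near(1)[OF x] by blast
        have "y \<notin> unit_ball n"
          using y(2) nrm_le_edist[of n x y] edist_commute[of n x y] by (simp add: unit_ball_eq)
        then show "\<exists>y\<in>P. edist n x y < e"
          using y by (intro bexI[of _ y]) auto
        show "\<exists>z\<in>Rn n - P. edist n x z < e"
          using bdry_near(2)[OF x e] by blast
      qed
      then show ?thesis
        using xR by (simp add: bdry_def)
    qed
    ultimately consider "x \<in> esphere n" | "x \<in> bdry n P"
      using xR by (fastforce simp: esphere_def)
    then show "x \<in> esphere n \<union> (\<Union>G\<in>exposed_faces n P. G)"
    proof cases
      case 2
      then show ?thesis
        by (rule bdry_in_exposed_face) blast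
    qed simp
  qed
  then have "hsf n (bdry n (unit_ball n \<union> P)) \<le> hsf n (esphere n) + (\<Sum>G\<in>exposed_faces n P. hsf n G)"
    by (rule order_trans[OF hausdorff_mono order_trans[OF hausdorff_Un_le add_left_mono[OF
          hausdorff_finite_UN_le[OF finite_exposed_faces]]]])
  also have "\<dots> < top"
    using hsf_esphere_finite[OF n_ge_1] finite_exposed_faces hsf_exposed_face_finite by simp
  finally show ?thesis .
qed

text \<open>The sum of \<open>outer_estimate\<close> and \<open>inner_estimate\<close>, using that
  \<open>outer\<close> and the radial image of \<open>YU\<close> cover the sphere up to a null set.
  The additive form avoids truncated subtraction in \<open>ennreal\<close>.\<close>

lemma surface_deviation_ge:
  "hsf n (bdry n (unit_ball n \<inter> P)) + ennreal \<delta> * hsf n (esphere n - caps) \<le> hsf n (bdry n (unit_ball n \<union> P))"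
proof -
  let ?XS = "\<Sum>F\<in>Fs. hsf n (hproj n (uf F) (hf F) ` X F)"
  have "hsf n (bdry n (unit_ball n \<inter> P)) \<le>
      hsf n ((\<Union>F\<in>Fs. hproj n (uf F) (hf F) ` X F) \<union> radial n ` YU) + hsf n null_part"
    by (rule order_trans[OF hausdorff_mono[OF bdry_inter_cover] hausdorff_Un_le])
  also have "\<dots> \<le> hsf n (\<Union>F\<in>Fs. hproj n (uf F) (hf F) ` X F) + hsf n (radial n ` YU)"
    by (simp add: hsf_null_part hausdorff_Un_le)
  also have "\<dots> \<le> ?XS + hsf n (radial n ` YU)"
    by (intro add_right_mono hausdorff_finite_UN_le finite_Fs)
  finally have 1: "hsf n (bdry n (unit_ball n \<inter> P)) \<le> ?XS + hsf n (radial n ` YU)" .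
  have "esphere n - caps \<subseteq> (outer - caps) \<union> ((radial n ` YU - caps) \<union> null_part)"
    using esphere_P_cover by (auto simp: outer_def)
  then have "hsf n (esphere n - caps) \<le> hsf n (outer - caps) + (hsf n (radial n ` YU - caps) + hsf n null_part)"
    by (rule order_trans[OF hausdorff_mono order_trans[OF hausdorff_Un_le add_left_mono[OF hausdorff_Un_le]]])
  then have 2: "ennreal \<delta> * hsf n (esphere n - caps) \<le>
      ennreal \<delta> * hsf n (outer - caps) + ennreal \<delta> * hsf n (radial n ` YU - caps)"
    by (simp add: hsf_null_part distrib_left[symmetric] mult_left_mono)
  have "hsf n (bdry n (unit_ball n \<inter> P)) + ennreal \<delta> * hsf n (esphere n - caps) \<le>
      (?XS + ennreal \<delta> * hsf n (outer - caps)) + (hsf n (radial n ` YU) + ennreal \<delta> * hsf n (radial n ` YU - caps))"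
    using add_mono[OF 1 2] by (simp add: add_ac)
  also have "\<dots> \<le> hsf n outer + hsf n YU"
    by (intro add_mono outer_estimate inner_estimate)
  also have "\<dots> = hsf n (outer \<union> YU)"
  proof -
    have "(outer \<union> YU) \<inter> outer = outer" "(outer \<union> YU) - outer = YU"
      using YU_subset by (auto simp: outer_def)
    moreover have "outer \<union> YU \<subseteq> Rn n"
      using outer_subset YU_subset P_subset_Rn by blast
    ultimately show ?thesis
      using hausdorff_add_borel[OF dim_nonneg, of "outer \<union> YU" n outer] by (simp add: sets.Un)
  qed
  also have "\<dots> \<le> hsf n (bdry n (unit_ball n \<union> P))"
    by (rule hausdorff_mono[OF outer_YU_subset_bdry_union])
  finally show ?thesis .
qed

section \<open>From the measure inequality to the deviation\<close>

lemma hsf_caps_le: "hsf n caps \<le> ennreal (real (card Fs) * (2 * sqrt \<delta>) powr (real n - 1)) * hsf n (esphere n)"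
proof -
  let ?k = "(2 * sqrt \<delta>) powr (real n - 1)"
  have "hsf n caps \<le> (\<Sum>F\<in>Fs. hsf n {x \<in> esphere n. 1 - \<delta> < ipr n (uf F) x})"
    unfolding caps_def by (rule hausdorff_finite_UN_le[OF finite_Fs])
  also have "\<dots> \<le> (\<Sum>F\<in>Fs. ennreal ?k * hsf n (esphere n))"
    using delta by (intro sum_mono hsf_cap_le n_ge_1 unit_normal) auto
  also have "\<dots> = ennreal (real (card Fs) * ?k) * hsf n (esphere n)"
    by (simp add: ennreal_mult ennreal_of_nat_eq_real_of_nat mult.assoc)
  finally show ?thesis .
qed

lemma Delta_s_ge:
  assumes small: "real (card Fs) * (2 * sqrt \<delta>) powr (real n - 1) \<le> 1 / 2"
  shows "\<delta> / 2 * surf n (bdry n (unit_ball n)) \<le> Delta_s n (unit_ball n) P"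
proof -
  define \<sigma> where "\<sigma> = enn2real (hsf n (esphere n))"
  have \<sigma>: "hsf n (esphere n) = ennreal \<sigma>" "0 \<le> \<sigma>"
    using hsf_esphere_finite[OF n_ge_1] by (simp_all add: \<sigma>_def)
  define a where "a = enn2real (hsf n (esphere n - caps))"
  have "hsf n (esphere n - caps) \<le> hsf n (esphere n)"
    by (rule hausdorff_mono) auto
  then have a: "hsf n (esphere n - caps) = ennreal a" "0 \<le> a"
    using hsf_esphere_finite[OF n_ge_1] by (simp_all add: a_def order_le_less_trans)
  define U where "U = enn2real (hsf n (bdry n (unit_ball n \<union> P)))"
  have U: "hsf n (bdry n (unit_ball n \<union> P)) = ennreal U" "0 \<le> U"
    using hsf_bdry_union_finite by (simp_all add: U_def)
  define K where "K = enn2real (hsf n (bdry n (unit_ball n \<inter> P)))"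
  have "hsf n (bdry n (unit_ball n \<inter> P)) \<le> hsf n (bdry n (unit_ball n \<union> P))"
    using surface_deviation_ge by (rule order_trans[rotated]) simp
  then have K: "hsf n (bdry n (unit_ball n \<inter> P)) = ennreal K" "0 \<le> K"
    using hsf_bdry_union_finite by (simp_all add: K_def order_le_less_trans)
  have "hsf n (esphere n) \<le> hsf n (esphere n - caps) + hsf n caps"
    by (rule order_trans[OF hausdorff_mono hausdorff_Un_le]) auto
  also have "\<dots> \<le> hsf n (esphere n - caps) + ennreal (1 / 2) * hsf n (esphere n)"
    using small by (intro add_left_mono order_trans[OF hsf_caps_le] mult_right_mono ennreal_leI) auto
  finally have "ennreal \<sigma> \<le> ennreal a + ennreal (1 / 2) * ennreal \<sigma>"
    unfolding \<sigma>(1) a(1) .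
  moreover have "ennreal (1 / 2 * \<sigma>) = ennreal (1 / 2) * ennreal \<sigma>"
    by (rule ennreal_mult) (use \<sigma> in auto)
  ultimately have "ennreal \<sigma> \<le> ennreal (a + 1 / 2 * \<sigma>)"
    using ennreal_plus[of a "1 / 2 * \<sigma>"] a(2) \<sigma>(2) by simp
  then have "\<sigma> / 2 \<le> a"
    using \<sigma>(2) a(2) by (subst (asm) ennreal_le_iff) auto
  then have "\<delta> * (\<sigma> / 2) \<le> \<delta> * a"
    using delta by (intro mult_left_mono) auto
  moreover have "ennreal (K + \<delta> * a) \<le> ennreal U"
    using surface_deviation_ge delta K(2) a(2) unfolding K(1) a(1) U(1) by (simp add: ennreal_plus ennreal_mult)
  then have "K + \<delta> * a \<le> U"
    using U(2) by (simp add: ennreal_le_iff)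
  ultimately show ?thesis
    by (simp add: Delta_s_def surf_def bdry_unit_ball[OF n_ge_1] \<sigma>_def[symmetric] U_def[symmetric] K_def[symmetric])
qed

end

theorem theorem2:
  shows "\<exists>c>0. \<exists>M0::nat. \<forall>n\<ge>2. \<forall>M\<ge>M0. \<forall>P.
           polytope_n n P \<and> has_interior n P \<and> card {F. facet_n n P F} \<le> M \<longrightarrow>
           Delta_s n (unit_ball n) P \<ge>
             c * surf n (bdry n (unit_ball n)) / real M powr (2 / (real n - 1))"
\<comment> \<open>\<open>1 / 32\<close> is the factor \<open>1 / 16\<close> of
  \<open>\<delta>\<close> times the half of the sphere that the caps leave. \<open>M \<ge> 1\<close>
  makes the negative power of \<open>M\<close> at most 1, hence
  \<open>\<delta> \<le> 1 / 16\<close>.\<close>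
proof (intro exI[of _ "1 / 32 :: real"] conjI exI[of _ "1 :: nat"] allI impI)
  fix n M :: nat and P
  assume n: "2 \<le> n" and M: "1 \<le> M"
    and PM: "polytope_n n P \<and> has_interior n P \<and> card {F. facet_n n P F} \<le> M"
  obtain S where S: "finite S" "S \<subseteq> Rn n"
      "P = {x. \<exists>w. (\<forall>s\<in>S. 0 \<le> w s) \<and> sum w S = 1 \<and> x = (\<lambda>i. \<Sum>s\<in>S. w s * s i)}"
    using PM unfolding polytope_n_def by blast
  interpret polytope n P S
    by (rule polytope.intro[OF n S])
  define m where "m = real n - 1"
  have m: "1 \<le> m"
    using n by (simp add: m_def)
  \<comment> \<open>Chosen so that \<open>2 * sqrt \<delta>\<close> is half of
    \<open>real M powr (- (1 / m))\<close>. Its power \<open>m\<close> is then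
    \<open>(1 / 2) powr m / M\<close>, so \<open>M\<close> caps fill at most half of the sphere
    because \<open>m \<ge> 1\<close>.\<close>
  define \<delta> where "\<delta> = 1 / 16 * real M powr (- (2 / m))"
  have "real M powr (- (2 / m)) \<le> real M powr 0"
    using M m by (intro powr_mono) auto
  then have \<delta>: "0 < \<delta>" "\<delta> \<le> 1 / 16"
    using M by (simp_all add: \<delta>_def)
  define supports where "supports F u h \<longleftrightarrow> u \<in> Rn n \<and> ipr n u u = 1 \<and> (\<forall>x\<in>P. ipr n u x \<le> h) \<and>
      F = {x\<in>P. ipr n u x = h}" for F u h
  have "\<exists>u h. facet_n n P F \<longrightarrow> supports F u h" for F
    using facet_exposed(1)[of F] unfolding exposed_faces_def supports_def by blast
  then obtain uf hf where uf: "\<And>F. facet_n n P F \<longrightarrow> supports F (uf F) (hf F)"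
    by metis
  interpret polytope_with_caps n P S \<delta> uf hf
    by unfold_locales (use \<delta> uf in \<open>simp_all add: supports_def\<close>)
  have "sqrt \<delta> = 1 / 4 * real M powr (- (1 / m))"
  proof (rule real_sqrt_unique)
    show "(1 / 4 * real M powr (- (1 / m)))\<^sup>2 = \<delta>"
      using M by (simp add: \<delta>_def power2_eq_square flip: powr_add)
  qed simp
  then have sqrt2: "2 * sqrt \<delta> = 1 / 2 * real M powr (- (1 / m))"
    by simp
  have "(2 * sqrt \<delta>) powr m = (1 / 2) powr m * (real M powr (- (1 / m))) powr m"
    unfolding sqrt2 by (simp only: powr_mult)
  also have "(real M powr (- (1 / m))) powr m = 1 / real M"
  proof -
    have "(real M powr (- (1 / m))) powr m = real M powr (- 1)"
      using m by (simp only: powr_powr) simp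
    then show ?thesis
      using M by (simp add: powr_minus_divide)
  qed
  also have "(1 / 2) powr m \<le> (1 / 2 :: real) powr 1"
    using m by (intro powr_mono') auto
  finally have "(2 * sqrt \<delta>) powr m \<le> 1 / 2 * (1 / real M)"
    using M by (simp add: divide_right_mono)
  moreover have "real (card Fs) \<le> real M"
    using PM unfolding Fs_def by simp
  ultimately have "real (card Fs) * (2 * sqrt \<delta>) powr m \<le> real M * (1 / 2 * (1 / real M))"
    by (intro mult_mono) auto
  also have "\<dots> = 1 / 2"
    using M by simp
  finally have "\<delta> / 2 * surf n (bdry n (unit_ball n)) \<le> Delta_s n (unit_ball n) P"
    unfolding m_def by (rule Delta_s_ge)
  then show "1 / 32 * surf n (bdry n (unit_ball n)) / real M powr (2 / (real n - 1)) \<le> Delta_s n (unit_ball n) P"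
    by (simp add: \<delta>_def m_def powr_minus_divide)
qed simp

end
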